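(* Let $\mathbf{G}$ be a Carnot group, let $\Omega\subset\mathbf{G}$ be a bounded domain, and let $u\in C(\Omega)$ be real-valued. Then the following statements are equivalent: (a) $u$ is v-convex on $\Omega$. (b) For any subdomain $\tilde\Omega\subset\subset\Omega$, there exists a sequence $\{u_k\}\subset\Gamma^2(\tilde\Omega)$ such that each $u_k$ is v-convex on $\tilde\Omega$ and $u_k\to u$ uniformly on $\tilde\Omega$. (c) For any subdomain $\tilde\Omega\subset\subset\Omega$, there exists a sequence $\{u_k\}\subset\Gamma^2(\tilde\Omega)$ such that each $u_k$ is h-convex on $\tilde\Omega$ and $u_k\to u$ uniformly on $\tilde\Omega$.
   Context: A Carnot group of step $r\ge 1$ is a simply connected Lie group $\mathbf{G}$ whose (finite-dimensional real) Lie algebra admits a vector space decomposition $\mathfrak{g}=V_1\oplus\cdots\oplus V_r$ with $[V_1,V_j]=V_{j+1}$ for $j=1,\dots,r-1$ and $[V_j,V_r]=0$ for $j=1,\dots,r$. The exponential map $\exp:\mathfrak{g}\to\mathbf{G}$ is a global diffeomorphism. Fix an inner product on $\mathfrak{g}$ for which the $V_j$ are mutually orthogonal, let $m=\dim V_1$, and let $X_1,\dots,X_m$ be a fixed orthonormal basis of $V_1$, regarded as left-invariant vector fields on $\mathbf{G}$. For a domain $\Omega\subset\mathbf{G}$, $\Gamma^2(\Omega)$ denotes the horizontal $C^2$ space: the continuous functions $u:\Omega\to\mathbb{R}$ whose horizontal derivatives $X_iu$ and $X_iX_ju$, $1\le i,j\le m$, exist and are continuous on $\Omega$. For a sufficiently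 regular function $\phi$, the horizontal hessian is $\nabla_h^2\phi=\left(\tfrac{X_iX_j+X_jX_i}{2}\phi\right)_{1\le i,j\le m}$. The notation $\tilde\Omega\subset\subset\Omega$ means that the closure of $\tilde\Omega$ is compact and contained in $\Omega$. v-convexity: for a domain $\Omega\subset\mathbf{G}$, an upper semicontinuous function $u:\Omega\to\mathbb{R}$ is v-convex (convex in the viscosity sense) on $\Omega$ if for every $\xi\in\mathbb{R}^m$, every $p\in\Omega$ and every $\phi\in C^2(\Omega)$ touching $u$ from above at $p$ (i.e. $\phi(p)=u(p)$ and $\phi\ge u$ in a neighborhood of $p$), one has $\xi^T\nabla_h^2\phi(p)\,\xi=\sum_{i,j=1}^m\xi_i\xi_jX_iX_j\phi(p)\ge 0$. h-convexity: for $p\in\mathbf{G}$, the horizontal plane at $p$ is $H_p(\mathbf{G})=\{p\cdot\exp(\xi):\xi\in V_1\}$. For $q=p\cdot\exp(\xi)\in H_p(\mathbf{G})$ with $\xi\in V_1$, the horizontal segment joining $p$ and $q$ is $[p,q]=\{p\cdot\exp(t\xi):t\in[0,1]\}$. A function $u:\Omega\to\mathbb{R}$ on a domain $\Omega\subset\mathbf{G}$ is h-convex (horizontally convex) on $\Omega$ if for all $p\in\Omega$ and $q=p\cdot\exp(\xi)\in H_p(\mathbf{G})\cap\Omega$ with $[p,q]\subset\Omega$, the restriction $u|_{[p,q]}$ is convex, i.e. $t\mapsto u(p\cdot\exp(t\xi))$ is convex on $[0,1]$. *)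

theory Defs
  imports "HOL-Analysis.Analysis" "HOL-Algebra.Group"
begin

section \<open>Smooth manifolds\<close>

text \<open>\<open>Ck_on k S f\<close> is meant for open \<open>S\<close>. A map is \<open>C\<^sup>k\<^sup>+\<^sup>1\<close> iff it is differentiable and
  all its directional derivatives are \<open>C\<^sup>k\<close>.\<close>

primrec Ck_on :: "nat \<Rightarrow> 'a::euclidean_space set \<Rightarrow> ('a \<Rightarrow> 'b::real_normed_vector) \<Rightarrow> bool" where
  "Ck_on 0 S f \<longleftrightarrow> continuous_on S f"
| "Ck_on (Suc k) S f \<longleftrightarrow>
     (\<forall>x\<in>S. f differentiable (at x)) \<and> (\<forall>v. Ck_on k S (\<lambda>x. frechet_derivative f (at x) v))"

definition smooth_on :: "'a::euclidean_space set \<Rightarrow> ('a \<Rightarrow> 'b::real_normed_vector) \<Rightarrow> bool" where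
  "smooth_on S f \<longleftrightarrow> (\<forall>k. Ck_on k S f)"

text \<open>A chart is a pair \<open>(U, \<phi>)\<close>; the values of \<open>\<phi>\<close> outside \<open>U\<close> are irrelevant.
  The manifold is the whole type \<open>'g\<close>, with model space \<open>'v\<close>.\<close>

type_synonym ('g, 'v) chart = "'g set \<times> ('g \<Rightarrow> 'v)"

definition chart_inv :: "('g, 'v) chart \<Rightarrow> 'v \<Rightarrow> 'g" where
  "chart_inv c = inv_into (fst c) (snd c)"

definition is_chart :: "('g::topological_space, 'v::euclidean_space) chart \<Rightarrow> bool" where
  "is_chart c \<longleftrightarrow> open (fst c) \<and> open (snd c ` fst c) \<and>
     homeomorphism (fst c) (snd c ` fst c) (snd c) (chart_inv c)"

definition smooth_atlas :: "('g::topological_space, 'v::euclidean_space) chart set \<Rightarrow> bool" where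
  "smooth_atlas A \<longleftrightarrow> (\<forall>c\<in>A. is_chart c) \<and> (\<Union>c\<in>A. fst c) = UNIV \<and>
     (\<forall>c\<in>A. \<forall>d\<in>A. smooth_on (snd c ` (fst c \<inter> fst d)) (snd d \<circ> chart_inv c))"

definition product_atlas ::
    "('g, 'v) chart set \<Rightarrow> ('h, 'w) chart set \<Rightarrow> ('g \<times> 'h, 'v \<times> 'w) chart set" where
  "product_atlas A B = {(fst c \<times> fst d, map_prod (snd c) (snd d)) | c d. c \<in> A \<and> d \<in> B}"

definition smooth_map ::
    "('g::topological_space, 'v::euclidean_space) chart set \<Rightarrow>
     ('h::topological_space, 'w::euclidean_space) chart set \<Rightarrow> ('g \<Rightarrow> 'h) \<Rightarrow> bool" where
  "smooth_map A B f \<longleftrightarrow> continuous_on UNIV f \<and>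
     (\<forall>c\<in>A. \<forall>d\<in>B. smooth_on (snd c ` (fst c \<inter> f -` fst d)) (snd d \<circ> f \<circ> chart_inv c))"

definition Ck_fun ::
    "('g::topological_space, 'v::euclidean_space) chart set \<Rightarrow> nat \<Rightarrow> 'g set \<Rightarrow> ('g \<Rightarrow> real) \<Rightarrow> bool" where
  "Ck_fun A k S f \<longleftrightarrow> (\<forall>c\<in>A. Ck_on k (snd c ` (fst c \<inter> S)) (f \<circ> chart_inv c))"

section \<open>Lie groups and Carnot groups\<close>

locale lie_group = group G for G :: "'g::{t2_space, second_countable_topology} monoid" (structure) +
  fixes A :: "('g, 'v::euclidean_space) chart set"
  assumes carrier_UNIV: "carrier G = UNIV"
    and atlas: "smooth_atlas A"
    and smooth_mult: "smooth_map (product_atlas A A) A (\<lambda>(p, q). p \<otimes> q)"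
    and smooth_inv: "smooth_map A A (\<lambda>p. inv p)"

text \<open>The Lie algebra is the tangent space at the identity, identified with the Euclidean space
  \<open>'v\<close> through the differential of a chart \<open>\<kappa>\<close> around the identity. (Composing \<open>\<kappa>\<close> with a linear
  isomorphism realises every inner product on the Lie algebra as the inner product of \<open>'v\<close>.)
  The exponential map is the unique map \<open>E\<close> such that, for each \<open>v\<close>, the curve \<open>t \<mapsto> E (t v)\<close>
  is the one-parameter subgroup with initial velocity \<open>v\<close>.\<close>

definition exponential_map ::
    "('g::topological_space) monoid \<Rightarrow> ('g, 'v::euclidean_space) chart \<Rightarrow> ('v \<Rightarrow> 'g) \<Rightarrow> bool" where
  "exponential_map G \<kappa> E \<longleftrightarrow>
     (\<forall>v. continuous_on UNIV (\<lambda>t::real. E (t *\<^sub>R v)) \<and>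
          (\<forall>s t::real. E ((s + t) *\<^sub>R v) = E (s *\<^sub>R v) \<otimes>\<^bsub>G\<^esub> E (t *\<^sub>R v)) \<and>
          ((\<lambda>t. snd \<kappa> (E (t *\<^sub>R v))) has_vector_derivative v) (at 0))"

text \<open>The left-invariant vector field determined by \<open>v\<close>, acting on a function \<open>f\<close>: its integral
  curve through \<open>p\<close> is \<open>t \<mapsto> p \<cdot> E (t v)\<close>.\<close>

definition left_inv_field ::
    "'g monoid \<Rightarrow> ('v::real_vector \<Rightarrow> 'g) \<Rightarrow> 'v \<Rightarrow> ('g \<Rightarrow> real) \<Rightarrow> 'g \<Rightarrow> real" where
  "left_inv_field G E v f p = deriv (\<lambda>t. f (p \<otimes>\<^bsub>G\<^esub> E (t *\<^sub>R v))) 0"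

definition lie_bracket ::
    "('g::topological_space) monoid \<Rightarrow> ('g, 'v::euclidean_space) chart set \<Rightarrow> ('v \<Rightarrow> 'g) \<Rightarrow> 'v \<Rightarrow> 'v \<Rightarrow> 'v" where
  "lie_bracket G A E v w = (THE z. \<forall>f. (\<forall>k. Ck_fun A k UNIV f) \<longrightarrow>
     (\<forall>p. left_inv_field G E z f p =
        left_inv_field G E v (left_inv_field G E w f) p -
        left_inv_field G E w (left_inv_field G E v f) p))"

text \<open>Since the layers are pairwise orthogonal, \<open>layers_span\<close> says that the Lie algebra is their
  direct sum.\<close>

locale carnot_group = lie_group G A
  for G :: "'g::{t2_space, second_countable_topology} monoid" (structure)
    and A :: "('g, 'v::euclidean_space) chart set" +
  fixes \<kappa> :: "('g, 'v) chart" and E :: "'v \<Rightarrow> 'g" and r :: nat and V :: "nat \<Rightarrow> 'v set"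
  assumes simply_connected: "simply_connected (UNIV :: 'g set)"
    and chart_at_one: "\<kappa> \<in> A" "\<one> \<in> fst \<kappa>"
    and exponential: "exponential_map G \<kappa> E"
    and step: "r \<ge> 1"
    and layer_subspace: "j \<in> {1..r} \<Longrightarrow> subspace (V j)"
    and layers_orthogonal:
      "\<lbrakk>i \<in> {1..r}; j \<in> {1..r}; i \<noteq> j; v \<in> V i; w \<in> V j\<rbrakk> \<Longrightarrow> v \<bullet> w = 0"
    and layers_span: "span (\<Union>j\<in>{1..r}. V j) = UNIV"
    and layer_bracket:
      "j \<in> {1..<r} \<Longrightarrow> span {lie_bracket G A E v w | v w. v \<in> V 1 \<and> w \<in> V j} = V (Suc j)"
    and top_layer_central:
      "\<lbrakk>j \<in> {1..r}; v \<in> V j; w \<in> V r\<rbrakk> \<Longrightarrow> lie_bracket G A E v w = 0"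

definition orthonormal_basis :: "'v::euclidean_space set \<Rightarrow> ('m::finite \<Rightarrow> 'v) \<Rightarrow> bool" where
  "orthonormal_basis W X \<longleftrightarrow>
     (\<forall>i j. X i \<bullet> X j = (if i = j then 1 else 0)) \<and> span (range X) = W"

section \<open>Domains and horizontal regularity\<close>

definition open_domain :: "'g::topological_space set \<Rightarrow> bool" where
  "open_domain S \<longleftrightarrow> open S \<and> connected S \<and> S \<noteq> {}"

text \<open>Boundedness is read in exponential coordinates; by properness this agrees with boundedness
  for any left-invariant Riemannian or Carnot-Caratheodory distance.\<close>

definition bounded_in_group :: "('v::euclidean_space \<Rightarrow> 'g) \<Rightarrow> 'g set \<Rightarrow> bool" where
  "bounded_in_group E S \<longleftrightarrow> bounded (E -` S)"

definition compactly_contained :: "'g::topological_space set \<Rightarrow> 'g set \<Rightarrow> bool" where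
  "compactly_contained T S \<longleftrightarrow> compact (closure T) \<and> closure T \<subseteq> S"

text \<open>Functions on \<open>S\<close> are total functions of which only the values on \<open>S\<close> matter;
  as \<open>S\<close> is open, the derivatives at points of \<open>S\<close> depend on these values only.\<close>

definition has_field_on ::
    "'g monoid \<Rightarrow> ('v::real_vector \<Rightarrow> 'g) \<Rightarrow> 'v \<Rightarrow> 'g set \<Rightarrow> ('g \<Rightarrow> real) \<Rightarrow> bool" where
  "has_field_on G E v S f \<longleftrightarrow>
     (\<forall>p\<in>S. (\<lambda>t::real. f (p \<otimes>\<^bsub>G\<^esub> E (t *\<^sub>R v))) differentiable (at 0))"

definition Gamma2 ::
    "('g::topological_space) monoid \<Rightarrow> ('v::real_vector \<Rightarrow> 'g) \<Rightarrow> ('m \<Rightarrow> 'v) \<Rightarrow> 'g set \<Rightarrow> ('g \<Rightarrow> real) \<Rightarrow> bool" where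
  "Gamma2 G E X S u \<longleftrightarrow> continuous_on S u \<and>
     (\<forall>i. has_field_on G E (X i) S u \<and> continuous_on S (left_inv_field G E (X i) u)) \<and>
     (\<forall>i j. has_field_on G E (X i) S (left_inv_field G E (X j) u) \<and>
        continuous_on S (left_inv_field G E (X i) (left_inv_field G E (X j) u)))"

definition horizontal_hessian ::
    "'g monoid \<Rightarrow> ('v::real_vector \<Rightarrow> 'g) \<Rightarrow> ('m::finite \<Rightarrow> 'v) \<Rightarrow> ('g \<Rightarrow> real) \<Rightarrow> 'g \<Rightarrow> real^'m^'m" where
  "horizontal_hessian G E X f p =
     (\<chi> i j. (left_inv_field G E (X i) (left_inv_field G E (X j) f) p +
              left_inv_field G E (X j) (left_inv_field G E (X i) f) p) / 2)"

section \<open>Notions of convexity\<close>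

definition upper_semicontinuous_on :: "'g::topological_space set \<Rightarrow> ('g \<Rightarrow> real) \<Rightarrow> bool" where
  "upper_semicontinuous_on S u \<longleftrightarrow>
     (\<forall>p\<in>S. \<forall>a. u p < a \<longrightarrow> (\<forall>\<^sub>F q in at p within S. u q < a))"

definition touches_above :: "('g::topological_space \<Rightarrow> real) \<Rightarrow> ('g \<Rightarrow> real) \<Rightarrow> 'g \<Rightarrow> bool" where
  "touches_above \<phi> u p \<longleftrightarrow> \<phi> p = u p \<and> (\<forall>\<^sub>F q in nhds p. u q \<le> \<phi> q)"

definition v_convex_on ::
    "('g::topological_space) monoid \<Rightarrow> ('g, 'v::euclidean_space) chart set \<Rightarrow> ('v \<Rightarrow> 'g) \<Rightarrow>
     ('m::finite \<Rightarrow> 'v) \<Rightarrow> 'g set \<Rightarrow> ('g \<Rightarrow> real) \<Rightarrow> bool" where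
  "v_convex_on G A E X S u \<longleftrightarrow> upper_semicontinuous_on S u \<and>
     (\<forall>\<xi> :: real^'m. \<forall>p\<in>S. \<forall>\<phi>. Ck_fun A 2 S \<phi> \<and> touches_above \<phi> u p \<longrightarrow>
        \<xi> \<bullet> (horizontal_hessian G E X \<phi> p *v \<xi>) \<ge> 0)"

definition horizontal_segment ::
    "'g monoid \<Rightarrow> ('v::real_vector \<Rightarrow> 'g) \<Rightarrow> 'g \<Rightarrow> 'v \<Rightarrow> 'g set" where
  "horizontal_segment G E p \<xi> = {p \<otimes>\<^bsub>G\<^esub> E (t *\<^sub>R \<xi>) | t::real. t \<in> {0..1}}"

text \<open>Here \<open>W\<close> is the first layer \<open>V 1\<close>. The endpoints \<open>p\<close> and \<open>p \<cdot> E \<xi>\<close> belong to the segment,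
  so that they lie in \<open>S\<close> need not be required separately.\<close>

definition h_convex_on ::
    "'g monoid \<Rightarrow> ('v::real_vector \<Rightarrow> 'g) \<Rightarrow> 'v set \<Rightarrow> 'g set \<Rightarrow> ('g \<Rightarrow> real) \<Rightarrow> bool" where
  "h_convex_on G E W S u \<longleftrightarrow>
     (\<forall>p\<in>S. \<forall>\<xi>\<in>W. horizontal_segment G E p \<xi> \<subseteq> S \<longrightarrow>
        convex_on {0..1} (\<lambda>t::real. u (p \<otimes>\<^bsub>G\<^esub> E (t *\<^sub>R \<xi>))))"

end

theory Submission
  imports Defs
begin

text \<open>
  The heart of the matter is that, for a continuous function on an open set, v-convexity and
  h-convexity are the same condition. Once this is known, (b) and (c) are the same
  statement. Moreover h-convexity is a family of linear inequalities between values of the function,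
  unlike the definition of v-convexity by test functions. It therefore passes to pointwise limits
  (\<open>h_convex_limit\<close>), which gives (a) from (c), and to averages, which gives (c) from (a).

  One half of the comparison is immediate: a test function \<open>\<phi>\<close> above an h-convex function dominates a
  convex function on each horizontal line through the point of contact, so its second derivative
  along this line, which is the quadratic form of the horizontal hessian, is nonnegative
  (\<open>locally_h_convex_imp_v_convex\<close>).

  For the other half, suppose that \<open>t \<mapsto> u (p E (t v))\<close> is not convex. Then some
  strictly concave parabola \<open>q\<close>, shifted by a constant, touches this function from above at an
  interior point. The curve is embedded in the family of its left translates \<open>p \<omega> E (t v)\<close>, and
  \<open>u (p \<omega> E (t v)) - q t - N \<bar>\<omega>\<bar>\<^sup>2\<close> is maximised over \<open>(\<omega>, t)\<close>; for large \<open>N\<close> the maximum is interior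
  (\<open>penalised_interior_maximum\<close>). The factorisation \<open>x = p \<omega> E (t v)\<close> is not unique, and each smooth
  choice of \<open>t\<close> as a function of \<open>x\<close> turns the maximality into a test function above \<open>u\<close>. If \<open>t\<close> is chosen
  to be, up to second order, the parameter along the curve through the contact point, then \<open>\<omega>\<close> is
  stationary to second order on this curve and the second derivative of the test function is \<open>q''\<close>,
  which is negative (\<open>parabola_test_function\<close>, \<open>v_convex_imp_h_convex\<close>). No straightening of the vector
  field is involved.

  The approximants are averages \<open>\<integral> \<eta> y u (y p) dy\<close> of left translates of \<open>u\<close>, with \<open>y\<close> in a small
  neighbourhood of the identity described by a chart. Left translations permute the integral curves
  of left-invariant fields, so the averages are h-convex (\<open>h_convex_mollify\<close>). For their regularity
  one writes \<open>y p E (t v) = y (p E (t v) (inv p)) p\<close>: differentiating in \<open>p\<close> along \<open>v\<close> amounts to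
  moving \<open>y\<close> along the left-invariant field of \<open>Ad p v\<close>. Integration by parts moves this derivative
  to the kernel, and since the resulting formula contains no derivative of \<open>u\<close>, it extends from
  polynomials to continuous functions by the Stone-Weierstrass theorem
  (\<open>has_derivative_average_along_flow\<close>, \<open>DERIV_mollify\<close>). Two such steps give \<open>\<Gamma>\<^sup>2\<close> regularity
  (\<open>Gamma2_mollify\<close>).
\<close>

section \<open>Calculus of \<open>C\<^sup>k\<close> maps between Euclidean spaces\<close>

lemma Ck_on_subset:
  "Ck_on k S f \<Longrightarrow> T \<subseteq> S \<Longrightarrow> Ck_on k T f"
  by (induction k arbitrary: f) (auto intro: continuous_on_subset)

lemma Ck_on_cong:
  assumes "open S" "\<And>x. x \<in> S \<Longrightarrow> f x = g x"
  shows "Ck_on k S f \<longleftrightarrow> Ck_on k S g"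
proof -
  have imp: "Ck_on k S f \<Longrightarrow> Ck_on k S g" if eq: "\<And>x. x \<in> S \<Longrightarrow> f x = g x" for f g
    using eq
  proof (induction k arbitrary: f g)
    case 0
    then show ?case by (simp cong: continuous_on_cong)
  next
    case (Suc k)
    have der: "(g has_derivative frechet_derivative f (at x)) (at x)" if x: "x \<in> S" for x
    proof -
      have "(f has_derivative frechet_derivative f (at x)) (at x)"
        using Suc.prems(1) x by (simp add: frechet_derivative_works)
      then show ?thesis
        by (rule has_derivative_transform_within_open[OF _ assms(1) x]) (use Suc.prems(2) in auto)
    qed
    have "frechet_derivative g (at x) = frechet_derivative f (at x)" if "x \<in> S" for x
      using der[OF that] frechet_derivative_at by metis
    then show ?case
      using Suc.IH[of "\<lambda>x. frechet_derivative f (at x) v" "\<lambda>x. frechet_derivative g (at x) v" for v]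
        Suc.prems differentiableI[OF der] by simp
  qed
  show ?thesis
    using imp[of f g] imp[of g f] assms(2) by auto
qed

lemma Ck_on_eq:
  "Ck_on k S f \<Longrightarrow> open S \<Longrightarrow> (\<And>x. x \<in> S \<Longrightarrow> f x = g x) \<Longrightarrow> Ck_on k S g"
  using Ck_on_cong[of S f g k] by blast

lemma Ck_on_SucI:
  assumes "open S" "\<And>x. x \<in> S \<Longrightarrow> (f has_derivative f' x) (at x)" "\<And>v. Ck_on k S (\<lambda>x. f' x v)"
  shows "Ck_on (Suc k) S f"
proof -
  have "frechet_derivative f (at x) = f' x" if "x \<in> S" for x
    using assms(2)[OF that] frechet_derivative_at by metis
  then have "Ck_on k S (\<lambda>x. frechet_derivative f (at x) v)" for v
    using Ck_on_cong[OF assms(1), of "\<lambda>x. frechet_derivative f (at x) v" "\<lambda>x. f' x v"] assms(3) by auto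
  then show ?thesis
    using assms(2) by (auto intro: differentiableI)
qed

lemma Ck_on_SucD:
  assumes "Ck_on (Suc k) S f"
  shows "x \<in> S \<Longrightarrow> (f has_derivative frechet_derivative f (at x)) (at x)"
    and "Ck_on k S (\<lambda>x. frechet_derivative f (at x) v)"
  using assms by (auto simp: frechet_derivative_works)

lemma Ck_on_imp_continuous_on: "Ck_on k S f \<Longrightarrow> continuous_on S f"
  by (cases k) (auto simp: continuous_at_imp_continuous_on differentiable_imp_continuous_within)

lemma Ck_on_SucD_le: "Ck_on (Suc k) S f \<Longrightarrow> Ck_on k S f"
proof (induction k arbitrary: f)
  case 0
  then show ?case using Ck_on_imp_continuous_on by fastforce
next
  case (Suc k)
  then have "Ck_on k S (\<lambda>x. frechet_derivative f (at x) v)" for v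
    by (metis Ck_on.simps(2))
  then show ?case using Suc.prems by auto
qed

lemma Ck_on_differentiable: "Ck_on k S f \<Longrightarrow> k \<noteq> 0 \<Longrightarrow> x \<in> S \<Longrightarrow> f differentiable (at x)"
  by (cases k) auto

lemma Ck_on_has_derivative:
  "Ck_on k S f \<Longrightarrow> k \<noteq> 0 \<Longrightarrow> x \<in> S \<Longrightarrow> (f has_derivative frechet_derivative f (at x)) (at x)"
  using Ck_on_differentiable frechet_derivative_works by blast

lemma Ck_on_local:
  assumes "\<And>x. x \<in> S \<Longrightarrow> \<exists>U. open U \<and> x \<in> U \<and> Ck_on k U f"
  shows "Ck_on k S f"
  using assms
proof (induction k arbitrary: f)
  case 0
  show ?case
    unfolding Ck_on.simps
  proof (rule continuous_at_imp_continuous_on, rule ballI)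
    fix x assume "x \<in> S"
    then obtain U where "open U" "x \<in> U" "continuous_on U f" using 0 by auto
    then show "isCont f x" by (simp add: continuous_on_eq_continuous_at)
  qed
next
  case (Suc k)
  have "Ck_on k S (\<lambda>x. frechet_derivative f (at x) v)" for v
    by (rule Suc.IH) (use Suc.prems in fastforce)
  moreover have "f differentiable (at x)" if "x \<in> S" for x
    using Suc.prems[OF that] by auto
  ultimately show ?case by simp
qed

lemma Ck_on_const: "Ck_on k S (\<lambda>x. c)"
proof (induction k arbitrary: c)
  case (Suc k)
  have "frechet_derivative (\<lambda>x::'a. c) (at x) v = 0" for x v
    by (simp add: frechet_derivative_const)
  then show ?case using Suc by simp
qed auto

lemma Ck_on_bounded_linear:
  assumes "bounded_linear h"
  shows "Ck_on k S h"
proof (cases k)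
  case 0
  then show ?thesis using assms linear_continuous_on by auto
next
  case (Suc j)
  have "(h has_derivative h) (at x)" for x
    by (rule bounded_linear_imp_has_derivative[OF assms])
  then show ?thesis
    unfolding Suc using Ck_on_const
    by (intro Ck_on_subset[OF Ck_on_SucI[of UNIV h "\<lambda>x. h"]]) auto
qed

lemmas Ck_on_id = Ck_on_bounded_linear[OF bounded_linear_ident]

lemma Ck_on_add:
  assumes "open S" "Ck_on k S f" "Ck_on k S g"
  shows "Ck_on k S (\<lambda>x. f x + g x)"
  using assms(2,3)
proof (induction k arbitrary: f g)
  case 0
  then show ?case by (auto intro: continuous_intros)
next
  case (Suc k)
  show ?case
    by (rule Ck_on_SucI[OF assms(1) has_derivative_add[OF Ck_on_SucD(1) Ck_on_SucD(1)]])
      (use Suc in auto)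
qed

lemma Ck_on_sum:
  assumes "open S" "\<And>i. i \<in> I \<Longrightarrow> Ck_on k S (f i)"
  shows "Ck_on k S (\<lambda>x. \<Sum>i\<in>I. f i x)"
  using assms(2)
  by (induction I rule: infinite_finite_induct) (auto simp: Ck_on_const intro: Ck_on_add[OF assms(1)])

lemma Ck_on_bilinear:
  assumes "bounded_bilinear h" "open S" "Ck_on k S f" "Ck_on k S g"
  shows "Ck_on k S (\<lambda>x. h (f x) (g x))"
  using assms(3,4)
proof (induction k arbitrary: f g)
  case 0
  then show ?case using bounded_bilinear.continuous_on[OF assms(1)] by simp
next
  case (Suc k)
  show ?case
  proof (rule Ck_on_SucI[OF assms(2) bounded_bilinear.FDERIV[OF assms(1) Ck_on_SucD(1) Ck_on_SucD(1)]])
    fix v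
    show "Ck_on k S (\<lambda>x. h (f x) (frechet_derivative g (at x) v) + h (frechet_derivative f (at x) v) (g x))"
      by (intro Ck_on_add[OF assms(2)] Suc.IH Ck_on_SucD_le[OF Suc.prems(1)] Ck_on_SucD_le[OF Suc.prems(2)]
          Ck_on_SucD(2)[OF Suc.prems(1)] Ck_on_SucD(2)[OF Suc.prems(2)])
  qed (use Suc.prems in blast)+
qed

lemmas Ck_on_mult = Ck_on_bilinear[OF bounded_bilinear_mult]
lemmas Ck_on_scaleR = Ck_on_bilinear[OF bounded_bilinear_scaleR]
lemmas Ck_on_inner = Ck_on_bilinear[OF bounded_bilinear_inner]

lemma Ck_on_uminus: 
  assumes "open S" "Ck_on k S f"
  shows "Ck_on k S (\<lambda>x. - f x)"
  using Ck_on_scaleR[OF assms(1) Ck_on_const[of _ _ "-1"] assms(2)] by simp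

lemma Ck_on_diff:
  assumes "open S" "Ck_on k S f" "Ck_on k S g"
  shows "Ck_on k S (\<lambda>x. f x - g x)"
  using Ck_on_add[OF assms(1,2) Ck_on_uminus[OF assms(1,3)]] by simp

lemma Ck_on_power:
  fixes f :: "'a::euclidean_space \<Rightarrow> real"
  assumes "open S" "Ck_on k S f"
  shows "Ck_on k S (\<lambda>x. f x ^ n)"
  by (induction n) (auto simp: Ck_on_const intro: Ck_on_mult[OF assms(1,2)])

lemma has_derivative_eq_sum_Basis:
  fixes v :: "'a::euclidean_space"
  assumes "(f has_derivative f') (at x)"
  shows "f' v = (\<Sum>b\<in>Basis. (v \<bullet> b) *\<^sub>R f' b)"
proof -
  interpret linear f' using assms has_derivative_linear by auto
  have "f' v = f' (\<Sum>b\<in>Basis. (v \<bullet> b) *\<^sub>R b)" by (simp add: euclidean_representation)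
  then show ?thesis by (simp add: sum scaleR)
qed

lemma Ck_on_compose:
  fixes f :: "'a::euclidean_space \<Rightarrow> 'b::euclidean_space"
  assumes "open S" "open T" "Ck_on k S f" "Ck_on k T g" "f ` S \<subseteq> T"
  shows "Ck_on k S (\<lambda>x. g (f x))"
  using assms(3,4)
proof (induction k arbitrary: g)
  case 0
  then show ?case using assms(5) by (auto intro: continuous_on_compose2)
next
  case (Suc k)
  have D: "((\<lambda>x. g (f x)) has_derivative
      (\<lambda>v. \<Sum>b\<in>Basis. (frechet_derivative f (at x) v \<bullet> b) *\<^sub>R frechet_derivative g (at (f x)) b)) (at x)"
    if "x \<in> S" for x
  proof -
    have g: "(g has_derivative frechet_derivative g (at (f x))) (at (f x))"
      using Ck_on_SucD(1)[OF Suc.prems(2)] assms(5) that by auto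
    have "((\<lambda>x. g (f x)) has_derivative
      (\<lambda>v. frechet_derivative g (at (f x)) (frechet_derivative f (at x) v))) (at x)"
      by (rule has_derivative_compose[OF Ck_on_SucD(1)[OF Suc.prems(1) that] g])
    then show ?thesis
      by (subst (asm) has_derivative_eq_sum_Basis[OF g])
  qed
  show ?case
  proof (rule Ck_on_SucI[OF assms(1) D])
    fix v
    have "Ck_on k S (\<lambda>x. frechet_derivative g (at (f x)) b)" for b
      by (rule Suc.IH) (use Ck_on_SucD_le[OF Suc.prems(1)] Ck_on_SucD(2)[OF Suc.prems(2)] in auto)
    moreover have "Ck_on k S (\<lambda>x. frechet_derivative f (at x) v \<bullet> b)" for b
      by (intro Ck_on_inner[OF assms(1)] Ck_on_const Ck_on_SucD(2)[OF Suc.prems(1)])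
    ultimately show "Ck_on k S (\<lambda>x. \<Sum>b\<in>Basis. (frechet_derivative f (at x) v \<bullet> b) *\<^sub>R
        frechet_derivative g (at (f x)) b)"
      by (intro Ck_on_sum[OF assms(1)] Ck_on_scaleR[OF assms(1)]) auto
  qed auto
qed

lemma Ck_on_Pair:
  assumes "open S" "Ck_on k S f" "Ck_on k S g"
  shows "Ck_on k S (\<lambda>x. (f x, g x))"
  using assms(2,3)
proof (induction k arbitrary: f g)
  case 0
  then show ?case by (auto intro: continuous_intros)
next
  case (Suc k)
  show ?case
    by (rule Ck_on_SucI[OF assms(1) has_derivative_Pair[OF Ck_on_SucD(1) Ck_on_SucD(1)]])
      (use Suc in auto)
qed

lemma Ck_on_derivative:
  fixes f :: "'a::euclidean_space \<Rightarrow> 'b::real_normed_vector"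
  assumes "open S" "Ck_on (Suc k) S f" "Ck_on k S h"
  shows "Ck_on k S (\<lambda>x. frechet_derivative f (at x) (h x))"
proof -
  have "Ck_on k S (\<lambda>x. \<Sum>b\<in>Basis. (h x \<bullet> b) *\<^sub>R frechet_derivative f (at x) b)"
    by (intro Ck_on_sum assms Ck_on_scaleR Ck_on_inner Ck_on_const Ck_on_SucD(2)[OF assms(2)])
  moreover have "frechet_derivative f (at x) (h x) = (\<Sum>b\<in>Basis. (h x \<bullet> b) *\<^sub>R frechet_derivative f (at x) b)"
    if "x \<in> S" for x
    by (rule has_derivative_eq_sum_Basis[OF Ck_on_SucD(1)[OF assms(2) that]])
  ultimately show ?thesis
    using Ck_on_cong[OF assms(1)] by (metis (no_types, lifting))
qed

lemma Ck_on_polynomial: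
  assumes "real_polynomial_function (f :: 'a::euclidean_space \<Rightarrow> real)"
  shows "Ck_on k UNIV f"
  using assms
  by induction (auto intro: Ck_on_bounded_linear Ck_on_const Ck_on_add Ck_on_mult)

text \<open>The function \<open>s \<mapsto> max(0,s)\<^sup>3\<close> is the source of all the cut-off functions below. Its
  regularity \<open>C\<^sup>2\<close> suffices, since no more than two derivatives of a cut-off are ever taken.\<close>

definition cubic_part :: "real \<Rightarrow> real" where
  "cubic_part s = max 0 s ^ 3"

lemma has_real_derivative_max_power:
  assumes "n \<ge> 1"
  shows "((\<lambda>s::real. max 0 s ^ Suc n) has_real_derivative real (Suc n) * max 0 s ^ n) (at s)"
proof -
  consider "s > 0" | "s < 0" | "s = 0" by linarith
  then show ?thesis
  proof cases
    case 1
    have "((\<lambda>s::real. s ^ Suc n) has_real_derivative real (Suc n) * max 0 s ^ n) (at s)"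
      using 1 by (auto intro!: derivative_eq_intros simp del: power_Suc)
    then show ?thesis
      by (rule has_field_derivative_transform_within_open[where S="{0<..}"]) (use 1 in auto)
  next
    case 2
    have "((\<lambda>s::real. 0) has_real_derivative real (Suc n) * max 0 s ^ n) (at s)"
      using 2 assms by (auto simp: max_def power_0_left)
    then show ?thesis
      by (rule has_field_derivative_transform_within_open[where S="{..<0}"]) (use 2 in auto)
  next
    case 3
    have lim: "((\<lambda>h::real. max 0 h ^ n) \<longlongrightarrow> max 0 0 ^ n) (at 0)"
      by (intro tendsto_intros)
    have "((\<lambda>h::real. max 0 h ^ Suc n / h) \<longlongrightarrow> 0) (at 0)"
    proof (rule Lim_null_comparison)
      show "\<forall>\<^sub>F h in at 0. norm (max 0 h ^ Suc n / h) \<le> max 0 h ^ n"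
        by (auto simp: eventually_at_filter max_def abs_mult divide_simps power_0_left)
      show "((\<lambda>h::real. max 0 h ^ n) \<longlongrightarrow> 0) (at 0)"
        using lim assms by (simp add: power_0_left)
    qed
    then show ?thesis
      using 3 assms by (simp add: has_field_derivative_iff power_0_left)
  qed
qed

lemma Ck_on_cubic_part: "Ck_on 2 UNIV cubic_part"
proof -
  have cont: "Ck_on 0 UNIV (\<lambda>s::real. max 0 s ^ 1)"
    by (auto intro!: continuous_intros)
  have step: "Ck_on (Suc k) UNIV (\<lambda>s::real. max 0 s ^ Suc n)"
    if "n \<ge> 1" "Ck_on k UNIV (\<lambda>s::real. max 0 s ^ n)" for k n
  proof (rule Ck_on_SucI)
    fix s :: real
    show "((\<lambda>s::real. max 0 s ^ Suc n) has_derivative (\<lambda>h. (real (Suc n) * max 0 s ^ n) * h)) (at s)"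
      using has_real_derivative_max_power[OF that(1), of s]
      by (simp add: has_field_derivative_def)
  next
    fix v
    show "Ck_on k UNIV (\<lambda>x::real. real (Suc n) * max 0 x ^ n * v)"
      by (intro Ck_on_mult open_UNIV Ck_on_const that(2))
  qed auto
  have "Ck_on (Suc (Suc 0)) UNIV (\<lambda>s::real. max 0 s ^ Suc (Suc 1))"
    by (intro step cont) auto
  then show ?thesis
    unfolding cubic_part_def by (simp only: numeral_2_eq_2 numeral_3_eq_3 One_nat_def)
qed

lemma cubic_part_simps:
  "s \<le> 0 \<Longrightarrow> cubic_part s = 0" "s > 0 \<Longrightarrow> cubic_part s > 0" "cubic_part s \<ge> 0"
  "s \<ge> 1 \<Longrightarrow> cubic_part s \<ge> 1"
  by (auto simp: cubic_part_def max_def)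

section \<open>\<open>C\<^sup>k\<close> maps into a Lie group and left-invariant fields\<close>

lemma is_chartD:
  assumes "is_chart c"
  shows "open (fst c)" "open (snd c ` fst c)" "continuous_on (fst c) (snd c)"
    "continuous_on (snd c ` fst c) (chart_inv c)"
    "x \<in> snd c ` fst c \<Longrightarrow> chart_inv c x \<in> fst c"
    "x \<in> snd c ` fst c \<Longrightarrow> snd c (chart_inv c x) = x"
    "p \<in> fst c \<Longrightarrow> chart_inv c (snd c p) = p"
    "inj_on (snd c) (fst c)"
proof -
  have h: "homeomorphism (fst c) (snd c ` fst c) (snd c) (chart_inv c)"
    using assms unfolding is_chart_def by auto
  show "open (fst c)" "open (snd c ` fst c)"
    using assms unfolding is_chart_def by auto
  show "continuous_on (fst c) (snd c)" "continuous_on (snd c ` fst c) (chart_inv c)"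
    "x \<in> snd c ` fst c \<Longrightarrow> chart_inv c x \<in> fst c"
    "x \<in> snd c ` fst c \<Longrightarrow> snd c (chart_inv c x) = x"
    using h unfolding homeomorphism_def by auto
  have left: "\<And>p. p \<in> fst c \<Longrightarrow> chart_inv c (snd c p) = p"
    using h unfolding homeomorphism_def by auto
  show "p \<in> fst c \<Longrightarrow> chart_inv c (snd c p) = p" by (rule left)
  show "inj_on (snd c) (fst c)" using left by (rule inj_on_inverseI)
qed

lemma chart_image_Int:
  assumes "is_chart c"
  shows "snd c ` (fst c \<inter> W) = snd c ` fst c \<inter> chart_inv c -` W"
  using is_chartD(5-7)[OF assms] by auto

lemma open_chart_image:
  assumes "is_chart c" "open W"
  shows "open (snd c ` (fst c \<inter> W))"
  unfolding chart_image_Int[OF assms(1)]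
  by (rule continuous_open_preimage[OF is_chartD(4,2)[OF assms(1)] assms(2)])

locale lie_group_exp = lie_group G A
  for G :: "'g::{t2_space, second_countable_topology} monoid" (structure)
    and A :: "('g, 'v::euclidean_space) chart set" +
  fixes \<kappa> :: "('g, 'v) chart" and E :: "'v \<Rightarrow> 'g"
  assumes chart_at_one: "\<kappa> \<in> A" "\<one> \<in> fst \<kappa>"
    and exponential: "exponential_map G \<kappa> E"
begin

abbreviation e0 :: 'v where "e0 \<equiv> snd \<kappa> \<one>"

abbreviation coords :: "'v set" where "coords \<equiv> snd \<kappa> ` fst \<kappa>"

lemma in_carrier [simp, intro]: "p \<in> carrier G"
  by (simp add: carrier_UNIV)

lemma chart: "c \<in> A \<Longrightarrow> is_chart c"
  using atlas unfolding smooth_atlas_def by auto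

lemmas chartD = is_chartD[OF chart]

lemma chart_around: obtains c where "c \<in> A" "p \<in> fst c"
  using atlas unfolding smooth_atlas_def by blast

lemma transition_smooth:
  "c \<in> A \<Longrightarrow> d \<in> A \<Longrightarrow> Ck_on k (snd c ` (fst c \<inter> fst d)) (\<lambda>x. snd d (chart_inv c x))"
  using atlas unfolding smooth_atlas_def smooth_on_def o_def by auto

lemma continuous_on_mult_group [continuous_intros]:
  fixes f g :: "'b::topological_space \<Rightarrow> 'g"
  assumes "continuous_on S f" "continuous_on S g"
  shows "continuous_on S (\<lambda>x. f x \<otimes> g x)"
proof -
  have "continuous_on UNIV (\<lambda>(p, q). p \<otimes> q)"
    using smooth_mult unfolding smooth_map_def by auto
  from continuous_on_compose2[OF this continuous_on_Pair[OF assms]] show ?thesis by simp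
qed

lemma continuous_on_inv_group [continuous_intros]:
  fixes f :: "'b::topological_space \<Rightarrow> 'g"
  assumes "continuous_on S f"
  shows "continuous_on S (\<lambda>x. inv (f x))"
  using continuous_on_compose2[of UNIV "\<lambda>p. inv p" S f] smooth_inv assms unfolding smooth_map_def by auto

text \<open>Working with group-valued maps of open subsets of Euclidean spaces removes nearly all chart
  bookkeeping: this class is closed under the group operations and under composition, and reading
  such a map in a chart only restricts its domain.\<close>

definition Ck_into :: "nat \<Rightarrow> 'b::euclidean_space set \<Rightarrow> ('b \<Rightarrow> 'g) \<Rightarrow> bool" where
  "Ck_into k S F \<longleftrightarrow> continuous_on S F \<and> (\<forall>c\<in>A. Ck_on k (S \<inter> F -` fst c) (\<lambda>x. snd c (F x)))"

lemma Ck_intoD: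
  assumes "Ck_into k S F"
  shows "continuous_on S F" "c \<in> A \<Longrightarrow> Ck_on k (S \<inter> F -` fst c) (\<lambda>x. snd c (F x))"
  using assms unfolding Ck_into_def by auto

lemma Ck_into_open_preimage:
  "Ck_into k S F \<Longrightarrow> open S \<Longrightarrow> open W \<Longrightarrow> open (S \<inter> F -` W)"
  unfolding Ck_into_def by (metis continuous_open_preimage)

lemma Ck_into_subset: "Ck_into k S F \<Longrightarrow> T \<subseteq> S \<Longrightarrow> Ck_into k T F"
  unfolding Ck_into_def by (metis Ck_on_subset continuous_on_subset Int_mono order_refl)

lemma Ck_intoI:
  assumes "open S" "continuous_on S F"
    and loc: "\<And>x. x \<in> S \<Longrightarrow> \<exists>c\<in>A. \<exists>U. open U \<and> x \<in> U \<and> F ` U \<subseteq> fst c \<and> Ck_on k U (\<lambda>x. snd c (F x))"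
  shows "Ck_into k S F"
  unfolding Ck_into_def
proof (intro conjI ballI Ck_on_local)
  fix d x assume d: "d \<in> A" and x: "x \<in> S \<inter> F -` fst d"
  then obtain c U where c: "c \<in> A" "open U" "x \<in> U" "F ` U \<subseteq> fst c" "Ck_on k U (\<lambda>x. snd c (F x))"
    using loc by blast
  define U' where "U' = U \<inter> (S \<inter> F -` fst d)"
  have op: "open U'"
    unfolding U'_def
    by (intro open_Int[OF c(2)] continuous_open_preimage[OF assms(2,1) chartD(1)[OF d]])
  have "Ck_on k U' (\<lambda>x. (\<lambda>y. snd d (chart_inv c y)) (snd c (F x)))"
    by (rule Ck_on_compose[OF op open_chart_image[OF chart[OF c(1)] chartD(1)[OF d]] _ transition_smooth[OF c(1) d]])
      (use c(4) Ck_on_subset[OF c(5)] in \<open>auto simp: U'_def\<close>)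
  then have "Ck_on k U' (\<lambda>x. snd d (F x))"
    by (rule Ck_on_eq[OF _ op]) (use c(4) chartD(7)[OF c(1)] in \<open>auto simp: U'_def\<close>)
  then show "\<exists>U. open U \<and> x \<in> U \<and> Ck_on k U (\<lambda>x. snd d (F x))"
    using op c x by (intro exI[of _ U'] conjI) (auto simp: U'_def)
qed (use assms(2) in auto)

lemma Ck_into_const: "Ck_into k S (\<lambda>x. p)"
  unfolding Ck_into_def by (auto intro: Ck_on_const)

lemma Ck_into_chart_inv:
  assumes "c \<in> A"
  shows "Ck_into k (snd c ` fst c) (chart_inv c)"
proof (rule Ck_intoI)
  fix x assume x: "x \<in> snd c ` fst c"
  have "Ck_on k (snd c ` fst c) (\<lambda>x. x)" by (rule Ck_on_id)
  then have "Ck_on k (snd c ` fst c) (\<lambda>x. snd c (chart_inv c x))"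
    by (rule Ck_on_eq[OF _ chartD(2)[OF assms]]) (simp add: chartD(6)[OF assms])
  then show "\<exists>d\<in>A. \<exists>U. open U \<and> x \<in> U \<and> chart_inv c ` U \<subseteq> fst d \<and> Ck_on k U (\<lambda>x. snd d (chart_inv c x))"
    using assms x chartD(2,5)[OF assms] by blast
qed (use chartD[OF assms] in auto)

lemma Ck_into_compose:
  fixes f :: "'b::euclidean_space \<Rightarrow> 'c::euclidean_space"
  assumes "open S" "open T" "Ck_into k T F" "Ck_on k S f" "f ` S \<subseteq> T"
  shows "Ck_into k S (\<lambda>x. F (f x))"
  unfolding Ck_into_def
proof (intro conjI ballI)
  have cont: "continuous_on S (\<lambda>x. F (f x))"
    using Ck_intoD(1)[OF assms(3)] Ck_on_imp_continuous_on[OF assms(4)] assms(5)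
    by (rule continuous_on_compose2)
  then show "continuous_on S (\<lambda>x. F (f x))" .
  fix c assume c: "c \<in> A"
  show "Ck_on k (S \<inter> (\<lambda>x. F (f x)) -` fst c) (\<lambda>x. snd c (F (f x)))"
    by (rule Ck_on_compose[OF _ _ Ck_on_subset[OF assms(4)] Ck_intoD(2)[OF assms(3) c]])
      (use assms c cont chartD(1)[OF c] in \<open>auto intro: continuous_open_preimage Ck_into_open_preimage\<close>)
qed

lemma mult_coords_smooth:
  assumes c: "c \<in> A" and d: "d \<in> A" and f: "f \<in> A"
  defines "W \<equiv> {z \<in> snd c ` fst c \<times> snd d ` fst d. chart_inv c (fst z) \<otimes> chart_inv d (snd z) \<in> fst f}"
  shows "open W" "Ck_on k W (\<lambda>z. snd f (chart_inv c (fst z) \<otimes> chart_inv d (snd z)))"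
proof -
  have "continuous_on (snd c ` fst c \<times> snd d ` fst d) (\<lambda>z. chart_inv c (fst z) \<otimes> chart_inv d (snd z))"
    by (intro continuous_intros continuous_on_compose2[OF chartD(4)[OF c]] 
        continuous_on_compose2[OF chartD(4)[OF d]]) auto
  from continuous_open_preimage[OF this open_Times[OF chartD(2)[OF c] chartD(2)[OF d]] chartD(1)[OF f]]
  show op: "open W"
    unfolding W_def by (simp add: Int_def vimage_def)
  define cd where "cd = (fst c \<times> fst d, map_prod (snd c) (snd d))"
  have inj: "inj_on (map_prod (snd c) (snd d)) (fst c \<times> fst d)"
    using map_prod_inj_on[OF chartD(8)[OF c] chartD(8)[OF d]] .
  have inv: "chart_inv cd z = (chart_inv c (fst z), chart_inv d (snd z))"
    if "z \<in> snd c ` fst c \<times> snd d ` fst d" for z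
  proof -
    have "inv_into (fst c \<times> fst d) (map_prod (snd c) (snd d)) z = (chart_inv c (fst z), chart_inv d (snd z))"
      by (rule inv_into_f_eq[OF inj]) (use that chartD(5,6)[OF c] chartD(5,6)[OF d] in auto)
    then show ?thesis unfolding chart_inv_def[of cd] by (simp add: cd_def)
  qed
  have im: "snd cd ` (fst cd \<inter> (\<lambda>(p, q). p \<otimes> q) -` fst f) = W"
  proof (intro equalityI subsetI)
    fix z assume "z \<in> W"
    then show "z \<in> snd cd ` (fst cd \<inter> (\<lambda>(p, q). p \<otimes> q) -` fst f)"
      using chartD(5,6)[OF c] chartD(5,6)[OF d]
      by (intro image_eqI[of _ _ "(chart_inv c (fst z), chart_inv d (snd z))"])
        (auto simp: cd_def W_def)
  qed (auto simp: W_def cd_def chartD(7)[OF c] chartD(7)[OF d])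
  have "cd \<in> product_atlas A A"
    using c d unfolding product_atlas_def cd_def by blast
  then have "smooth_on W (snd f \<circ> (\<lambda>(p, q). p \<otimes> q) \<circ> chart_inv cd)"
    using smooth_mult f im unfolding smooth_map_def by blast
  then have "Ck_on k W (snd f \<circ> (\<lambda>(p, q). p \<otimes> q) \<circ> chart_inv cd)"
    unfolding smooth_on_def by auto
  then show "Ck_on k W (\<lambda>z. snd f (chart_inv c (fst z) \<otimes> chart_inv d (snd z)))"
    by (rule Ck_on_eq[OF _ op]) (use inv in \<open>auto simp: W_def\<close>)
qed

lemma Ck_into_mult:
  fixes F :: "'b::euclidean_space \<Rightarrow> 'g"
  assumes "open S" "Ck_into k S F" "Ck_into k S H"
  shows "Ck_into k S (\<lambda>x. F x \<otimes> H x)"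
proof (rule Ck_intoI[OF assms(1)])
  show cont: "continuous_on S (\<lambda>x. F x \<otimes> H x)"
    using assms by (intro continuous_intros Ck_intoD(1))
  fix x assume x: "x \<in> S"
  obtain c where c: "c \<in> A" "F x \<in> fst c" using chart_around .
  obtain d where d: "d \<in> A" "H x \<in> fst d" using chart_around .
  obtain f where f: "f \<in> A" "F x \<otimes> H x \<in> fst f" using chart_around .
  define U where "U = (S \<inter> F -` fst c) \<inter> (S \<inter> H -` fst d) \<inter> (S \<inter> (\<lambda>x. F x \<otimes> H x) -` fst f)"
  have op: "open U"
    unfolding U_def
    by (intro open_Int Ck_into_open_preimage[OF assms(2,1) chartD(1)[OF c(1)]]
        Ck_into_open_preimage[OF assms(3,1) chartD(1)[OF d(1)]]
        continuous_open_preimage[OF cont assms(1) chartD(1)[OF f(1)]])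
  note ms = mult_coords_smooth[OF c(1) d(1) f(1)]
  have "Ck_on k U (\<lambda>x. (snd c (F x), snd d (H x)))"
    by (intro Ck_on_Pair op; rule Ck_on_subset[OF Ck_intoD(2)])
      (use assms c d in \<open>auto simp: U_def\<close>)
  then have "Ck_on k U (\<lambda>x. (\<lambda>z. snd f (chart_inv c (fst z) \<otimes> chart_inv d (snd z))) (snd c (F x), snd d (H x)))"
    by (rule Ck_on_compose[OF op ms(1) _ ms(2)])
      (auto simp: U_def chartD(7)[OF c(1)] chartD(7)[OF d(1)])
  then have "Ck_on k U (\<lambda>x. snd f (F x \<otimes> H x))"
    by (rule Ck_on_eq[OF _ op])
      (auto simp: U_def chartD(7)[OF c(1)] chartD(7)[OF d(1)])
  then show "\<exists>c\<in>A. \<exists>U. open U \<and> x \<in> U \<and> (\<lambda>x. F x \<otimes> H x) ` U \<subseteq> fst c \<and> Ck_on k U (\<lambda>x. snd c (F x \<otimes> H x))"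
    using op f x c d by (intro bexI[of _ f] exI[of _ U] conjI) (auto simp: U_def)
qed

lemma Ck_into_inv:
  fixes F :: "'b::euclidean_space \<Rightarrow> 'g"
  assumes "open S" "Ck_into k S F"
  shows "Ck_into k S (\<lambda>x. inv (F x))"
proof (rule Ck_intoI[OF assms(1)])
  show cont: "continuous_on S (\<lambda>x. inv (F x))"
    using assms by (intro continuous_intros Ck_intoD(1))
  fix x assume x: "x \<in> S"
  obtain c where c: "c \<in> A" "F x \<in> fst c" using chart_around .
  obtain d where d: "d \<in> A" "inv (F x) \<in> fst d" using chart_around .
  define U where "U = (S \<inter> F -` fst c) \<inter> (S \<inter> (\<lambda>x. inv (F x)) -` fst d)"
  have op: "open U"
    unfolding U_def
    by (intro open_Int Ck_into_open_preimage[OF assms(2,1) chartD(1)[OF c(1)]]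
        continuous_open_preimage[OF cont assms(1) chartD(1)[OF d(1)]])
  have sm: "Ck_on k (snd c ` (fst c \<inter> (\<lambda>p. inv p) -` fst d)) (\<lambda>y. snd d (inv (chart_inv c y)))"
    using smooth_inv c(1) d(1) unfolding smooth_map_def smooth_on_def o_def by auto
  have "open ((\<lambda>p. inv p) -` fst d)"
    using continuous_open_preimage[OF continuous_on_inv_group[OF continuous_on_id] open_UNIV chartD(1)[OF d(1)]] by simp
  then have ope: "open (snd c ` (fst c \<inter> (\<lambda>p. inv p) -` fst d))"
    by (rule open_chart_image[OF chart[OF c(1)]])
  have "Ck_on k U (\<lambda>x. snd c (F x))"
    by (rule Ck_on_subset[OF Ck_intoD(2)[OF assms(2) c(1)]]) (auto simp: U_def)
  then have "Ck_on k U (\<lambda>x. (\<lambda>y. snd d (inv (chart_inv c y))) (snd c (F x)))"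
    by (rule Ck_on_compose[OF op ope _ sm]) (auto simp: U_def)
  then have "Ck_on k U (\<lambda>x. snd d (inv (F x)))"
    by (rule Ck_on_eq[OF _ op])
      (auto simp: U_def chartD(7)[OF c(1)])
  then show "\<exists>c\<in>A. \<exists>U. open U \<and> x \<in> U \<and> (\<lambda>x. inv (F x)) ` U \<subseteq> fst c \<and> Ck_on k U (\<lambda>x. snd c (inv (F x)))"
    using op d x c by (intro bexI[of _ d] exI[of _ U] conjI) (auto simp: U_def)
qed

definition one_param :: "'v \<Rightarrow> (real \<Rightarrow> 'g) \<Rightarrow> bool" where
  "one_param v \<sigma> \<longleftrightarrow> continuous_on UNIV \<sigma> \<and> (\<forall>s t. \<sigma> (s + t) = \<sigma> s \<otimes> \<sigma> t) \<and>
     ((\<lambda>t. snd \<kappa> (\<sigma> t)) has_vector_derivative v) (at 0)"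

lemma one_param_exp: "one_param v (\<lambda>t. E (t *\<^sub>R v))"
  using exponential unfolding exponential_map_def one_param_def by auto

lemma one_paramD:
  assumes "one_param v \<sigma>"
  shows "continuous_on S \<sigma>" "\<sigma> (s + t) = \<sigma> s \<otimes> \<sigma> t" "\<sigma> 0 = \<one>"
    "((\<lambda>t. snd \<kappa> (\<sigma> t)) has_vector_derivative v) (at 0)"
proof -
  show "continuous_on S \<sigma>" "((\<lambda>t. snd \<kappa> (\<sigma> t)) has_vector_derivative v) (at 0)"
    using assms unfolding one_param_def by (auto intro: continuous_on_subset)
  have add: "\<And>s t. \<sigma> (s + t) = \<sigma> s \<otimes> \<sigma> t"
    using assms unfolding one_param_def by auto
  show "\<sigma> (s + t) = \<sigma> s \<otimes> \<sigma> t" by (rule add)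
  show "\<sigma> 0 = \<one>" using add[of 0 0] by (simp add: r_cancel_one)
qed

lemma E_0 [simp]: "E 0 = \<one>"
  using one_paramD(3)[OF one_param_exp[of 0]] by simp

text \<open>In a chart, the left-invariant field of \<open>v\<close> at \<open>p\<close> is the derivative of \<open>q \<mapsto> p q\<close> at the
  identity, applied to \<open>v\<close>. It is written as a partial derivative of the multiplication so that its
  smooth dependence on \<open>p\<close> is immediate.\<close>

definition field_coords :: "('g, 'v) chart \<Rightarrow> 'v \<Rightarrow> 'v \<Rightarrow> 'v" where
  "field_coords c x v =
     frechet_derivative (\<lambda>z. snd c (chart_inv c (fst z) \<otimes> chart_inv \<kappa> (snd z))) (at (x, e0)) (0, v)"

lemma field_coords_domain:
  assumes "c \<in> A" "x \<in> snd c ` fst c"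
  shows "(x, e0) \<in> {z \<in> snd c ` fst c \<times> coords. chart_inv c (fst z) \<otimes> chart_inv \<kappa> (snd z) \<in> fst c}"
  using assms chart_at_one chartD(5,7) by auto

lemma field_coords_has_derivative:
  assumes "c \<in> A" "x \<in> snd c ` fst c"
  shows "((\<lambda>z. snd c (chart_inv c (fst z) \<otimes> chart_inv \<kappa> (snd z))) has_derivative
     frechet_derivative (\<lambda>z. snd c (chart_inv c (fst z) \<otimes> chart_inv \<kappa> (snd z))) (at (x, e0))) (at (x, e0))"
  by (rule Ck_on_has_derivative[OF mult_coords_smooth(2)[OF assms(1) chart_at_one(1) assms(1), of 1]
        _ field_coords_domain[OF assms]]) simp

lemma linear_field_coords:
  assumes "c \<in> A" "x \<in> snd c ` fst c"
  shows "linear (field_coords c x)"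
proof -
  interpret linear "frechet_derivative (\<lambda>z. snd c (chart_inv c (fst z) \<otimes> chart_inv \<kappa> (snd z))) (at (x, e0))"
    by (rule has_derivative_linear[OF field_coords_has_derivative[OF assms]])
  show ?thesis
    unfolding field_coords_def
    by (rule linearI) (simp_all flip: add scaleR)
qed

lemma Ck_on_field_coords:
  assumes "c \<in> A"
  shows "Ck_on k (snd c ` fst c) (\<lambda>x. field_coords c x v)"
  unfolding field_coords_def
  by (rule Ck_on_compose[where f="\<lambda>x. (x, e0)", OF chartD(2)[OF assms]
        mult_coords_smooth(1)[OF assms chart_at_one(1) assms] _
        Ck_on_SucD(2)[OF mult_coords_smooth(2)[OF assms chart_at_one(1) assms]]])
    (use field_coords_domain[OF assms] in \<open>auto intro!: Ck_on_Pair Ck_on_id Ck_on_const chartD(2)[OF assms]\<close>)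

lemma one_param_coords_derivative:
  assumes c: "c \<in> A" and \<sigma>: "one_param v \<sigma>" and t: "p \<otimes> \<sigma> t \<in> fst c"
  shows "((\<lambda>t. snd c (p \<otimes> \<sigma> t)) has_vector_derivative field_coords c (snd c (p \<otimes> \<sigma> t)) v) (at t)"
proof -
  define q where "q = p \<otimes> \<sigma> t"
  let ?M = "\<lambda>z. snd c (chart_inv c (fst z) \<otimes> chart_inv \<kappa> (snd z))"
  have q: "q \<in> fst c" using t by (simp add: q_def)
  have D1: "((\<lambda>s. (snd c q, snd \<kappa> (\<sigma> s))) has_derivative (\<lambda>h. (0, h *\<^sub>R v))) (at 0)"
    using one_paramD(4)[OF \<sigma>] unfolding has_vector_derivative_def
    by (intro has_derivative_Pair) auto
  have D0: "(?M has_derivative frechet_derivative ?M (at (snd c q, e0))) (at (snd c q, snd \<kappa> (\<sigma> 0)))"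
    using field_coords_has_derivative[OF c, of "snd c q"] q one_paramD(3)[OF \<sigma>] by simp
  have "((\<lambda>s. ?M (snd c q, snd \<kappa> (\<sigma> s))) has_derivative
      (\<lambda>h. frechet_derivative ?M (at (snd c q, e0)) (0, h *\<^sub>R v))) (at 0)"
    by (rule has_derivative_compose[OF D1 D0])
  moreover have "frechet_derivative ?M (at (snd c q, e0)) (0, h *\<^sub>R v) = h *\<^sub>R field_coords c (snd c q) v" for h
    using linear_scale[OF linear_field_coords[OF c]] q unfolding field_coords_def by blast
  ultimately have D2: "((\<lambda>s. ?M (snd c q, snd \<kappa> (\<sigma> s))) has_vector_derivative field_coords c (snd c q) v) (at 0)"
    by (simp add: has_vector_derivative_def)
  have op: "open (\<sigma> -` fst \<kappa>)"
    using continuous_open_preimage[OF one_paramD(1)[OF \<sigma>] open_UNIV chartD(1)[OF chart_at_one(1)]] by simp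
  have "((\<lambda>s. snd c (q \<otimes> \<sigma> s)) has_vector_derivative field_coords c (snd c q) v) (at 0)"
    by (rule has_vector_derivative_transform_within_open[OF D2 op])
      (use q chart_at_one chartD(7)[OF c] chartD(7)[OF chart_at_one(1)] one_paramD(3)[OF \<sigma>] in auto)
  moreover have "q \<otimes> \<sigma> s = p \<otimes> \<sigma> (s + t)" for s
    unfolding q_def using one_paramD(2)[OF \<sigma>, of t s] by (simp add: m_assoc add.commute)
  ultimately have "((\<lambda>s. snd c (p \<otimes> \<sigma> (s + t))) has_vector_derivative field_coords c (snd c q) v) (at (t - t))"
    by simp
  moreover have "((\<lambda>s. s - t) has_vector_derivative 1) (at t)"
    by (auto intro!: derivative_eq_intros simp: has_real_derivative_iff_has_vector_derivative[symmetric])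
  ultimately show ?thesis
    using vector_diff_chain_at[of "\<lambda>s. s - t" 1 t "\<lambda>s. snd c (p \<otimes> \<sigma> (s + t))"] by (simp add: o_def q_def)
qed

lemma Ck_into_one_param:
  assumes "one_param v \<sigma>"
  shows "Ck_into k UNIV (\<lambda>t. p \<otimes> \<sigma> t)"
proof (induction k)
  case 0
  have "continuous_on UNIV (\<lambda>t. p \<otimes> \<sigma> t)"
    by (intro continuous_intros one_paramD(1)[OF assms])
  then show ?case
    unfolding Ck_into_def
    by (auto intro!: continuous_on_compose2[OF chartD(3)] elim: continuous_on_subset)
next
  case (Suc k)
  have cont: "continuous_on UNIV (\<lambda>t. p \<otimes> \<sigma> t)"
    by (intro continuous_intros one_paramD(1)[OF assms])
  have "Ck_on (Suc k) (UNIV \<inter> (\<lambda>t. p \<otimes> \<sigma> t) -` fst c) (\<lambda>t. snd c (p \<otimes> \<sigma> t))" if c: "c \<in> A" for c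
  proof (rule Ck_on_SucI)
    show op: "open (UNIV \<inter> (\<lambda>t. p \<otimes> \<sigma> t) -` fst c)"
      by (rule continuous_open_preimage[OF cont open_UNIV chartD(1)[OF c]])
    fix t assume "t \<in> UNIV \<inter> (\<lambda>t. p \<otimes> \<sigma> t) -` fst c"
    then show "((\<lambda>t. snd c (p \<otimes> \<sigma> t)) has_derivative (\<lambda>h. h *\<^sub>R field_coords c (snd c (p \<otimes> \<sigma> t)) v)) (at t)"
      using one_param_coords_derivative[OF c assms] by (simp add: has_vector_derivative_def)
  next
    fix h :: real
    have op: "open (UNIV \<inter> (\<lambda>t. p \<otimes> \<sigma> t) -` fst c)"
      by (rule continuous_open_preimage[OF cont open_UNIV chartD(1)[OF c]])
    have "Ck_on k (UNIV \<inter> (\<lambda>t. p \<otimes> \<sigma> t) -` fst c) (\<lambda>t. field_coords c (snd c (p \<otimes> \<sigma> t)) v)"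
      by (rule Ck_on_compose[OF op chartD(2)[OF c] Ck_intoD(2)[OF Suc c] Ck_on_field_coords[OF c]]) auto
    then show "Ck_on k (UNIV \<inter> (\<lambda>t. p \<otimes> \<sigma> t) -` fst c) (\<lambda>t. h *\<^sub>R field_coords c (snd c (p \<otimes> \<sigma> t)) v)"
      by (intro Ck_on_scaleR[OF op] Ck_on_const)
  qed
  then show ?case using cont unfolding Ck_into_def by auto
qed

lemma Ck_into_exp: "Ck_into k UNIV (\<lambda>t. E (t *\<^sub>R v))"
  using Ck_into_one_param[OF one_param_exp, of k \<one> v] by simp

lemma Ck_fun_has_derivative:
  assumes "Ck_fun A k W f" "k \<noteq> 0" "c \<in> A" "p \<in> fst c \<inter> W"
  shows "((f \<circ> chart_inv c) has_derivative frechet_derivative (f \<circ> chart_inv c) (at (snd c p))) (at (snd c p))"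
  using Ck_on_has_derivative[OF _ assms(2)] assms unfolding Ck_fun_def by blast

lemma DERIV_one_param_coords:
  assumes f: "((f \<circ> chart_inv c) has_derivative D) (at (snd c p))" and c: "c \<in> A" "p \<in> fst c"
    and \<sigma>: "one_param v \<sigma>"
  shows "((\<lambda>t. f (p \<otimes> \<sigma> t)) has_real_derivative D (field_coords c (snd c p) v)) (at 0)"
proof -
  have "((\<lambda>t. snd c (p \<otimes> \<sigma> t)) has_derivative (\<lambda>h. h *\<^sub>R field_coords c (snd c p) v)) (at 0)"
    using one_param_coords_derivative[OF c(1) \<sigma>, of p 0] c(2) one_paramD(3)[OF \<sigma>]
    by (simp add: has_vector_derivative_def)
  from has_derivative_compose[OF this, of "f \<circ> chart_inv c" D] f
  have "((\<lambda>t. (f \<circ> chart_inv c) (snd c (p \<otimes> \<sigma> t))) has_derivative (\<lambda>h. D (h *\<^sub>R field_coords c (snd c p) v))) (at 0)"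
    using one_paramD(3)[OF \<sigma>] by simp
  moreover have "D (h *\<^sub>R field_coords c (snd c p) v) = h * D (field_coords c (snd c p) v)" for h
    using linear_scale[OF has_derivative_linear[OF f]] by simp
  ultimately have "((\<lambda>t. (f \<circ> chart_inv c) (snd c (p \<otimes> \<sigma> t))) has_derivative (\<lambda>h. h * D (field_coords c (snd c p) v))) (at 0)"
    by simp
  then have D: "((\<lambda>t. (f \<circ> chart_inv c) (snd c (p \<otimes> \<sigma> t))) has_real_derivative D (field_coords c (snd c p) v)) (at 0)"
    by (simp add: has_field_derivative_def mult.commute[of _ "D _"])
  have "continuous_on UNIV (\<lambda>t. p \<otimes> \<sigma> t)"
    by (intro continuous_intros one_paramD(1)[OF \<sigma>])
  then have "open (UNIV \<inter> (\<lambda>t. p \<otimes> \<sigma> t) -` fst c)"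
    using continuous_open_preimage chartD(1)[OF c(1)] by blast
  then show ?thesis
    by (rule has_field_derivative_transform_within_open[OF D])
      (use c one_paramD(3)[OF \<sigma>] chartD(7)[OF c(1)] in auto)
qed

lemma left_inv_field_coords:
  assumes "Ck_fun A k W f" "k \<noteq> 0" "c \<in> A" "p \<in> fst c \<inter> W"
  shows "left_inv_field G E v f p =
    frechet_derivative (f \<circ> chart_inv c) (at (snd c p)) (field_coords c (snd c p) v)"
  unfolding left_inv_field_def
  by (rule DERIV_imp_deriv[OF DERIV_one_param_coords[OF Ck_fun_has_derivative[OF assms] assms(3) _ one_param_exp]])
    (use assms(4) in auto)

lemma DERIV_left_inv_field:
  assumes f: "Ck_fun A k W f" "k \<noteq> 0" and \<sigma>: "one_param v \<sigma>" and t: "p \<otimes> \<sigma> t \<in> W"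
  shows "((\<lambda>t. f (p \<otimes> \<sigma> t)) has_real_derivative left_inv_field G E v f (p \<otimes> \<sigma> t)) (at t)"
proof -
  obtain c where c: "c \<in> A" "p \<otimes> \<sigma> t \<in> fst c" using chart_around .
  have "((\<lambda>s. f ((p \<otimes> \<sigma> t) \<otimes> \<sigma> s)) has_real_derivative left_inv_field G E v f (p \<otimes> \<sigma> t)) (at 0)"
    using DERIV_one_param_coords[OF Ck_fun_has_derivative[OF f c(1)] c \<sigma>] c t
      left_inv_field_coords[OF f c(1)] by simp
  moreover have "(p \<otimes> \<sigma> t) \<otimes> \<sigma> s = p \<otimes> \<sigma> (s + t)" for s
    using one_paramD(2)[OF \<sigma>, of t s] by (simp add: m_assoc add.commute)
  ultimately show ?thesis
    using DERIV_shift[of "\<lambda>s. f (p \<otimes> \<sigma> s)" "left_inv_field G E v f (p \<otimes> \<sigma> t)" 0 t] by simp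
qed

lemma Ck_fun_left_inv_field:
  assumes f: "Ck_fun A (Suc k) W f" and W: "open W"
  shows "Ck_fun A k W (left_inv_field G E v f)"
  unfolding Ck_fun_def
proof
  fix c assume c: "c \<in> A"
  have op: "open (snd c ` (fst c \<inter> W))" by (rule open_chart_image[OF chart[OF c] W])
  have "Ck_on (Suc k) (snd c ` (fst c \<inter> W)) (f \<circ> chart_inv c)"
    using f c unfolding Ck_fun_def by auto
  then have "Ck_on k (snd c ` (fst c \<inter> W))
      (\<lambda>x. frechet_derivative (f \<circ> chart_inv c) (at x) (field_coords c x v))"
    by (rule Ck_on_derivative[OF op]) (rule Ck_on_subset[OF Ck_on_field_coords[OF c]], auto)
  then show "Ck_on k (snd c ` (fst c \<inter> W)) (left_inv_field G E v f \<circ> chart_inv c)"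
    by (rule Ck_on_eq[OF _ op]) (use left_inv_field_coords[OF f _ c] chartD(7)[OF c] in auto)
qed

lemma left_inv_field_sum:
  assumes f: "Ck_fun A k W f" "k \<noteq> 0" and p: "p \<in> W"
  shows "left_inv_field G E (\<Sum>i\<in>I. a i *\<^sub>R v i) f p = (\<Sum>i\<in>I. a i * left_inv_field G E (v i) f p)"
proof -
  obtain c where c: "c \<in> A" "p \<in> fst c" using chart_around .
  let ?D = "frechet_derivative (f \<circ> chart_inv c) (at (snd c p))"
  have "linear ?D"
    using has_derivative_linear[OF Ck_fun_has_derivative[OF f c(1)]] c p by auto
  then show ?thesis
    using linear_field_coords[OF c(1), of "snd c p"] c p
    by (simp add: left_inv_field_coords[OF f c(1)] linear_sum linear_scale)
qed

lemma continuous_on_Ck_fun: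
  assumes f: "Ck_fun A k W f" and W: "open W"
  shows "continuous_on W f"
proof (rule continuous_at_imp_continuous_on, rule ballI)
  fix p assume p: "p \<in> W"
  obtain c where c: "c \<in> A" "p \<in> fst c" using chart_around .
  have "continuous_on (snd c ` (fst c \<inter> W)) (f \<circ> chart_inv c)"
    using f c(1) Ck_on_imp_continuous_on unfolding Ck_fun_def by blast
  moreover have "continuous_on (fst c \<inter> W) (snd c)"
    using chartD(3)[OF c(1)] by (rule continuous_on_subset) auto
  ultimately have "continuous_on (fst c \<inter> W) (\<lambda>p. (f \<circ> chart_inv c) (snd c p))"
    by (rule continuous_on_compose2) auto
  then have "continuous_on (fst c \<inter> W) f"
    by (rule continuous_on_eq) (use chartD(7)[OF c(1)] in auto)
  then show "isCont f p"
    using c p W chartD(1)[OF c(1)] by (simp add: continuous_on_eq_continuous_at open_Int)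
qed

end

section \<open>From horizontal to viscosity convexity\<close>

lemma second_derivative_nonneg:
  fixes g g1 :: "real \<Rightarrow> real"
  assumes g: "\<forall>\<^sub>F t in nhds 0. (g has_real_derivative g1 t) (at t)"
    and g1: "(g1 has_real_derivative D) (at 0)"
    and sym: "\<forall>\<^sub>F t in nhds 0. 2 * g 0 \<le> g t + g (- t)"
  shows "D \<ge> 0"
proof (rule ccontr)
  assume "\<not> D \<ge> 0"
  have "((\<lambda>t. g1 t - g1 (- t)) has_real_derivative D - (D * (- 1))) (at 0)"
    by (rule DERIV_diff[OF g1 DERIV_chain2[of g1 D "\<lambda>t. - t" 0]])
      (use g1 in \<open>auto intro!: derivative_eq_intros\<close>)
  from DERIV_neg_dec_right[OF this] \<open>\<not> D \<ge> 0\<close>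
  obtain d1 where d1: "d1 > 0" "\<And>h. 0 < h \<Longrightarrow> h < d1 \<Longrightarrow> g1 h - g1 (- h) < 0"
    by auto
  obtain d2 where d2: "d2 > 0" "\<And>t. \<bar>t\<bar> < d2 \<Longrightarrow> (g has_real_derivative g1 t) (at t)"
    "\<And>t. \<bar>t\<bar> < d2 \<Longrightarrow> 2 * g 0 \<le> g t + g (- t)"
    using eventually_conj[OF g sym] unfolding eventually_nhds_metric dist_real_def by auto
  define d where "d = min d1 d2 / 2"
  have d: "0 < d" "d < d1" "d < d2" using d1 d2 by (auto simp: d_def)
  have der: "((\<lambda>t. g t + g (- t)) has_real_derivative g1 t - g1 (- t)) (at t)" if "0 \<le> t" "t \<le> d" for t
  proof -
    have "((\<lambda>t. g t + g (- t)) has_real_derivative g1 t + g1 (- t) * (- 1)) (at t)"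
      by (rule DERIV_add[OF d2(2) DERIV_chain2[OF d2(2)]])
        (use that d in \<open>auto intro!: derivative_eq_intros\<close>)
    then show ?thesis by simp
  qed
  obtain z where z: "0 < z" "z < d" "(g d + g (- d)) - (g 0 + g (- 0)) = (d - 0) * (g1 z - g1 (- z))"
    using MVT2[OF d(1) der] by auto
  have "d * (g1 z - g1 (- z)) < 0"
    using d d1(2)[of z] z by (simp add: mult_pos_neg)
  then show False using z d2(3)[of d] d by simp
qed

context lie_group_exp
begin

lemma one_param_preimage_nhds:
  assumes "one_param v \<sigma>" "open W" "p \<in> W"
  shows "\<forall>\<^sub>F t in nhds 0. p \<otimes> \<sigma> t \<in> W"
proof -
  have "open (UNIV \<inter> (\<lambda>t. p \<otimes> \<sigma> t) -` W)"
    by (rule continuous_open_preimage[OF _ open_UNIV assms(2)])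
      (intro continuous_intros one_paramD(1)[OF assms(1)])
  moreover have "0 \<in> UNIV \<inter> (\<lambda>t. p \<otimes> \<sigma> t) -` W"
    using one_paramD(3)[OF assms(1)] assms(3) by simp
  ultimately show ?thesis
    using eventually_nhds by blast
qed

text \<open>Left-invariant fields depend linearly on the direction, so the quadratic form of the horizontal
  hessian is a second derivative along one single field. This reduces both directions of the
  comparison to functions of one real variable.\<close>

lemma hessian_quadratic_form:
  fixes X :: "'m::finite \<Rightarrow> 'v" and \<xi> :: "real^'m"
  assumes f: "Ck_fun A 2 W f" and W: "open W" and p: "p \<in> W"
  shows "\<xi> \<bullet> (horizontal_hessian G E X f p *v \<xi>) =
    left_inv_field G E (\<Sum>i\<in>UNIV. \<xi> $ i *\<^sub>R X i) (left_inv_field G E (\<Sum>i\<in>UNIV. \<xi> $ i *\<^sub>R X i) f) p"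
proof -
  define v where "v = (\<Sum>i\<in>UNIV. \<xi> $ i *\<^sub>R X i)"
  define a where "a i j = left_inv_field G E (X i) (left_inv_field G E (X j) f) p" for i j
  have f': "Ck_fun A (Suc 1) W f" using f by (simp add: numeral_2_eq_2)
  note f1 = Ck_fun_left_inv_field[OF f' W]
  have eq: "left_inv_field G E v f q = (\<Sum>j\<in>UNIV. \<xi> $ j * left_inv_field G E (X j) f q)" if "q \<in> W" for q
    unfolding v_def by (rule left_inv_field_sum[OF f _ that]) simp
  have inner: "left_inv_field G E (X i) (left_inv_field G E v f) p = (\<Sum>j\<in>UNIV. \<xi> $ j * a i j)" for i
  proof -
    have D: "((\<lambda>t. \<Sum>j\<in>UNIV. \<xi> $ j * left_inv_field G E (X j) f (p \<otimes> E (t *\<^sub>R X i)))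
        has_real_derivative (\<Sum>j\<in>UNIV. \<xi> $ j * a i j)) (at 0)"
      unfolding a_def
      using DERIV_left_inv_field[OF f1 _ one_param_exp, of p 0] p
      by (intro DERIV_sum DERIV_cmult) auto
    have "((\<lambda>t. left_inv_field G E v f (p \<otimes> E (t *\<^sub>R X i)))
        has_real_derivative (\<Sum>j\<in>UNIV. \<xi> $ j * a i j)) (at 0)"
      using D
    proof (rule DERIV_cong_ev[THEN iffD1, rotated 3])
      show "\<forall>\<^sub>F t in nhds 0. (\<Sum>j\<in>UNIV. \<xi> $ j * left_inv_field G E (X j) f (p \<otimes> E (t *\<^sub>R X i))) =
          left_inv_field G E v f (p \<otimes> E (t *\<^sub>R X i))"
        using one_param_preimage_nhds[OF one_param_exp[of "X i"] W p] by eventually_elim (simp add: eq)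
    qed auto
    then show ?thesis
      unfolding left_inv_field_def[of _ _ "X i" "left_inv_field G E v f"] by (rule DERIV_imp_deriv)
  qed
  have "left_inv_field G E v (left_inv_field G E v f) p = (\<Sum>i\<in>UNIV. \<xi> $ i * (\<Sum>j\<in>UNIV. \<xi> $ j * a i j))"
    unfolding inner[symmetric] by (subst (1) v_def, rule left_inv_field_sum[OF f1 _ p]) simp
  moreover have "\<xi> \<bullet> (horizontal_hessian G E X f p *v \<xi>) =
      (\<Sum>i\<in>UNIV. \<Sum>j\<in>UNIV. \<xi> $ i * \<xi> $ j * a i j) / 2 + (\<Sum>i\<in>UNIV. \<Sum>j\<in>UNIV. \<xi> $ i * \<xi> $ j * a j i) / 2"
    unfolding horizontal_hessian_def a_def[symmetric]
    by (simp add: inner_vec_def matrix_vector_mult_def sum_distrib_left sum_divide_distrib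
        flip: sum.distrib) (simp add: field_simps)
  moreover have "(\<Sum>i\<in>UNIV. \<Sum>j\<in>UNIV. \<xi> $ i * \<xi> $ j * a j i) = (\<Sum>i\<in>UNIV. \<Sum>j\<in>UNIV. \<xi> $ i * \<xi> $ j * a i j)"
    by (subst sum.swap) (simp add: mult.commute)
  ultimately show ?thesis
    by (simp add: v_def[symmetric] sum_distrib_left mult.assoc)
qed

lemma h_convex_midpoint:
  assumes h: "h_convex_on G E W T u" and W: "subspace W" "v \<in> W"
    and T: "\<And>t. \<bar>t\<bar> \<le> \<bar>s\<bar> \<Longrightarrow> p \<otimes> E (t *\<^sub>R v) \<in> T"
  shows "2 * u p \<le> u (p \<otimes> E (s *\<^sub>R v)) + u (p \<otimes> E (- s *\<^sub>R v))"
proof -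
  define q where "q = p \<otimes> E (- s *\<^sub>R v)"
  have E: "q \<otimes> E (t *\<^sub>R (2 * s) *\<^sub>R v) = p \<otimes> E ((2 * t * s - s) *\<^sub>R v)" for t
    using one_paramD(2)[OF one_param_exp[of v], of "-s" "2 * t * s"]
    unfolding q_def by (simp add: m_assoc algebra_simps)
  have "q \<in> T" using T[of "-s"] by (simp add: q_def)
  moreover have "(2 * s) *\<^sub>R v \<in> W" using W by (rule subspace_scale)
  moreover have "horizontal_segment G E q ((2 * s) *\<^sub>R v) \<subseteq> T"
    unfolding horizontal_segment_def
  proof clarify
    fix t :: real assume t: "t \<in> {0..1}"
    have "\<bar>2 * t * s - s\<bar> = \<bar>2 * t - 1\<bar> * \<bar>s\<bar>" by (simp flip: abs_mult add: algebra_simps)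
    also have "\<dots> \<le> 1 * \<bar>s\<bar>" by (rule mult_right_mono) (use t in auto)
    finally show "q \<otimes> E (t *\<^sub>R (2 * s) *\<^sub>R v) \<in> T"
      using T[of "2 * t * s - s"] unfolding E by simp
  qed
  ultimately have "convex_on {0..1} (\<lambda>t::real. u (q \<otimes> E (t *\<^sub>R (2 * s) *\<^sub>R v)))"
    using h unfolding h_convex_on_def by blast
  from convex_onD[OF this, of "1/2" 0 1] show ?thesis
    unfolding E by (simp add: field_simps)
qed

text \<open>A test function above \<open>u\<close> dominates, along each horizontal line through the contact point, a
  convex function with the same value there, so its second symmetric differences are nonnegative.\<close>

lemma locally_h_convex_imp_v_convex:
  fixes X :: "'m::finite \<Rightarrow> 'v"
  assumes S: "open S" and u: "continuous_on S u" and W: "subspace W" "range X \<subseteq> W"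
    and loc: "\<And>p. p \<in> S \<Longrightarrow> \<exists>T. open T \<and> p \<in> T \<and> h_convex_on G E W T u"
  shows "v_convex_on G A E X S u"
  unfolding v_convex_on_def
proof (intro conjI allI ballI impI)
  show "upper_semicontinuous_on S u"
    unfolding upper_semicontinuous_on_def
    using u unfolding continuous_on_def by (blast intro: order_tendstoD(2))
  fix \<xi> :: "real^'m" and p \<phi>
  assume p: "p \<in> S" and \<phi>: "Ck_fun A 2 S \<phi> \<and> touches_above \<phi> u p"
  define v where "v = (\<Sum>i\<in>UNIV. \<xi> $ i *\<^sub>R X i)"
  have v: "v \<in> W"
    unfolding v_def using W by (intro subspace_sum subspace_scale) auto
  obtain T where T: "open T" "p \<in> T" "h_convex_on G E W T u" using loc[OF p] by blast
  have f': "Ck_fun A (Suc 1) S \<phi>" using \<phi> by (simp add: numeral_2_eq_2)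
  let ?\<sigma> = "\<lambda>t. p \<otimes> E (t *\<^sub>R v)"
  have der: "\<forall>\<^sub>F t in nhds 0. ((\<lambda>t. \<phi> (?\<sigma> t)) has_real_derivative left_inv_field G E v \<phi> (?\<sigma> t)) (at t)"
    using one_param_preimage_nhds[OF one_param_exp S p]
    by eventually_elim (rule DERIV_left_inv_field[OF f' _ one_param_exp], auto)
  have der2: "((\<lambda>t. left_inv_field G E v \<phi> (?\<sigma> t)) has_real_derivative
      left_inv_field G E v (left_inv_field G E v \<phi>) p) (at 0)"
    using DERIV_left_inv_field[OF Ck_fun_left_inv_field[OF f' S] _ one_param_exp, of p 0 v] p by simp
  have "\<forall>\<^sub>F q in nhds p. q \<in> T \<and> u q \<le> \<phi> q"
    using \<phi> T eventually_nhds_in_open[OF T(1,2)]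
    unfolding touches_above_def by (auto intro: eventually_conj)
  then obtain N where N: "open N" "p \<in> N" "\<And>q. q \<in> N \<Longrightarrow> q \<in> T \<and> u q \<le> \<phi> q"
    unfolding eventually_nhds by blast
  obtain d where d: "d > 0" "\<And>t::real. \<bar>t\<bar> < d \<Longrightarrow> ?\<sigma> t \<in> N"
    using one_param_preimage_nhds[OF one_param_exp[of v] N(1,2)]
    unfolding eventually_nhds_metric by auto
  have "\<forall>\<^sub>F t::real in nhds 0. 2 * \<phi> (?\<sigma> 0) \<le> \<phi> (?\<sigma> t) + \<phi> (?\<sigma> (- t))"
    unfolding eventually_nhds_metric
  proof (intro exI conjI allI impI)
    fix t :: real assume t: "dist t 0 < d"
    have "2 * u p \<le> u (?\<sigma> t) + u (?\<sigma> (- t))"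
      by (rule h_convex_midpoint[OF T(3) W(1) v]) (use d N t in auto)
    also have "\<dots> \<le> \<phi> (?\<sigma> t) + \<phi> (?\<sigma> (- t))"
      by (intro add_mono) (use d(2)[of t] d(2)[of "- t"] N(3) t in auto)
    finally show "2 * \<phi> (?\<sigma> 0) \<le> \<phi> (?\<sigma> t) + \<phi> (?\<sigma> (- t))"
      using \<phi> unfolding touches_above_def by simp
  qed (rule d(1))
  then have "left_inv_field G E v (left_inv_field G E v \<phi>) p \<ge> 0"
    by (rule second_derivative_nonneg[OF der der2])
  then show "\<xi> \<bullet> (horizontal_hessian G E X \<phi> p *v \<xi>) \<ge> 0"
    unfolding hessian_quadratic_form[OF conjunct1[OF \<phi>] S p, of \<xi> X] v_def .
qed

end

section \<open>From viscosity to horizontal convexity\<close>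

text \<open>The parabola is a violated chord plus a small multiple of \<open>(t - a) (b - t)\<close>; its strict concavity
  is what a test function will turn into a contradiction.\<close>

lemma not_convex_imp_above_parabola:
  fixes f :: "real \<Rightarrow> real"
  assumes "\<not> convex_on {0..1} f"
  obtains a b t0 \<epsilon> k0 k1 where "0 \<le> a" "a < t0" "t0 < b" "b \<le> 1" "\<epsilon> > 0"
    "f a = k0 + k1 * a - \<epsilon> * a\<^sup>2" "f b = k0 + k1 * b - \<epsilon> * b\<^sup>2" "f t0 > k0 + k1 * t0 - \<epsilon> * t0\<^sup>2"
proof -
  obtain s a b where s: "0 < s" "s < 1" and ab: "a \<in> {0..1}" "b \<in> {0..1}" "a < b"
    and gt: "f ((1 - s) *\<^sub>R a + s *\<^sub>R b) > (1 - s) * f a + s * f b"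
    using assms convex_on_linorderI[of "{0..1}" f] by (metis convex_real_interval(5) not_le)
  define t0 where "t0 = (1 - s) * a + s * b"
  define \<epsilon> where "\<epsilon> = (f t0 - ((1 - s) * f a + s * f b)) / 2"
  define m where "m = (f b - f a) / (b - a)"
  have \<epsilon>: "\<epsilon> > 0" using gt by (simp add: \<epsilon>_def t0_def)
  have t0: "a < t0" "t0 < b"
    using s ab mult_strict_left_mono[of a b s] mult_strict_left_mono[of a b "1 - s"]
    unfolding t0_def by (auto simp: algebra_simps)
  have mb: "m * (b - a) = f b - f a" using ab by (simp add: m_def)
  have "(t0 - a) * (b - t0) \<le> 1 * 1"
    by (rule mult_mono) (use t0 ab in auto)
  then have le: "\<epsilon> * ((t0 - a) * (b - t0)) \<le> \<epsilon>" using \<epsilon> by simp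
  have mt: "f a + m * (t0 - a) = (1 - s) * f a + s * f b"
  proof -
    have "t0 - a = s * (b - a)" by (simp add: t0_def algebra_simps)
    then have "m * (t0 - a) = s * (f b - f a)" using mb by (simp add: mult.left_commute)
    then show ?thesis by (simp add: algebra_simps)
  qed
  define q where "q t = f a + m * (t - a) + \<epsilon> * ((t - a) * (b - t))" for t
  have q: "q t = (f a - m * a - \<epsilon> * a * b) + (m + \<epsilon> * (a + b)) * t - \<epsilon> * t\<^sup>2" for t
    by (simp add: q_def algebra_simps power2_eq_square)
  have e2: "2 * \<epsilon> = f t0 - ((1 - s) * f a + s * f b)" by (simp add: \<epsilon>_def)
  have "q t0 = (1 - s) * f a + s * f b + \<epsilon> * ((t0 - a) * (b - t0))"
    by (simp add: q_def mt)
  also have "\<dots> < f t0"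
    using le \<epsilon> e2 by linarith
  finally have "f t0 > q t0" .
  moreover have "f a = q a" "f b = q b"
    using mb by (simp_all add: q_def)
  ultimately show thesis
    unfolding q by (intro that[OF _ t0 _ \<epsilon>]) (use ab in auto)
qed

lemma second_order_contact:
  fixes \<sigma> \<sigma>1 :: "real \<Rightarrow> real"
  assumes \<sigma>: "\<forall>\<^sub>F s in nhds 0. (\<sigma> has_real_derivative \<sigma>1 s) (at s)"
    and \<sigma>1: "(\<sigma>1 has_real_derivative 0) (at 0)" and "\<sigma> 0 = 0" "\<sigma>1 0 = 1" and c: "c > 0"
  shows "\<forall>\<^sub>F s in nhds 0. \<bar>\<sigma> s - s\<bar> \<le> c * s\<^sup>2"
proof -
  have "(\<lambda>s. (\<sigma>1 s - 1) / s) \<midarrow>0\<rightarrow> 0"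
    using \<sigma>1 \<open>\<sigma>1 0 = 1\<close> by (simp add: has_field_derivative_iff)
  from LIM_D[OF this c]
  obtain d1 where "d1 > 0" "\<forall>s. s \<noteq> 0 \<and> norm (s - 0) < d1 \<longrightarrow> norm ((\<sigma>1 s - 1) / s - 0) < c"
    by blast
  then have d1: "d1 > 0" "\<And>s. s \<noteq> 0 \<Longrightarrow> \<bar>s\<bar> < d1 \<Longrightarrow> \<bar>(\<sigma>1 s - 1) / s\<bar> < c"
    by auto
  obtain d2 where d2: "d2 > 0" "\<And>s. \<bar>s\<bar> < d2 \<Longrightarrow> (\<sigma> has_real_derivative \<sigma>1 s) (at s)"
    using \<sigma> unfolding eventually_nhds_metric dist_real_def by auto
  have bnd: "\<bar>\<sigma>1 s - 1\<bar> \<le> c * \<bar>s\<bar>" if "\<bar>s\<bar> < d1" for s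
    using d1(2)[of s] that \<open>\<sigma>1 0 = 1\<close> by (cases "s = 0") (auto simp: divide_simps)
  have "\<bar>\<sigma> s - s\<bar> \<le> c * s\<^sup>2" if s: "\<bar>s\<bar> < min d1 d2" for s
  proof -
    let ?I = "{- \<bar>s\<bar>..\<bar>s\<bar>}"
    have "norm ((\<sigma> s - s) - (\<sigma> 0 - 0)) \<le> (c * \<bar>s\<bar>) * norm (s - 0)"
    proof (rule field_differentiable_bound[of ?I "\<lambda>s. \<sigma> s - s" "\<lambda>z. \<sigma>1 z - 1"])
      fix z assume z: "z \<in> ?I"
      have zs: "\<bar>z\<bar> \<le> \<bar>s\<bar>" using z by (simp add: abs_le_iff)
      then have z12: "\<bar>z\<bar> < d1" "\<bar>z\<bar> < d2" using s by linarith+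
      show "((\<lambda>s. \<sigma> s - s) has_field_derivative \<sigma>1 z - 1) (at z within ?I)"
        by (rule has_field_derivative_at_within[OF DERIV_diff[OF d2(2)[OF z12(2)] DERIV_ident]])
      have "\<bar>\<sigma>1 z - 1\<bar> \<le> c * \<bar>z\<bar>" by (rule bnd[OF z12(1)])
      also have "\<dots> \<le> c * \<bar>s\<bar>" by (rule mult_left_mono[OF zs less_imp_le[OF c]])
      finally show "norm (\<sigma>1 z - 1) \<le> c * \<bar>s\<bar>" by simp
    qed auto
    then show ?thesis using \<open>\<sigma> 0 = 0\<close> by (simp add: power2_eq_square abs_mult_self_eq mult.assoc)
  qed
  then show ?thesis
    unfolding eventually_nhds_metric dist_real_def using d1 d2 by (intro exI[of _ "min d1 d2"]) auto
qed

lemma DERIV_imp_local_Lipschitz: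
  fixes h :: "real \<Rightarrow> real"
  assumes "(h has_real_derivative D) (at 0)"
  shows "\<forall>\<^sub>F s in nhds 0. \<bar>h s - h 0\<bar> \<le> (\<bar>D\<bar> + 1) * \<bar>s\<bar>"
proof -
  have "(\<lambda>s. (h s - h 0) / s) \<midarrow>0\<rightarrow> D"
    using assms by (simp add: has_field_derivative_iff)
  from LIM_D[OF this zero_less_one]
  obtain d where "d > 0" "\<forall>s. s \<noteq> 0 \<and> norm (s - 0) < d \<longrightarrow> norm ((h s - h 0) / s - D) < 1"
    by blast
  then have d: "d > 0" "\<And>s. s \<noteq> 0 \<Longrightarrow> \<bar>s\<bar> < d \<Longrightarrow> \<bar>(h s - h 0) / s - D\<bar> < 1"
    by auto
  have "\<bar>h s - h 0\<bar> \<le> (\<bar>D\<bar> + 1) * \<bar>s\<bar>" if "\<bar>s\<bar> < d" for s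
  proof (cases "s = 0")
    case False
    then have "\<bar>(h s - h 0) / s\<bar> \<le> \<bar>D\<bar> + 1" using d(2)[OF False that] by linarith
    then show ?thesis using False by (simp add: divide_simps)
  qed auto
  then show ?thesis
    unfolding eventually_nhds_metric dist_real_def using d(1) by auto
qed

lemma Ck_on_real_deriv:
  fixes f :: "real \<Rightarrow> real"
  assumes "Ck_on (Suc k) J f"
  shows "s \<in> J \<Longrightarrow> (f has_real_derivative deriv f s) (at s)"
    and "open J \<Longrightarrow> Ck_on k J (deriv f)"
proof -
  have der: "(f has_real_derivative deriv f s) (at s)" if "s \<in> J" for s
    using assms that by (simp add: DERIV_deriv_iff_real_differentiable)
  show "s \<in> J \<Longrightarrow> (f has_real_derivative deriv f s) (at s)" by (rule der)
  assume "open J"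
  have "frechet_derivative f (at s) 1 = deriv f s" if "s \<in> J" for s
    using frechet_derivative_at[OF der[OF that, unfolded has_field_derivative_def]] by (metis mult.right_neutral)
  then show "Ck_on k J (deriv f)"
    by (rule Ck_on_eq[OF Ck_on_SucD(2)[OF assms, of 1] \<open>open J\<close>])
qed

text \<open>One application of \<open>cubic_part\<close> gives a bump that is constant on no ball about \<open>e\<close>. A second one, to
  \<open>1 - bump\<close>, truncates the region where the first bump exceeds \<open>1\<close> and makes it flat there.\<close>

lemma C2_cutoff:
  fixes e :: "'a::euclidean_space"
  assumes "R > 0"
  obtains \<beta> where "Ck_on 2 UNIV \<beta>" "\<And>x. norm (x - e) \<le> R / 2 \<Longrightarrow> \<beta> x = (1::real)"
    "\<And>x. norm (x - e) \<ge> R \<Longrightarrow> \<beta> x = 0"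
proof
  define \<beta> where "\<beta> x = 1 - cubic_part (1 - cubic_part (2 - 2 / R\<^sup>2 * ((x - e) \<bullet> (x - e))))" for x
  have sq: "(x - e) \<bullet> (x - e) = (norm (x - e))\<^sup>2" for x by (simp add: power2_norm_eq_inner)
  have c: "Ck_on 2 UNIV (\<lambda>x. cubic_part (f x))" if "Ck_on 2 UNIV f" for f :: "'a \<Rightarrow> real"
    by (rule Ck_on_compose[OF open_UNIV open_UNIV that Ck_on_cubic_part]) auto
  show "Ck_on 2 UNIV \<beta>"
    unfolding \<beta>_def
    by (intro c Ck_on_diff Ck_on_const Ck_on_mult Ck_on_inner Ck_on_id open_UNIV)
  show "\<beta> x = 1" if "norm (x - e) \<le> R / 2" for x
  proof -
    have "(norm (x - e))\<^sup>2 \<le> (R / 2)\<^sup>2" using that by (rule power_mono) simp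
    then have "4 * (norm (x - e))\<^sup>2 \<le> R\<^sup>2" by (simp add: power_divide)
    then have "2 * (norm (x - e))\<^sup>2 \<le> R\<^sup>2" using zero_le_power2[of "norm (x - e)"] by linarith
    then have "2 / R\<^sup>2 * ((x - e) \<bullet> (x - e)) \<le> 1"
      using assms unfolding sq by (simp add: divide_le_eq)
    then show ?thesis
      unfolding \<beta>_def using cubic_part_simps(1) cubic_part_simps(4) by simp
  qed
  show "\<beta> x = 0" if "norm (x - e) \<ge> R" for x
  proof -
    have "R\<^sup>2 \<le> (norm (x - e))\<^sup>2" using that assms by (intro power_mono) auto
    then have "2 - 2 / R\<^sup>2 * ((x - e) \<bullet> (x - e)) \<le> 0"
      using assms unfolding sq by (simp add: field_simps)
    then show ?thesis
      unfolding \<beta>_def by (simp add: cubic_part_simps(1) cubic_part_def[of 1])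
  qed
qed

context lie_group_exp
begin

text \<open>Test functions have to be defined and regular on all of the domain, so a function given in a
  chart near a point is cut off; that the result is regular across the boundary of the chart uses
  that compact sets are closed.\<close>

lemma extend_test_function:
  fixes f :: "'v \<Rightarrow> real"
  assumes f: "Ck_on 2 U f" and U: "open U" "e0 \<in> U" "U \<subseteq> coords"
  obtains \<phi> where "Ck_fun A 2 UNIV \<phi>"
    "\<forall>\<^sub>F p in nhds g. inv g \<otimes> p \<in> fst \<kappa> \<and> snd \<kappa> (inv g \<otimes> p) \<in> U \<and> \<phi> p = f (snd \<kappa> (inv g \<otimes> p))"
proof -
  obtain R where R: "R > 0" "cball e0 R \<subseteq> U"
    using U open_contains_cball by blast
  obtain \<beta> :: "'v \<Rightarrow> real" where \<beta>: "Ck_on 2 UNIV \<beta>" "\<And>x. norm (x - e0) \<le> R / 2 \<Longrightarrow> \<beta> x = 1"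
    "\<And>x. norm (x - e0) \<ge> R \<Longrightarrow> \<beta> x = 0"
    using C2_cutoff[where e=e0, OF R(1)] by blast
  define L where "L p = inv g \<otimes> p" for p
  define D where "D = chart_inv \<kappa> ` cball e0 R"
  define \<phi> where "\<phi> p = (if L p \<in> D then \<beta> (snd \<kappa> (L p)) * f (snd \<kappa> (L p)) else 0)" for p
  define W1 where "W1 = L -` (fst \<kappa> \<inter> snd \<kappa> -` U)"
  define W2 where "W2 = L -` (- D)"
  note ch = chartD[OF chart_at_one(1)]
  have contL: "continuous_on UNIV L"
    unfolding L_def by (intro continuous_intros)
  have openL: "open (L -` T)" if "open T" for T
    using continuous_open_preimage[OF contL open_UNIV that] by simp
  have "open (fst \<kappa> \<inter> snd \<kappa> -` U)"
    by (rule continuous_open_preimage[OF ch(3,1) U(1)])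
  then have W1: "open W1"
    unfolding W1_def by (rule openL)
  have "compact D"
    unfolding D_def
    by (rule compact_continuous_image[OF continuous_on_subset[OF ch(4)] compact_cball]) (use R U in auto)
  then have W2: "open W2"
    unfolding W2_def by (intro openL open_Compl compact_imp_closed)
  have D_iff: "q \<in> D \<longleftrightarrow> q \<in> fst \<kappa> \<and> snd \<kappa> q \<in> cball e0 R" for q
  proof
    assume "q \<in> D"
    then obtain x where x: "x \<in> cball e0 R" "q = chart_inv \<kappa> x" unfolding D_def by blast
    then have "x \<in> coords" using R(2) U(3) by blast
    then show "q \<in> fst \<kappa> \<and> snd \<kappa> q \<in> cball e0 R" using x ch(5,6) by metis
  next
    assume "q \<in> fst \<kappa> \<and> snd \<kappa> q \<in> cball e0 R"
    then show "q \<in> D" unfolding D_def using ch(7) by (metis imageI)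
  qed
  have cover: "p \<in> W1 \<or> p \<in> W2" for p
    using D_iff R(2) by (auto simp: W1_def W2_def)
  have on_W1: "\<phi> p = \<beta> (snd \<kappa> (L p)) * f (snd \<kappa> (L p))" if "p \<in> W1" for p
    using that \<beta>(3)[of "snd \<kappa> (L p)"] by (auto simp: \<phi>_def W1_def D_iff dist_norm norm_minus_commute)
  show thesis
  proof
    show "Ck_fun A 2 UNIV \<phi>"
      unfolding Ck_fun_def
    proof (intro ballI Ck_on_local)
      fix c x assume c: "c \<in> A" and x: "x \<in> snd c ` (fst c \<inter> UNIV)"
      show "\<exists>V. open V \<and> x \<in> V \<and> Ck_on 2 V (\<phi> \<circ> chart_inv c)"
      proof (cases "chart_inv c x \<in> W1")
        case True
        define V where "V = snd c ` fst c \<inter> chart_inv c -` W1"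
        have V: "open V" "x \<in> V"
          unfolding V_def using continuous_open_preimage[OF chartD(4,2)[OF c] W1] True x by auto
        have "Ck_into 2 V (\<lambda>y. L (chart_inv c y))"
          unfolding L_def by (intro Ck_into_mult[OF V(1)] Ck_into_const Ck_into_subset[OF Ck_into_chart_inv[OF c]])
            (auto simp: V_def)
        then have "Ck_on 2 V (\<lambda>y. snd \<kappa> (L (chart_inv c y)))"
          by (rule Ck_on_subset[OF Ck_intoD(2)[OF _ chart_at_one(1)]]) (auto simp: V_def W1_def)
        then have "Ck_on 2 V (\<lambda>y. (\<lambda>z. \<beta> z * f z) (snd \<kappa> (L (chart_inv c y))))"
          by (rule Ck_on_compose[OF V(1) U(1) _ Ck_on_mult[OF U(1) Ck_on_subset[OF \<beta>(1)] f]])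
            (auto simp: V_def W1_def)
        then have "Ck_on 2 V (\<phi> \<circ> chart_inv c)"
          by (rule Ck_on_eq[OF _ V(1)]) (auto simp: V_def on_W1)
        then show ?thesis using V by blast
      next
        case False
        define V where "V = snd c ` fst c \<inter> chart_inv c -` W2"
        have V: "open V" "x \<in> V"
          unfolding V_def using continuous_open_preimage[OF chartD(4,2)[OF c] W2] False cover x by auto
        have "Ck_on 2 V (\<phi> \<circ> chart_inv c)"
          by (rule Ck_on_eq[OF Ck_on_const[of _ _ 0] V(1)]) (auto simp: V_def W2_def \<phi>_def)
        then show ?thesis using V by blast
      qed
    qed
    define N where "N = L -` (fst \<kappa> \<inter> snd \<kappa> -` ball e0 (R / 2))"
    have "open (fst \<kappa> \<inter> snd \<kappa> -` ball e0 (R / 2))"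
      by (rule continuous_open_preimage[OF ch(3,1) open_ball])
    then have "open N"
      unfolding N_def by (rule openL)
    moreover have "g \<in> N"
      using R(1) chart_at_one(2) by (simp add: N_def L_def)
    ultimately have "\<forall>\<^sub>F p in nhds g. p \<in> N" by (rule eventually_nhds_in_open)
    then show "\<forall>\<^sub>F p in nhds g. inv g \<otimes> p \<in> fst \<kappa> \<and> snd \<kappa> (inv g \<otimes> p) \<in> U \<and> \<phi> p = f (snd \<kappa> (inv g \<otimes> p))"
    proof eventually_elim
      case (elim p)
      have "snd \<kappa> (L p) \<in> cball e0 R" using elim R(1) by (auto simp: N_def)
      then have "p \<in> W1" using elim R by (auto simp: W1_def N_def)
      moreover have "\<beta> (snd \<kappa> (L p)) = 1"
        using elim by (intro \<beta>(2)) (auto simp: N_def dist_norm norm_minus_commute)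
      ultimately show ?case
        using on_W1 by (auto simp: W1_def L_def)
    qed
  qed
qed

text \<open>A linear coordinate normalised on \<open>v\<close> agrees with the parameter of \<open>s \<mapsto> E (s v)\<close> to first
  order. Subtracting a multiple of its square removes its second derivative along the curve.\<close>

lemma second_order_parameter:
  assumes v: "v \<noteq> 0"
  obtains \<tau> :: "'v \<Rightarrow> real" where "Ck_on 2 UNIV \<tau>" "\<tau> e0 = 0"
    "\<And>c. c > 0 \<Longrightarrow> \<forall>\<^sub>F s in nhds 0. \<bar>\<tau> (snd \<kappa> (E (s *\<^sub>R v))) - s\<bar> \<le> c * s\<^sup>2"
proof -
  define l where "l x = ((x - e0) \<bullet> v) * (1 / (v \<bullet> v))" for x
  define J where "J = (\<lambda>s. E (s *\<^sub>R v)) -` fst \<kappa>"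
  define f where "f s = l (snd \<kappa> (E (s *\<^sub>R v)))" for s
  have J: "open J" "0 \<in> J"
    using Ck_into_open_preimage[OF Ck_into_exp open_UNIV chartD(1)[OF chart_at_one(1)], of v] chart_at_one
    by (auto simp: J_def)
  have l: "Ck_on 2 UNIV l"
    unfolding l_def by (intro Ck_on_mult Ck_on_inner Ck_on_diff Ck_on_id Ck_on_const open_UNIV)
  have \<gamma>: "Ck_on 2 J (\<lambda>s. snd \<kappa> (E (s *\<^sub>R v)))"
    using Ck_intoD(2)[OF Ck_into_exp chart_at_one(1), of 2 v] by (simp add: J_def)
  have f: "Ck_on (Suc (Suc 0)) J f"
    using Ck_on_compose[OF J(1) open_UNIV \<gamma> l] by (simp add: f_def[abs_def] numeral_2_eq_2)
  note f1 = Ck_on_real_deriv[OF f]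
  note f2 = Ck_on_real_deriv[OF f1(2)[OF J(1)]]
  have f0: "f 0 = 0" by (simp add: f_def l_def)
  have "((\<lambda>s. snd \<kappa> (E (s *\<^sub>R v))) has_derivative (\<lambda>h. h *\<^sub>R v)) (at 0)"
    using one_paramD(4)[OF one_param_exp] by (simp add: has_vector_derivative_def)
  then have "(f has_derivative (\<lambda>h. ((h *\<^sub>R v - 0) \<bullet> v) * (1 / (v \<bullet> v)))) (at 0)"
    unfolding f_def l_def
    by (intro has_derivative_mult_left has_derivative_inner_left has_derivative_diff has_derivative_const)
  then have "(f has_real_derivative 1) (at 0)"
    using v by (simp add: has_field_derivative_def lambda_one[symmetric])
  then have d1: "deriv f 0 = 1" by (rule DERIV_imp_deriv)
  define b where "b = deriv (deriv f) 0"
  define \<tau> where "\<tau> x = l x - b / 2 * (l x)\<^sup>2" for x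
  show thesis
  proof
    show "Ck_on 2 UNIV \<tau>"
      unfolding \<tau>_def by (intro Ck_on_diff Ck_on_mult Ck_on_power Ck_on_const l open_UNIV)
    show "\<tau> e0 = 0" by (simp add: \<tau>_def l_def)
    fix c :: real assume c: "c > 0"
    have "\<forall>\<^sub>F s in nhds 0. \<bar>(f s - b / 2 * (f s)\<^sup>2) - s\<bar> \<le> c * s\<^sup>2"
    proof (rule second_order_contact[OF _ _ _ _ c])
      show "\<forall>\<^sub>F s in nhds 0. ((\<lambda>s. f s - b / 2 * (f s)\<^sup>2) has_real_derivative
          deriv f s - b * (f s * deriv f s)) (at s)"
        using eventually_nhds_in_open[OF J]
      proof eventually_elim
        case (elim s)
        show ?case
          by (rule derivative_eq_intros f1(1)[OF elim] refl)+ simp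
      qed
      have "((\<lambda>s. deriv f s - b * (f s * deriv f s)) has_real_derivative
          b - b * (deriv f 0 * deriv f 0 + b * f 0)) (at 0)"
        unfolding b_def
        by (rule DERIV_diff[OF f2(1)[OF J(2)] DERIV_cmult[OF DERIV_mult[OF f1(1)[OF J(2)] f2(1)[OF J(2)]]]])
      then show "((\<lambda>s. deriv f s - b * (f s * deriv f s)) has_real_derivative 0) (at 0)"
        by (simp add: d1 f0)
    qed (simp_all add: f0 d1)
    then show "\<forall>\<^sub>F s in nhds 0. \<bar>\<tau> (snd \<kappa> (E (s *\<^sub>R v))) - s\<bar> \<le> c * s\<^sup>2"
      by (simp add: \<tau>_def f_def)
  qed
qed

end

text \<open>A reparametrisation that agrees with \<open>s\<close> up to \<open>o(s\<^sup>2)\<close> changes the value of a Lipschitz function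
  by \<open>o(s\<^sup>2)\<close> only, so the second symmetric differences of the parabola survive. The function \<open>h\<close> is
  merely differentiable, since its argument \<open>s - \<tau> s\<close> is itself \<open>o(s\<^sup>2)\<close>.\<close>

lemma concave_perturbation:
  fixes g h \<tau> :: "real \<Rightarrow> real"
  assumes g: "\<forall>\<^sub>F s in nhds 0. g s = k0 + k1 * (ts + \<tau> s) - \<epsilon> * (ts + \<tau> s)\<^sup>2 + h (s - \<tau> s)"
    and h: "(h has_real_derivative D) (at 0)" and "\<epsilon> > 0" and \<tau>0: "\<tau> 0 = 0"
    and \<tau>: "\<And>c. c > 0 \<Longrightarrow> \<forall>\<^sub>F s in nhds 0. \<bar>\<tau> s - s\<bar> \<le> c * s\<^sup>2"
  shows "\<forall>\<^sub>F s in nhds 0. g s + g (- s) \<le> 2 * g 0 - \<epsilon> * s\<^sup>2"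
proof -
  define q where "q t = k0 + k1 * t - \<epsilon> * t\<^sup>2" for t
  define M where "M = \<bar>k1\<bar> + \<epsilon> * (2 * \<bar>ts\<bar> + 2)"
  define L where "L = \<bar>D\<bar> + 1"
  \<comment> \<open>\<open>M\<close> and \<open>L\<close> are Lipschitz constants of \<open>q\<close> and \<open>h\<close>; with this \<open>c\<close> the total error is half the
    second difference \<open>2 \<epsilon> s\<^sup>2\<close> of the parabola.\<close>
  define c where "c = \<epsilon> / (2 * (M + L))"
  have "M \<ge> 0" using \<open>\<epsilon> > 0\<close> by (simp add: M_def)
  have MLpos: "M + L > 0" using \<open>M \<ge> 0\<close> by (simp add: L_def)
  have "c > 0" using MLpos \<open>\<epsilon> > 0\<close> by (simp add: c_def)
  have q: "\<bar>q (ts + x) - q (ts + y)\<bar> \<le> M * \<bar>x - y\<bar>" if "\<bar>x\<bar> \<le> 1" "\<bar>y\<bar> \<le> 1" for x y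
  proof -
    have "q (ts + x) - q (ts + y) = (k1 - \<epsilon> * (2 * ts + (x + y))) * (x - y)"
      by (simp add: q_def algebra_simps power2_eq_square)
    moreover have "\<bar>k1 - \<epsilon> * (2 * ts + (x + y))\<bar> \<le> \<bar>k1\<bar> + \<bar>\<epsilon> * (2 * ts + (x + y))\<bar>"
      by (rule abs_triangle_ineq4)
    moreover have "\<bar>\<epsilon> * (2 * ts + (x + y))\<bar> \<le> \<epsilon> * (2 * \<bar>ts\<bar> + 2)"
      unfolding abs_mult using that \<open>\<epsilon> > 0\<close> by (intro mult_mono) auto
    ultimately show ?thesis
      unfolding M_def by (auto simp: abs_mult intro!: mult_right_mono)
  qed
  obtain d where d: "d > 0" "\<And>x. \<bar>x\<bar> < d \<Longrightarrow> \<bar>h x - h 0\<bar> \<le> L * \<bar>x\<bar>"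
    using DERIV_imp_local_Lipschitz[OF h] unfolding eventually_nhds_metric dist_real_def L_def by auto
  have lim: "((\<lambda>s::real. c * s\<^sup>2) \<longlongrightarrow> c * 0\<^sup>2) (nhds 0)"
    by (intro tendsto_intros filterlim_ident)
  have "\<forall>\<^sub>F s in nhds 0. c * s\<^sup>2 < min d (1 / 2)"
    by (rule order_tendstoD(2)[OF lim]) (use d in auto)
  moreover have "\<forall>\<^sub>F s::real in nhds 0. \<bar>s\<bar> < 1 / 2"
    unfolding eventually_nhds_metric by (intro exI[of _ "1/2"]) auto
  ultimately have "\<forall>\<^sub>F s in nhds 0. \<bar>g s - (q (ts + s) + h 0)\<bar> \<le> \<epsilon> / 2 * s\<^sup>2"
    using g \<tau>[OF \<open>c > 0\<close>]
  proof eventually_elim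
    case (elim s)
    have "\<bar>q (ts + \<tau> s) - q (ts + s)\<bar> \<le> M * \<bar>\<tau> s - s\<bar>"
      by (rule q) (use elim in auto)
    also have "\<dots> \<le> M * (c * s\<^sup>2)"
      by (rule mult_left_mono) (use elim \<open>M \<ge> 0\<close> in auto)
    finally have 1: "\<bar>q (ts + \<tau> s) - q (ts + s)\<bar> \<le> M * (c * s\<^sup>2)" .
    have "\<bar>h (s - \<tau> s) - h 0\<bar> \<le> L * \<bar>s - \<tau> s\<bar>"
      by (rule d(2)) (use elim in auto)
    also have "\<dots> \<le> L * (c * s\<^sup>2)"
      by (rule mult_left_mono) (use elim in \<open>auto simp: L_def\<close>)
    finally have 2: "\<bar>h (s - \<tau> s) - h 0\<bar> \<le> L * (c * s\<^sup>2)" .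
    have "M * (c * s\<^sup>2) + L * (c * s\<^sup>2) = ((M + L) * c) * s\<^sup>2" by (simp add: algebra_simps)
    also have "(M + L) * c = \<epsilon> / 2" using MLpos by (simp add: c_def divide_simps)
    finally have 3: "M * (c * s\<^sup>2) + L * (c * s\<^sup>2) = \<epsilon> / 2 * s\<^sup>2" .
    have "g s = q (ts + \<tau> s) + h (s - \<tau> s)" using elim by (simp add: q_def)
    then show ?case using 1 2 3 by linarith
  qed
  then obtain d' where d': "d' > 0" "\<And>s. \<bar>s\<bar> < d' \<Longrightarrow> \<bar>g s - (q (ts + s) + h 0)\<bar> \<le> \<epsilon> / 2 * s\<^sup>2"
    unfolding eventually_nhds_metric dist_real_def by auto
  have "g s + g (- s) \<le> 2 * g 0 - \<epsilon> * s\<^sup>2" if s: "\<bar>s\<bar> < d'" for s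
  proof -
    have "g 0 = q ts + h 0" using d'(2)[of 0] d'(1) by simp
    moreover have "q (ts + s) + q (ts + - s) = 2 * q ts - 2 * \<epsilon> * s\<^sup>2"
      by (simp add: q_def algebra_simps power2_eq_square)
    moreover have "g s - (q (ts + s) + h 0) \<le> \<epsilon> / 2 * s\<^sup>2" "g (- s) - (q (ts + - s) + h 0) \<le> \<epsilon> / 2 * s\<^sup>2"
      using abs_le_D1[OF d'(2)[of s]] abs_le_D1[OF d'(2)[of "- s"]] s by auto
    ultimately show ?thesis by (simp add: field_simps)
  qed
  then show ?thesis
    unfolding eventually_nhds_metric dist_real_def using d'(1) by auto
qed

context lie_group_exp
begin

lemma exp_add: "E (s *\<^sub>R v) \<otimes> E (t *\<^sub>R v) = E ((s + t) *\<^sub>R v)"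
  by (rule one_paramD(2)[OF one_param_exp, symmetric])

lemma exp_add_assoc: "E (s *\<^sub>R v) \<otimes> (E (t *\<^sub>R v) \<otimes> b) = E ((s + t) *\<^sub>R v) \<otimes> b"
  by (simp add: exp_add flip: m_assoc)

lemma cancel_inv: "inv a \<otimes> (a \<otimes> b) = b" "a \<otimes> (inv a \<otimes> b) = b"
  by (simp_all flip: m_assoc)

text \<open>The integral curve through \<open>p\<close> is embedded into the family of its left translates \<open>p \<omega>\<close>, with
  \<open>\<omega>\<close> near the identity. A large penalty on \<open>\<omega>\<close> keeps the maximum away from the boundary of the
  compact parameter set in all directions transverse to the curve.\<close>

lemma penalised_interior_maximum:
  fixes q :: "real \<Rightarrow> real"
  assumes S: "open S" and u: "continuous_on S u" and seg: "\<And>t. t \<in> {a..b} \<Longrightarrow> p \<otimes> E (t *\<^sub>R v) \<in> S"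
    and q: "continuous_on {a..b} q" and ab: "a < t0" "t0 < b"
    and bd: "u (p \<otimes> E (a *\<^sub>R v)) = q a" "u (p \<otimes> E (b *\<^sub>R v)) = q b" "u (p \<otimes> E (t0 *\<^sub>R v)) > q t0"
  obtains r \<omega>s ts N where "cball e0 r \<subseteq> coords" "\<omega>s \<in> ball e0 r" "a < ts" "ts < b"
    "\<forall>\<omega>\<in>cball e0 r. \<forall>t\<in>{a..b}. p \<otimes> chart_inv \<kappa> \<omega> \<otimes> E (t *\<^sub>R v) \<in> S"
    "\<forall>\<omega>\<in>cball e0 r. \<forall>t\<in>{a..b}.
      u (p \<otimes> chart_inv \<kappa> \<omega> \<otimes> E (t *\<^sub>R v)) - q t - N * (norm (\<omega> - e0))\<^sup>2 \<le>
      u (p \<otimes> chart_inv \<kappa> \<omega>s \<otimes> E (ts *\<^sub>R v)) - q ts - N * (norm (\<omega>s - e0))\<^sup>2"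
proof -
  define \<Phi> where "\<Phi> z = p \<otimes> chart_inv \<kappa> (fst z) \<otimes> E (snd z *\<^sub>R v)" for z
  define \<delta> where "\<delta> = u (p \<otimes> E (t0 *\<^sub>R v)) - q t0"
  have "\<delta> > 0" using bd(3) by (simp add: \<delta>_def)
  note ch = chartD[OF chart_at_one(1)]
  have \<Phi>e: "\<Phi> (e0, t) = p \<otimes> E (t *\<^sub>R v)" for t
    using ch(7)[OF chart_at_one(2)] by (simp add: \<Phi>_def)
  have cont\<Phi>: "continuous_on (coords \<times> UNIV) \<Phi>"
    unfolding \<Phi>_def
    by (intro continuous_intros continuous_on_compose2[OF ch(4)] 
        continuous_on_compose2[OF one_paramD(1)[OF one_param_exp, where S=UNIV]]) auto
  define W where "W = (coords \<times> UNIV) \<inter> \<Phi> -` S"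
  have W: "open W"
    unfolding W_def by (rule continuous_open_preimage[OF cont\<Phi> open_Times[OF ch(2) open_UNIV] S])
  have contW: "continuous_on W (\<lambda>z. u (\<Phi> z))"
    by (rule continuous_on_compose2[OF u continuous_on_subset[OF cont\<Phi>]]) (auto simp: W_def)
  have eW: "{e0} \<times> {a..b} \<subseteq> W"
    using seg chart_at_one(2) by (auto simp: W_def \<Phi>e)
  obtain X0 where X0: "e0 \<in> X0" "open X0" "X0 \<times> {a..b} \<subseteq> W"
    using Elementary_Topology.tube_lemma[OF compact_Icc W eW] by blast
  have end_small: "\<forall>\<^sub>F \<omega> in nhds e0. u (\<Phi> (\<omega>, t)) < q t + \<delta>" if "t \<in> {a..b}" "u (p \<otimes> E (t *\<^sub>R v)) = q t" for t
  proof -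
    have "continuous_on X0 (\<lambda>\<omega>. u (\<Phi> (\<omega>, t)))"
      by (rule continuous_on_compose2[OF contW]) (use X0 that in \<open>auto intro!: continuous_intros\<close>)
    then have "isCont (\<lambda>\<omega>. u (\<Phi> (\<omega>, t))) e0"
      using X0 by (simp add: continuous_on_eq_continuous_at)
    then have "((\<lambda>\<omega>. u (\<Phi> (\<omega>, t))) \<longlongrightarrow> q t) (nhds e0)"
      using that tendsto_at_iff_tendsto_nhds[of "\<lambda>\<omega>. u (\<Phi> (\<omega>, t))" e0] by (simp add: isCont_def \<Phi>e)
    then show ?thesis by (rule order_tendstoD(2)) (use \<open>\<delta> > 0\<close> in simp)
  qed
  have "\<forall>\<^sub>F \<omega> in nhds e0. \<omega> \<in> X0 \<and> u (\<Phi> (\<omega>, a)) < q a + \<delta> \<and> u (\<Phi> (\<omega>, b)) < q b + \<delta>"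
    using eventually_nhds_in_open[OF X0(2,1)] end_small[of a] end_small[of b] ab bd
    by (intro eventually_conj) auto
  then obtain N0 where N0: "open N0" "e0 \<in> N0"
      "\<And>\<omega>. \<omega> \<in> N0 \<Longrightarrow> \<omega> \<in> X0 \<and> u (\<Phi> (\<omega>, a)) < q a + \<delta> \<and> u (\<Phi> (\<omega>, b)) < q b + \<delta>"
    unfolding eventually_nhds by blast
  obtain r where r: "r > 0" "cball e0 r \<subseteq> N0"
    using N0(1,2) open_contains_cball by blast
  define Q where "Q = cball e0 r \<times> {a..b}"
  have QW: "Q \<subseteq> W" using r N0(3) X0(3) by (auto simp: Q_def)
  have Q: "compact Q" unfolding Q_def by (intro compact_Times compact_cball compact_Icc)
  have Qne: "(e0, t0) \<in> Q" using r ab by (auto simp: Q_def)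
  define m where "m z = u (\<Phi> z) - q (snd z)" for z
  have contm: "continuous_on Q m"
    unfolding m_def
    by (intro continuous_intros continuous_on_subset[OF contW QW] continuous_on_compose2[OF q])
      (auto simp: Q_def)
  obtain M where M: "\<And>z. z \<in> Q \<Longrightarrow> m z \<le> M"
    using continuous_attains_sup[OF Q _ contm] Qne by blast
  \<comment> \<open>On the sphere of radius \<open>r\<close> this penalty pushes the functional below \<open>\<delta>\<close>, its value at \<open>(e0, t0)\<close>;
    at \<open>t = a\<close> and \<open>t = b\<close> it is below \<open>\<delta>\<close> because \<open>r\<close> is small.\<close>
  define N where "N = (M - \<delta> + 1) / r\<^sup>2"
  define F where "F z = m z - N * (norm (fst z - e0))\<^sup>2" for z
  have "continuous_on Q F"
    unfolding F_def by (intro continuous_intros contm)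
  then obtain z where z: "z \<in> Q" "\<And>y. y \<in> Q \<Longrightarrow> F y \<le> F z"
    using continuous_attains_sup[OF Q] Qne by blast
  have "F (e0, t0) = \<delta>" by (simp add: F_def m_def \<Phi>e \<delta>_def)
  then have Fz: "F z \<ge> \<delta>" using z(2)[OF Qne] by simp
  obtain \<omega>s ts where zs: "z = (\<omega>s, ts)" by (cases z)
  have mem: "\<omega>s \<in> cball e0 r" "ts \<in> {a..b}" using z(1) by (auto simp: Q_def zs)
  have "m (e0, t0) \<le> M" by (rule M[OF Qne])
  then have "M \<ge> \<delta>" by (simp add: m_def \<Phi>e \<delta>_def)
  then have "N \<ge> 0" using r(1) by (simp add: N_def)
  have ball: "\<omega>s \<in> ball e0 r"
  proof (rule ccontr)
    assume "\<omega>s \<notin> ball e0 r"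
    then have "norm (\<omega>s - e0) = r" using mem(1) by (simp add: dist_norm norm_minus_commute)
    then have "F z \<le> M - (M - \<delta> + 1)"
      using M[OF z(1)] r(1) by (simp add: F_def zs N_def)
    then show False using Fz by simp
  qed
  have "F z \<le> m z" using \<open>N \<ge> 0\<close> by (simp add: F_def)
  then have "ts \<noteq> a" "ts \<noteq> b"
    using Fz N0(3)[of \<omega>s] mem(1) r(2) by (auto simp: m_def zs)
  then have ts: "a < ts" "ts < b" using mem(2) by auto
  have coords: "cball e0 r \<subseteq> coords"
  proof
    fix \<omega> assume "\<omega> \<in> cball e0 r"
    then have "(\<omega>, t0) \<in> W" using QW ab by (auto simp: Q_def)
    then show "\<omega> \<in> coords" by (simp add: W_def)
  qed
  have inS: "p \<otimes> chart_inv \<kappa> \<omega> \<otimes> E (t *\<^sub>R v) \<in> S" if "\<omega> \<in> cball e0 r" "t \<in> {a..b}" for \<omega> t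
  proof -
    have "(\<omega>, t) \<in> W" using QW that by (auto simp: Q_def)
    then show ?thesis by (simp add: W_def \<Phi>_def)
  qed
  have max: "u (p \<otimes> chart_inv \<kappa> \<omega> \<otimes> E (t *\<^sub>R v)) - q t - N * (norm (\<omega> - e0))\<^sup>2 \<le>
      u (p \<otimes> chart_inv \<kappa> \<omega>s \<otimes> E (ts *\<^sub>R v)) - q ts - N * (norm (\<omega>s - e0))\<^sup>2"
    if "\<omega> \<in> cball e0 r" "t \<in> {a..b}" for \<omega> t
    using z(2)[of "(\<omega>, t)"] that by (simp add: Q_def F_def m_def \<Phi>_def zs)
  show thesis by (rule that[OF coords ball ts]) (use inS max in blast)+
qed


text \<open>At the penalised maximum every factorisation \<open>x = p \<omega> E (t v)\<close> gives an upper bound for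
  \<open>u x\<close>. Choosing \<open>t\<close> as a smooth function of \<open>x\<close> yields a test function, and choosing it so that
  \<open>t\<close> is, to second order, the parameter of the integral curve through the contact point makes
  \<open>\<omega>\<close> constant to second order along this curve, on which the test function is then the parabola up to
  a constant and \<open>o(s\<^sup>2)\<close>.\<close>

lemma parabola_test_function:
  assumes S: "open S" and u: "continuous_on S u" and seg: "\<And>t. t \<in> {a..b} \<Longrightarrow> p \<otimes> E (t *\<^sub>R v) \<in> S"
    and ab: "a < t0" "t0 < b" and \<epsilon>: "\<epsilon> > 0" and v: "v \<noteq> 0"
    and bd: "u (p \<otimes> E (a *\<^sub>R v)) = k0 + k1 * a - \<epsilon> * a\<^sup>2" "u (p \<otimes> E (b *\<^sub>R v)) = k0 + k1 * b - \<epsilon> * b\<^sup>2"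
      "u (p \<otimes> E (t0 *\<^sub>R v)) > k0 + k1 * t0 - \<epsilon> * t0\<^sup>2"
  obtains x \<phi> where "x \<in> S" "Ck_fun A 2 UNIV \<phi>" "touches_above \<phi> u x"
    "left_inv_field G E v (left_inv_field G E v \<phi>) x < 0"
proof -
  define q where "q t = k0 + k1 * t - \<epsilon> * t\<^sup>2" for t :: real
  have qc: "continuous_on {a..b} q" unfolding q_def by (intro continuous_intros)
  obtain r \<omega>s ts N where r: "cball e0 r \<subseteq> coords" and \<omega>s: "\<omega>s \<in> ball e0 r" and ts: "a < ts" "ts < b"
    and inS: "\<forall>\<omega>\<in>cball e0 r. \<forall>t\<in>{a..b}. p \<otimes> chart_inv \<kappa> \<omega> \<otimes> E (t *\<^sub>R v) \<in> S"
    and max: "\<forall>\<omega>\<in>cball e0 r. \<forall>t\<in>{a..b}.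
      u (p \<otimes> chart_inv \<kappa> \<omega> \<otimes> E (t *\<^sub>R v)) - q t - N * (norm (\<omega> - e0))\<^sup>2 \<le>
      u (p \<otimes> chart_inv \<kappa> \<omega>s \<otimes> E (ts *\<^sub>R v)) - q ts - N * (norm (\<omega>s - e0))\<^sup>2"
    using penalised_interior_maximum[OF S u seg qc ab bd[folded q_def]] .
  note ch = chartD[OF chart_at_one(1)]
  obtain \<tau> where \<tau>: "Ck_on 2 UNIV \<tau>" "\<tau> e0 = 0"
    "\<And>c. c > 0 \<Longrightarrow> \<forall>\<^sub>F s in nhds 0. \<bar>\<tau> (snd \<kappa> (E (s *\<^sub>R v))) - s\<bar> \<le> c * s\<^sup>2"
    using second_order_parameter[OF v] by blast
  define gs where "gs = chart_inv \<kappa> \<omega>s"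
  define xs where "xs = p \<otimes> gs \<otimes> E (ts *\<^sub>R v)"
  have "\<omega>s \<in> coords" using \<omega>s r by auto
  then have gs: "gs \<in> fst \<kappa>" "snd \<kappa> gs = \<omega>s" unfolding gs_def by (rule ch(5), rule ch(6))
  define C where "C = u xs - q ts - N * (norm (\<omega>s - e0))\<^sup>2"
  define Y where "Y \<zeta> = inv p \<otimes> xs \<otimes> chart_inv \<kappa> \<zeta> \<otimes> E ((- (ts + \<tau> \<zeta>)) *\<^sub>R v)" for \<zeta>
  define P where "P x = N * ((x - e0) \<bullet> (x - e0))" for x
  have P: "P x = N * (norm (x - e0))\<^sup>2" for x by (simp add: P_def power2_norm_eq_inner)
  have CkP: "Ck_on k UNIV P" for k
    unfolding P_def by (intro Ck_on_mult Ck_on_inner Ck_on_diff Ck_on_id Ck_on_const open_UNIV)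
  define f where "f \<zeta> = q (ts + \<tau> \<zeta>) + P (snd \<kappa> (Y \<zeta>)) + C" for \<zeta>
  define U where "U = (coords \<inter> Y -` (fst \<kappa> \<inter> snd \<kappa> -` ball e0 r)) \<inter> \<tau> -` {a - ts<..<b - ts}"
  have Y_curve: "inv p \<otimes> xs \<otimes> E (s *\<^sub>R v) \<otimes> E ((- (ts + t)) *\<^sub>R v) = gs \<otimes> E ((s - t) *\<^sub>R v)" for s t
    unfolding xs_def by (simp add: m_assoc cancel_inv exp_add_assoc exp_add del: scaleR_minus_left minus_add_distrib)
  have CkY: "Ck_into 2 coords Y"
  proof -
    have "Ck_on 2 coords (\<lambda>\<zeta>. - (ts + \<tau> \<zeta>))"
      by (intro Ck_on_uminus Ck_on_add Ck_on_const ch(2) Ck_on_subset[OF \<tau>(1)]) auto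
    then have "Ck_into 2 coords (\<lambda>\<zeta>. E ((- (ts + \<tau> \<zeta>)) *\<^sub>R v))"
      by (rule Ck_into_compose[OF ch(2) open_UNIV Ck_into_exp]) auto
    then show ?thesis
      unfolding Y_def by (intro Ck_into_mult Ck_into_const Ck_into_chart_inv chart_at_one(1) ch(2))
  qed
  have openU: "open U"
    unfolding U_def
    by (intro open_Int Ck_into_open_preimage[OF CkY ch(2)] continuous_open_preimage[OF ch(3,1)] open_ball
        open_vimage open_greaterThanLessThan Ck_on_imp_continuous_on[OF \<tau>(1)])
  have Ye: "Y e0 = gs"
    using Y_curve[of 0 0] ch(7)[OF chart_at_one(2)] by (simp add: Y_def \<tau>(2))
  have eU: "e0 \<in> U"
    using Ye gs \<omega>s ts chart_at_one(2) by (auto simp: U_def \<tau>(2))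
  have Uc: "U \<subseteq> coords" by (auto simp: U_def)
  have Ckf: "Ck_on 2 U f"
  proof -
    have "Ck_on 2 U (\<lambda>\<zeta>. snd \<kappa> (Y \<zeta>))"
      by (rule Ck_on_subset[OF Ck_intoD(2)[OF CkY chart_at_one(1)]]) (auto simp: U_def)
    then have "Ck_on 2 U (\<lambda>\<zeta>. P (snd \<kappa> (Y \<zeta>)))"
      by (rule Ck_on_compose[OF openU open_UNIV _ CkP]) auto
    then show ?thesis
      unfolding f_def q_def
      by (intro Ck_on_add Ck_on_diff Ck_on_mult Ck_on_power Ck_on_const openU Ck_on_subset[OF \<tau>(1)]) auto
  qed
  obtain \<phi> where \<phi>: "Ck_fun A 2 UNIV \<phi>"
    and ev: "\<forall>\<^sub>F x in nhds xs. inv xs \<otimes> x \<in> fst \<kappa> \<and> snd \<kappa> (inv xs \<otimes> x) \<in> U \<and>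
      \<phi> x = f (snd \<kappa> (inv xs \<otimes> x))"
    using extend_test_function[OF Ckf openU eU Uc] by blast
  have fe: "f e0 = u xs" by (simp add: f_def Ye gs \<tau>(2) P C_def)
  have touch: "touches_above \<phi> u xs"
    unfolding touches_above_def
  proof
    have "\<phi> xs = f (snd \<kappa> (inv xs \<otimes> xs))" using eventually_nhds_x_imp_x[OF ev] by auto
    then show "\<phi> xs = u xs" by (simp add: fe)
    show "\<forall>\<^sub>F x in nhds xs. u x \<le> \<phi> x"
      using ev
    proof eventually_elim
      case (elim x)
      define \<zeta> where "\<zeta> = snd \<kappa> (inv xs \<otimes> x)"
      define t where "t = ts + \<tau> \<zeta>"
      have \<zeta>: "chart_inv \<kappa> \<zeta> = inv xs \<otimes> x" using ch(7) elim by (simp add: \<zeta>_def)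
      have YU: "Y \<zeta> \<in> fst \<kappa>" "snd \<kappa> (Y \<zeta>) \<in> cball e0 r" "t \<in> {a..b}"
        using elim unfolding U_def t_def \<zeta>_def[symmetric] by auto
      have "Y \<zeta> = inv p \<otimes> x \<otimes> E ((- t) *\<^sub>R v)"
        unfolding Y_def \<zeta> t_def by (simp add: m_assoc cancel_inv)
      then have "p \<otimes> Y \<zeta> \<otimes> E (t *\<^sub>R v) = x"
        by (simp add: m_assoc cancel_inv exp_add del: scaleR_minus_left)
      then show ?case
        using bspec[OF bspec[OF max YU(2)] YU(3)] ch(7)[OF YU(1)] elim
        unfolding \<zeta>_def[symmetric] gs_def[symmetric] xs_def[symmetric]
        by (simp add: f_def P C_def t_def)
    qed
  qed
  have xsS: "xs \<in> S" unfolding xs_def gs_def using inS \<omega>s ts by auto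
  let ?X = "left_inv_field G E v"
  define g where "g s = \<phi> (xs \<otimes> E (s *\<^sub>R v))" for s
  define h where "h s = P (snd \<kappa> (gs \<otimes> E (s *\<^sub>R v))) + C" for s
  obtain D where hD: "(h has_real_derivative D) (at 0)"
  proof -
    define J where "J = (\<lambda>s. gs \<otimes> E (s *\<^sub>R v)) -` fst \<kappa>"
    note Cki = Ck_into_one_param[OF one_param_exp, of 1 gs v]
    have J: "open J" "0 \<in> J"
      using Ck_into_open_preimage[OF Cki open_UNIV ch(1)] gs by (auto simp: J_def)
    have "Ck_on 1 J (\<lambda>s. snd \<kappa> (gs \<otimes> E (s *\<^sub>R v)))"
      using Ck_intoD(2)[OF Cki chart_at_one(1)] by (simp add: J_def)
    then have "Ck_on 1 J (\<lambda>s. P (snd \<kappa> (gs \<otimes> E (s *\<^sub>R v))))"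
      by (rule Ck_on_compose[OF J(1) open_UNIV _ CkP]) auto
    then have "Ck_on (Suc 0) J h"
      unfolding h_def One_nat_def by (intro Ck_on_add J(1) Ck_on_const)
    from Ck_on_real_deriv(1)[OF this J(2)] show thesis by (rule that)
  qed
  obtain Nb where Nb: "open Nb" "xs \<in> Nb" "\<And>x. x \<in> Nb \<Longrightarrow> inv xs \<otimes> x \<in> fst \<kappa> \<and> snd \<kappa> (inv xs \<otimes> x) \<in> U \<and>
      \<phi> x = f (snd \<kappa> (inv xs \<otimes> x))"
    using ev unfolding eventually_nhds by blast
  define \<tau>' where "\<tau>' s = \<tau> (snd \<kappa> (E (s *\<^sub>R v)))" for s
  have g_eq: "\<forall>\<^sub>F s in nhds 0. g s = k0 + k1 * (ts + \<tau>' s) - \<epsilon> * (ts + \<tau>' s)\<^sup>2 + h (s - \<tau>' s)"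
    using one_param_preimage_nhds[OF one_param_exp[of v] Nb(1,2)]
  proof eventually_elim
    case (elim s)
    have xE: "inv xs \<otimes> (xs \<otimes> E (s *\<^sub>R v)) = E (s *\<^sub>R v)" by (rule cancel_inv)
    have Es: "E (s *\<^sub>R v) \<in> fst \<kappa>" "g s = f (snd \<kappa> (E (s *\<^sub>R v)))"
      using Nb(3)[OF elim] by (simp_all add: xE g_def)
    have "Y (snd \<kappa> (E (s *\<^sub>R v))) = gs \<otimes> E ((s - \<tau>' s) *\<^sub>R v)"
      unfolding Y_def ch(7)[OF Es(1)] \<tau>'_def[symmetric] by (rule Y_curve)
    then show ?case
      unfolding Es(2) f_def h_def \<tau>'_def[symmetric] q_def by simp
  qed
  have conc: "\<forall>\<^sub>F s in nhds 0. g s + g (- s) \<le> 2 * g 0 - \<epsilon> * s\<^sup>2"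
    by (rule concave_perturbation[OF g_eq hD \<epsilon>]) (use \<tau> in \<open>simp_all add: \<tau>'_def\<close>)
  have \<phi>': "Ck_fun A (Suc 1) UNIV \<phi>" using \<phi> by (simp add: numeral_2_eq_2)
  have g1: "(g has_real_derivative ?X \<phi> (xs \<otimes> E (s *\<^sub>R v))) (at s)" for s
    unfolding g_def by (rule DERIV_left_inv_field[OF \<phi>' _ one_param_exp]) auto
  have g2: "((\<lambda>s. ?X \<phi> (xs \<otimes> E (s *\<^sub>R v))) has_real_derivative ?X (?X \<phi>) xs) (at 0)"
    using DERIV_left_inv_field[OF Ck_fun_left_inv_field[OF \<phi>' open_UNIV] _ one_param_exp, of xs 0 v] by simp
  \<comment> \<open>Adding half of \<open>\<epsilon> s\<^sup>2\<close> to \<open>g\<close> still leaves nonpositive second differences, which gives a strict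
    inequality for \<open>g\<close> itself.\<close>
  have "- ?X (?X \<phi>) xs - \<epsilon> \<ge> 0"
  proof (rule second_derivative_nonneg[of "\<lambda>s. - g s - \<epsilon> / 2 * s\<^sup>2"])
    show "\<forall>\<^sub>F s in nhds 0. ((\<lambda>s. - g s - \<epsilon> / 2 * s\<^sup>2) has_real_derivative
        - ?X \<phi> (xs \<otimes> E (s *\<^sub>R v)) - \<epsilon> * s) (at s)"
      by (intro always_eventually allI) (auto intro!: derivative_eq_intros g1)
    show "((\<lambda>s. - ?X \<phi> (xs \<otimes> E (s *\<^sub>R v)) - \<epsilon> * s) has_real_derivative - ?X (?X \<phi>) xs - \<epsilon>) (at 0)"
      by (auto intro!: derivative_eq_intros g2)
    show "\<forall>\<^sub>F s in nhds 0. 2 * (- g 0 - \<epsilon> / 2 * 0\<^sup>2) \<le> (- g s - \<epsilon> / 2 * s\<^sup>2) + (- g (- s) - \<epsilon> / 2 * (- s)\<^sup>2)"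
      using conc by eventually_elim simp
  qed
  then have "?X (?X \<phi>) xs < 0" using \<epsilon> by simp
  then show thesis using that[OF xsS \<phi> touch] by blast
qed

lemma v_convex_imp_h_convex:
  fixes X :: "'m::finite \<Rightarrow> 'v"
  assumes S: "open S" and u: "continuous_on S u" and vc: "v_convex_on G A E X S u"
  shows "h_convex_on G E (span (range X)) S u"
  unfolding h_convex_on_def
proof (intro ballI impI)
  fix p v assume p: "p \<in> S" and v: "v \<in> span (range X)" and seg: "horizontal_segment G E p v \<subseteq> S"
  show "convex_on {0..1} (\<lambda>t::real. u (p \<otimes> E (t *\<^sub>R v)))"
  proof (rule ccontr)
    assume nc: "\<not> convex_on {0..1} (\<lambda>t::real. u (p \<otimes> E (t *\<^sub>R v)))"
    then have "v \<noteq> 0" by (auto simp: convex_on_def algebra_simps simp flip: distrib_right)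
    obtain a b t0 \<epsilon> k0 k1 where *: "0 \<le> a" "a < t0" "t0 < b" "b \<le> 1" "\<epsilon> > 0"
      "u (p \<otimes> E (a *\<^sub>R v)) = k0 + k1 * a - \<epsilon> * a\<^sup>2" "u (p \<otimes> E (b *\<^sub>R v)) = k0 + k1 * b - \<epsilon> * b\<^sup>2"
      "u (p \<otimes> E (t0 *\<^sub>R v)) > k0 + k1 * t0 - \<epsilon> * t0\<^sup>2"
      using not_convex_imp_above_parabola[OF nc] .
    have pS: "p \<otimes> E (t *\<^sub>R v) \<in> S" if "t \<in> {a..b}" for t
    proof (rule subsetD[OF seg])
      show "p \<otimes> E (t *\<^sub>R v) \<in> horizontal_segment G E p v"
        unfolding horizontal_segment_def using that *(1,4) by (intro CollectI exI[of _ t]) auto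
    qed
    obtain x \<phi> where x: "x \<in> S" "Ck_fun A 2 UNIV \<phi>" "touches_above \<phi> u x"
      "left_inv_field G E v (left_inv_field G E v \<phi>) x < 0"
      using parabola_test_function[OF S u pS *(2,3,5) \<open>v \<noteq> 0\<close> *(6-8)] .
    have "\<exists>c. v = (\<Sum>i\<in>UNIV. c i *\<^sub>R X i)"
    proof -
      have "v \<in> range (\<lambda>c. \<Sum>i\<in>UNIV. c i *\<^sub>R X i)"
        using v
      proof (induction rule: span_induct_alt)
        case base
        show ?case by (rule image_eqI[of _ _ "\<lambda>_. 0"]) auto
      next
        case (step k x y)
        then obtain i c where "x = X i" "y = (\<Sum>i\<in>UNIV. c i *\<^sub>R X i)" by auto
        then have eq: "k *\<^sub>R x + y = (\<Sum>j\<in>UNIV. ((if j = i then k else 0) + c j) *\<^sub>R X j)"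
          by (simp add: scaleR_add_left sum.distrib if_distrib[of "\<lambda>z. z *\<^sub>R _"] cong: if_cong)
        show ?case
          unfolding eq
          by (rule rangeI[of "\<lambda>c. \<Sum>i\<in>UNIV. c i *\<^sub>R X i" "\<lambda>j. (if j = i then k else 0) + c j"])
      qed
      then show ?thesis by blast
    qed
    then obtain c where c: "v = (\<Sum>i\<in>UNIV. c i *\<^sub>R X i)" by blast
    define \<xi> :: "real^'m" where "\<xi> = (\<chi> i. c i)"
    have "v = (\<Sum>i\<in>UNIV. \<xi> $ i *\<^sub>R X i)" by (simp add: c \<xi>_def)
    moreover have "Ck_fun A 2 S \<phi>"
      using x(2) unfolding Ck_fun_def by (auto intro: Ck_on_subset)
    then have "\<xi> \<bullet> (horizontal_hessian G E X \<phi> x *v \<xi>) \<ge> 0"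
      using vc x(1,3) unfolding v_convex_on_def by blast
    ultimately show False
      using x(4) hessian_quadratic_form[OF x(2) open_UNIV UNIV_I, of \<xi> X] by simp
  qed
qed

end

section \<open>Averages of a continuous function along a flow\<close>

text \<open>Translation invariance of Lebesgue measure: the integral of \<open>y \<mapsto> k (y + t b)\<close> does not depend on
  small \<open>t\<close>, and its derivative at \<open>t = 0\<close> is the integral in question.\<close>

lemma integral_frechet_derivative_eq_0:
  fixes k :: "'a::euclidean_space \<Rightarrow> real"
  assumes U: "open U" "cbox l h \<subseteq> U" and D: "compact D" "D \<subseteq> box l h"
    and k: "Ck_on 1 U k" "\<And>y. y \<in> U - D \<Longrightarrow> k y = 0"
  shows "integral (cbox l h) (\<lambda>y. frechet_derivative k (at y) b) = 0"
proof -
  obtain d1 where d1: "d1 > 0" "(\<Union>y\<in>cbox l h. ball y d1) \<subseteq> U"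
    using compact_subset_open_imp_ball_epsilon_subset[OF compact_cbox U] .
  obtain d2 where d2: "d2 > 0" "(\<Union>y\<in>D. ball y d2) \<subseteq> box l h"
    using compact_subset_open_imp_ball_epsilon_subset[OF D(1) open_box D(2)] .
  define \<delta> where "\<delta> = min d1 d2 / (2 * (norm b + 1))"
  have nb: "norm b + 1 > 0" by (simp add: add_nonneg_pos)
  have \<delta>: "\<delta> > 0" using d1(1) d2(1) nb by (simp add: \<delta>_def)
  let ?J = "{-\<delta>..\<delta>}"
  have small: "norm (t *\<^sub>R b) < d1" "norm (t *\<^sub>R b) < d2" if "t \<in> ?J" for t
  proof -
    have "norm (t *\<^sub>R b) \<le> \<delta> * (norm b + 1)"
      unfolding norm_scaleR using that \<delta> by (intro mult_mono) auto
    also have "\<dots> = min d1 d2 / 2" using nb by (simp add: \<delta>_def divide_simps)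
    also have "\<dots> < min d1 d2" using d1(1) d2(1) by linarith
    finally show "norm (t *\<^sub>R b) < d1" "norm (t *\<^sub>R b) < d2" by auto
  qed
  have inU: "y + t *\<^sub>R b \<in> U" if "y \<in> cbox l h" "t \<in> ?J" for y t
  proof -
    have "y + t *\<^sub>R b \<in> ball y d1" using small(1)[OF that(2)] by (simp add: dist_norm)
    then show ?thesis using d1(2) that(1) by blast
  qed
  have const: "integral (cbox l h) (\<lambda>y. k (y + t *\<^sub>R b)) = integral D k" if t: "t \<in> ?J" for t
  proof -
    let ?S = "cbox (l + t *\<^sub>R b) (h + t *\<^sub>R b)"
    have mem: "y \<in> ?S \<longleftrightarrow> y - t *\<^sub>R b \<in> cbox l h" for y
      by (simp add: mem_box algebra_simps)
    have SU: "?S \<subseteq> U"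
    proof
      fix y assume "y \<in> ?S"
      then show "y \<in> U" using inU[OF _ t, of "y - t *\<^sub>R b"] mem by simp
    qed
    have DS: "D \<subseteq> ?S"
    proof
      fix y assume "y \<in> D"
      moreover have "y - t *\<^sub>R b \<in> ball y d2" using small(2)[OF t] by (simp add: dist_norm)
      ultimately have "y - t *\<^sub>R b \<in> box l h" using d2(2) by blast
      then show "y \<in> ?S" using mem box_subset_cbox by blast
    qed
    have "integral (cbox l h) (\<lambda>y. k (y + t *\<^sub>R b)) = integral ?S k"
      using integral_shift_cbox[of "l + t *\<^sub>R b" "t *\<^sub>R b" "h + t *\<^sub>R b" k] by simp
    also have "\<dots> = integral D k"
      unfolding integral_restrict_UNIV[of ?S k, symmetric] integral_restrict_UNIV[of D k, symmetric]
      using SU DS k(2) by (intro arg_cong[where f="integral UNIV"] ext) auto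
    finally show ?thesis .
  qed
  have contk: "continuous_on U k" by (rule Ck_on_imp_continuous_on[OF k(1)])
  have contDk: "continuous_on U (\<lambda>y. frechet_derivative k (at y) b)"
    using k(1) by simp
  have "((\<lambda>t. integral (cbox l h) (\<lambda>y. k (y + t *\<^sub>R b))) has_field_derivative
      integral (cbox l h) (\<lambda>y. frechet_derivative k (at (y + 0 *\<^sub>R b)) b)) (at 0 within ?J)"
  proof (rule leibniz_rule_field_derivative[where fx = "\<lambda>t y. frechet_derivative k (at (y + t *\<^sub>R b)) b"])
    fix t y assume t: "t \<in> ?J" and y: "y \<in> cbox l h"
    have k': "(k has_derivative frechet_derivative k (at (y + t *\<^sub>R b))) (at (y + t *\<^sub>R b))"
      using Ck_on_has_derivative[OF k(1) _ inU[OF y t]] by simp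
    have "((\<lambda>t. k (y + t *\<^sub>R b)) has_derivative (\<lambda>s. frechet_derivative k (at (y + t *\<^sub>R b)) (s *\<^sub>R b))) (at t)"
      by (rule has_derivative_compose[of "\<lambda>t. y + t *\<^sub>R b" "\<lambda>s. s *\<^sub>R b", OF _ k']) (auto intro!: derivative_eq_intros)
    then have "((\<lambda>t. k (y + t *\<^sub>R b)) has_real_derivative frechet_derivative k (at (y + t *\<^sub>R b)) b) (at t)"
      unfolding has_field_derivative_def
      by (simp add: linear_scale[OF has_derivative_linear[OF k']]
          mult.commute[of _ "frechet_derivative k (at (y + t *\<^sub>R b)) b"])
    then show "((\<lambda>t. k (y + t *\<^sub>R b)) has_field_derivative frechet_derivative k (at (y + t *\<^sub>R b)) b) (at t within ?J)"
      by (rule has_field_derivative_at_within)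
  next
    fix t assume t: "t \<in> ?J"
    have "continuous_on (cbox l h) (\<lambda>y. k (y + t *\<^sub>R b))"
      by (rule continuous_on_compose2[OF contk]) (use inU t in \<open>auto intro!: continuous_intros\<close>)
    then show "(\<lambda>y. k (y + t *\<^sub>R b)) integrable_on cbox l h"
      by (rule integrable_continuous)
  next
    have "continuous_on (?J \<times> cbox l h) (\<lambda>z. frechet_derivative k (at (snd z + fst z *\<^sub>R b)) b)"
      by (rule continuous_on_compose2[OF contDk]) (use inU in \<open>auto intro!: continuous_intros\<close>)
    then show "continuous_on (?J \<times> cbox l h) (\<lambda>(t, y). frechet_derivative k (at (y + t *\<^sub>R b)) b)"
      by (simp add: case_prod_beta)
  qed (use \<delta> in auto)
  then have "((\<lambda>t. integral (cbox l h) (\<lambda>y. k (y + t *\<^sub>R b))) has_field_derivative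
      integral (cbox l h) (\<lambda>y. frechet_derivative k (at y) b)) (at 0 within ?J)"
    by simp
  then have "((\<lambda>t. integral D k) has_field_derivative
      integral (cbox l h) (\<lambda>y. frechet_derivative k (at y) b)) (at 0 within ?J)"
    by (rule has_field_derivative_transform_within[OF _ zero_less_one]) (use \<delta> const in auto)
  moreover have "at 0 within ?J = at (0::real)"
    by (rule at_within_interior) (use \<delta> in auto)
  ultimately show ?thesis
    using DERIV_unique[OF _ DERIV_const] by auto
qed

text \<open>The formal adjoint, with respect to Lebesgue measure, of differentiation along the vector
  field \<open>a\<close>: minus the divergence of \<open>\<eta> a\<close>.\<close>

definition field_adjoint :: "('a::euclidean_space \<Rightarrow> 'a) \<Rightarrow> ('a \<Rightarrow> real) \<Rightarrow> 'a \<Rightarrow> real" where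
  "field_adjoint a \<eta> y = - (\<Sum>b\<in>Basis. frechet_derivative (\<lambda>y. \<eta> y * (a y \<bullet> b)) (at y) b)"

lemma Ck_on_mult_inner:
  assumes "open U" "Ck_on k U \<eta>" "Ck_on k U a"
  shows "Ck_on k U (\<lambda>y. \<eta> y * (a y \<bullet> b))"
  by (intro Ck_on_mult Ck_on_inner Ck_on_const assms)

lemma Ck_on_field_adjoint:
  assumes "open U" "Ck_on (Suc k) U \<eta>" "Ck_on (Suc k) U a"
  shows "Ck_on k U (field_adjoint a \<eta>)"
  unfolding field_adjoint_def
  by (intro Ck_on_uminus Ck_on_sum assms(1) Ck_on_SucD(2)[OF Ck_on_mult_inner[OF assms]])

lemma field_adjoint_eq_0:
  assumes "open U" "closed D" "\<And>y. y \<in> U - D \<Longrightarrow> \<eta> y = 0" "y \<in> U - D"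
  shows "field_adjoint a \<eta> y = 0"
proof -
  have "((\<lambda>y. \<eta> y * (a y \<bullet> b)) has_derivative (\<lambda>h. 0)) (at y)" for b
    by (rule has_derivative_transform_within_open[OF has_derivative_const[of 0] open_Diff[OF assms(1,2)] assms(4)])
      (simp add: assms(3))
  from frechet_derivative_at[OF this] have "frechet_derivative (\<lambda>y. \<eta> y * (a y \<bullet> b)) (at y) = (\<lambda>h. 0)" for b
    by metis
  then show ?thesis by (simp add: field_adjoint_def)
qed

lemma integral_field_adjoint:
  fixes \<eta> f :: "'a::euclidean_space \<Rightarrow> real"
  assumes U: "open U" "cbox l h \<subseteq> U" and D: "compact D" "D \<subseteq> box l h"
    and \<eta>: "Ck_on 1 U \<eta>" "\<And>y. y \<in> U - D \<Longrightarrow> \<eta> y = 0" and a: "Ck_on 1 U a" and f: "Ck_on 1 U f"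
  shows "integral (cbox l h) (\<lambda>y. \<eta> y * frechet_derivative f (at y) (a y)) =
         integral (cbox l h) (\<lambda>y. field_adjoint a \<eta> y * f y)"
proof -
  define k where "k b y = (\<eta> y * (a y \<bullet> b)) * f y" for b y
  let ?d = "\<lambda>y b. frechet_derivative (k b) (at y) b"
  note \<eta>a = Ck_on_mult_inner[OF U(1) \<eta>(1) a]
  have k: "Ck_on 1 U (k b)" for b
    unfolding k_def by (rule Ck_on_mult[OF U(1) \<eta>a f])
  have d: "?d y b = (\<eta> y * (a y \<bullet> b)) * frechet_derivative f (at y) b
      + frechet_derivative (\<lambda>y. \<eta> y * (a y \<bullet> b)) (at y) b * f y" if "y \<in> U" for y b
  proof -
    have "(k b has_derivative (\<lambda>h. (\<eta> y * (a y \<bullet> b)) * frechet_derivative f (at y) h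
      + frechet_derivative (\<lambda>y. \<eta> y * (a y \<bullet> b)) (at y) h * f y)) (at y)"
      unfolding k_def
      by (rule has_derivative_mult[OF Ck_on_has_derivative[OF \<eta>a _ that] Ck_on_has_derivative[OF f _ that]]) auto
    from frechet_derivative_at[OF this] show ?thesis by metis
  qed
  have sum: "(\<Sum>b\<in>Basis. ?d y b) = \<eta> y * frechet_derivative f (at y) (a y) - field_adjoint a \<eta> y * f y"
    if y: "y \<in> U" for y
  proof -
    have "\<eta> y * frechet_derivative f (at y) (a y) = (\<Sum>b\<in>Basis. (\<eta> y * (a y \<bullet> b)) * frechet_derivative f (at y) b)"
      using has_derivative_eq_sum_Basis[OF Ck_on_has_derivative[OF f _ y], of "a y"]
      by (simp add: sum_distrib_left mult.assoc)
    then show ?thesis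
      by (simp add: d[OF y] sum.distrib field_adjoint_def sum_distrib_right)
  qed
  have contd: "continuous_on (cbox l h) (\<lambda>y. ?d y b)" for b
  proof -
    have "continuous_on U (\<lambda>y. ?d y b)" using k[of b] by simp
    then show ?thesis by (rule continuous_on_subset[OF _ U(2)])
  qed
  have "0 = (\<Sum>b\<in>Basis. integral (cbox l h) (\<lambda>y. ?d y b))"
    using integral_frechet_derivative_eq_0[OF U D k] \<eta>(2) by (simp add: k_def)
  also have "\<dots> = integral (cbox l h) (\<lambda>y. \<Sum>b\<in>Basis. ?d y b)"
    by (rule integral_sum[symmetric]) (auto intro: integrable_continuous contd)
  also have "\<dots> = integral (cbox l h) (\<lambda>y. \<eta> y * frechet_derivative f (at y) (a y) - field_adjoint a \<eta> y * f y)"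
    by (rule integral_cong) (use sum U(2) in auto)
  also have "\<dots> = integral (cbox l h) (\<lambda>y. \<eta> y * frechet_derivative f (at y) (a y)) -
      integral (cbox l h) (\<lambda>y. field_adjoint a \<eta> y * f y)"
  proof (rule integral_diff)
    have "continuous_on U (\<lambda>y. \<eta> y * frechet_derivative f (at y) (a y))"
      using Ck_on_derivative[OF U(1), of 0 f a] f Ck_on_imp_continuous_on[OF a] Ck_on_imp_continuous_on[OF \<eta>(1)]
      by (intro continuous_intros) auto
    then show "(\<lambda>y. \<eta> y * frechet_derivative f (at y) (a y)) integrable_on cbox l h"
      using U(2) by (intro integrable_continuous) (rule continuous_on_subset)
    have "continuous_on U (\<lambda>y. field_adjoint a \<eta> y * f y)"
      using Ck_on_field_adjoint[OF U(1), of 0 \<eta> a] \<eta>(1) a Ck_on_imp_continuous_on[OF f]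
      by (intro continuous_intros) auto
    then show "(\<lambda>y. field_adjoint a \<eta> y * f y) integrable_on cbox l h"
      using U(2) by (intro integrable_continuous) (rule continuous_on_subset)
  qed
  finally show ?thesis by simp
qed

lemma integral_weighted_bound:
  fixes w f :: "'a::euclidean_space \<Rightarrow> real"
  assumes w: "continuous_on (cbox l h) w" and f: "continuous_on (cbox l h) f"
    and b: "\<And>y. y \<in> cbox l h \<Longrightarrow> \<bar>f y\<bar> \<le> \<epsilon>"
  shows "\<bar>integral (cbox l h) (\<lambda>y. w y * f y)\<bar> \<le> integral (cbox l h) (\<lambda>y. \<bar>w y\<bar>) * \<epsilon>"
proof -
  have "norm (integral (cbox l h) (\<lambda>y. w y * f y)) \<le> integral (cbox l h) (\<lambda>y. \<bar>w y\<bar> * \<epsilon>)"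
    by (rule integral_norm_bound_integral)
      (use b in \<open>auto intro!: integrable_continuous continuous_intros w f mult_left_mono simp: abs_mult\<close>)
  then show ?thesis by simp
qed

text \<open>If the points \<open>g (t, y)\<close> move in such a way that the \<open>t\<close>-derivative equals the \<open>y\<close>-derivative
  along \<open>a\<close>, then for \<open>F\<close> of class \<open>C\<^sup>1\<close> integration by parts moves the derivative of the average from
  \<open>F\<close> to the weight. The resulting formula no longer involves derivatives of \<open>F\<close>, so it passes to
  uniform limits of polynomials, that is, to all continuous \<open>F\<close>. This replaces a change of variables
  and its Jacobian.\<close>

lemma has_derivative_average_along_flow:
  fixes \<eta> F :: "'a::euclidean_space \<Rightarrow> real" and g :: "real \<times> 'a \<Rightarrow> 'a"
  assumes U: "open U" "cbox l h \<subseteq> U" and D: "compact D" "D \<subseteq> box l h"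
    and \<eta>: "Ck_on 1 U \<eta>" "\<And>y. y \<in> U - D \<Longrightarrow> \<eta> y = 0" and a: "Ck_on 1 U a"
    and W: "open W" "{0} \<times> cbox l h \<subseteq> W" "W \<subseteq> UNIV \<times> U" and g: "Ck_on 1 W g"
    and flow: "\<And>t y. (t, y) \<in> W \<Longrightarrow>
      frechet_derivative g (at (t, y)) (1, 0) = frechet_derivative g (at (t, y)) (0, a y)"
    and g0: "\<And>y. y \<in> cbox l h \<Longrightarrow> g (0, y) = y"
    and F: "continuous_on T F" "g ` W \<subseteq> T"
  shows "((\<lambda>t. integral (cbox l h) (\<lambda>y. \<eta> y * F (g (t, y)))) has_real_derivative
    integral (cbox l h) (\<lambda>y. field_adjoint a \<eta> y * F y)) (at 0)"
proof -
  let ?B = "cbox l h"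
  obtain X0 where X0: "0 \<in> X0" "open X0" "X0 \<times> ?B \<subseteq> W"
    using Elementary_Topology.tube_lemma[OF compact_cbox W(1,2)] by blast
  obtain \<delta> where \<delta>: "\<delta> > 0" "cball 0 \<delta> \<subseteq> X0"
    using X0(1,2) open_contains_cball by blast
  let ?J = "{-\<delta>..\<delta>}"
  define Q where "Q = ?J \<times> ?B"
  have QW: "Q \<subseteq> W"
    using X0(3) \<delta>(2) unfolding Q_def cball_eq_atLeastAtMost by auto
  have Q: "compact Q" unfolding Q_def by (intro compact_Times compact_Icc compact_cbox)
  have contg: "continuous_on W g" by (rule Ck_on_imp_continuous_on[OF g])
  define K where "K = g ` Q"
  have K: "compact K" "K \<subseteq> T"
    unfolding K_def using compact_continuous_image[OF continuous_on_subset[OF contg QW] Q] F(2) QW by auto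
  have "\<exists>p. real_polynomial_function p \<and> (\<forall>x\<in>K. \<bar>F x - p x\<bar> < 1 / Suc n)" for n
    using Stone_Weierstrass_real_polynomial_function[OF K(1) continuous_on_subset[OF F(1) K(2)], of "1 / Suc n"]
    by (metis of_nat_0_less_iff zero_less_Suc zero_less_divide_1_iff)
  then obtain p where p: "\<And>n. real_polynomial_function (p n)" "\<And>n x. x \<in> K \<Longrightarrow> \<bar>F x - p n x\<bar> < 1 / Suc n"
    by metis
  have cont\<eta>: "continuous_on ?B \<eta>"
    by (rule continuous_on_subset[OF Ck_on_imp_continuous_on[OF \<eta>(1)] U(2)])
  have "Ck_on 0 U (field_adjoint a \<eta>)"
    by (rule Ck_on_field_adjoint) (use U \<eta> a in auto)
  then have contad: "continuous_on ?B (field_adjoint a \<eta>)"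
    using U(2) continuous_on_subset by auto
  have cont_slice: "continuous_on ?B (\<lambda>y. f (g (t, y)))" if "continuous_on K f" "t \<in> ?J" for f :: "'a \<Rightarrow> real" and t
    by (rule continuous_on_compose2[OF that(1) continuous_on_compose2[OF contg]])
      (use that(2) QW in \<open>auto intro!: continuous_intros simp: K_def Q_def\<close>)
  have contp: "continuous_on S (p n)" for n S
    using Ck_on_imp_continuous_on[OF Ck_on_polynomial[OF p(1)]] continuous_on_subset by blast
  have contF: "continuous_on K F" by (rule continuous_on_subset[OF F(1) K(2)])
  define H where "H f t = integral ?B (\<lambda>y. \<eta> y * f (g (t, y)))" for f :: "'a \<Rightarrow> real" and t
  define k where "k f t = integral ?B (\<lambda>y. field_adjoint a \<eta> y * f (g (t, y)))" for f :: "'a \<Rightarrow> real" and t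
  have conv: "\<bar>integral ?B (\<lambda>y. w y * p n (g (t, y))) - integral ?B (\<lambda>y. w y * F (g (t, y)))\<bar>
      \<le> integral ?B (\<lambda>y. \<bar>w y\<bar>) * (1 / Suc n)" if w: "continuous_on ?B w" and t: "t \<in> ?J" for w t n
  proof -
    have "integral ?B (\<lambda>y. w y * p n (g (t, y))) - integral ?B (\<lambda>y. w y * F (g (t, y))) =
        integral ?B (\<lambda>y. w y * (p n (g (t, y)) - F (g (t, y))))"
      unfolding right_diff_distrib
      by (rule integral_diff[symmetric]; intro integrable_continuous continuous_on_mult w cont_slice contp contF t)
    also have "\<bar>\<dots>\<bar> \<le> integral ?B (\<lambda>y. \<bar>w y\<bar>) * (1 / Suc n)"
    proof (rule integral_weighted_bound[OF w])
      show "continuous_on ?B (\<lambda>y. p n (g (t, y)) - F (g (t, y)))"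
        by (intro continuous_on_diff cont_slice contp contF t)
      fix y assume "y \<in> ?B"
      then have "g (t, y) \<in> K" using t by (auto simp: K_def Q_def)
      from p(2)[OF this, of n] show "\<bar>p n (g (t, y)) - F (g (t, y))\<bar> \<le> 1 / Suc n" by linarith
    qed
    finally show ?thesis .
  qed
  have der: "(H (p n) has_derivative (\<lambda>s. k (p n) t * s)) (at t within ?J)" if t: "t \<in> ?J" for n t
  proof -
    have Ckpg: "Ck_on 1 W (\<lambda>z. p n (g z))"
      by (rule Ck_on_compose[OF W(1) open_UNIV g Ck_on_polynomial[OF p(1)]]) auto
    let ?D = "\<lambda>z. frechet_derivative (\<lambda>z. p n (g z)) (at z)"
    have D_flow: "?D (t, y) (1, 0) = ?D (t, y) (0, a y)" if "(t, y) \<in> W" for t y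
    proof -
      have "((\<lambda>z. p n (g z)) has_derivative
          (\<lambda>v. frechet_derivative (p n) (at (g (t, y))) (frechet_derivative g (at (t, y)) v))) (at (t, y))"
        by (rule has_derivative_compose[OF Ck_on_has_derivative[OF g _ that]
              Ck_on_has_derivative[OF Ck_on_polynomial[OF p(1), of 1]]]) auto
      from frechet_derivative_at[OF this, symmetric] show ?thesis using flow[OF that] by simp
    qed
    have "(H (p n) has_field_derivative integral ?B (\<lambda>y. \<eta> y * ?D (t, y) (1, 0))) (at t within ?J)"
      unfolding H_def
    proof (rule leibniz_rule_field_derivative[where fx = "\<lambda>t y. \<eta> y * ?D (t, y) (1, 0)"])
      fix s y assume s: "s \<in> ?J" and y: "y \<in> ?B"
      then have sy: "(s, y) \<in> W" using QW by (auto simp: Q_def)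
      have D: "((\<lambda>z. p n (g z)) has_derivative ?D (s, y)) (at (s, y))"
        by (rule Ck_on_has_derivative[OF Ckpg _ sy]) simp
      have D1: "((\<lambda>s. p n (g (s, y))) has_derivative (\<lambda>r. ?D (s, y) (r, 0))) (at s)"
        by (rule has_derivative_compose[of "\<lambda>s. (s, y)" "\<lambda>r. (r, 0)" s UNIV "\<lambda>z. p n (g z)", OF _ D])
          (auto intro!: derivative_eq_intros)
      have D2: "(\<lambda>r. ?D (s, y) (r, 0)) = (*) (?D (s, y) (1, 0))"
      proof
        fix r
        have "?D (s, y) (r *\<^sub>R (1, 0)) = r *\<^sub>R ?D (s, y) (1, 0)"
          by (rule linear_scale[OF has_derivative_linear[OF D]])
        moreover have "r *\<^sub>R (1::real, 0::'a) = (r, 0)" by simp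
        ultimately show "?D (s, y) (r, 0) = ?D (s, y) (1, 0) * r"
          by (metis mult.commute real_scaleR_def)
      qed
      have "((\<lambda>s. p n (g (s, y))) has_real_derivative ?D (s, y) (1, 0)) (at s)"
        unfolding has_field_derivative_def by (rule has_derivative_eq_rhs[OF D1 D2])
      then show "((\<lambda>s. \<eta> y * p n (g (s, y))) has_field_derivative \<eta> y * ?D (s, y) (1, 0)) (at s within ?J)"
        by (rule has_field_derivative_at_within[OF DERIV_cmult])
    next
      fix s assume "s \<in> ?J"
      then show "(\<lambda>y. \<eta> y * p n (g (s, y))) integrable_on ?B"
        by (intro integrable_continuous continuous_on_mult cont\<eta> cont_slice contp)
    next
      have "continuous_on Q (\<lambda>z. \<eta> (snd z) * ?D z (1, 0))"
        using Ck_on_SucD(2)[of 0 W "\<lambda>z. p n (g z)" "(1, 0)"] Ckpg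
        by (intro continuous_on_mult continuous_on_compose2[OF cont\<eta>] continuous_on_subset[OF _ QW])
          (auto simp: Q_def intro!: continuous_intros)
      then show "continuous_on (?J \<times> ?B) (\<lambda>(s, y). \<eta> y * ?D (s, y) (1, 0))"
        by (simp add: case_prod_beta Q_def)
    qed (use t in auto)
    moreover have "integral ?B (\<lambda>y. \<eta> y * ?D (t, y) (1, 0)) = k (p n) t"
    proof -
      define Ut where "Ut = (\<lambda>y. (t, y)) -` W"
      have Ut: "open Ut" unfolding Ut_def by (intro open_vimage W(1) continuous_intros)
      have BUt: "?B \<subseteq> Ut" using QW t unfolding Ut_def Q_def by blast
      have UtU: "Ut \<subseteq> U" using W(3) by (auto simp: Ut_def)
      have slice: "frechet_derivative (\<lambda>y. p n (g (t, y))) (at y) v = ?D (t, y) (0, v)" if "y \<in> Ut" for y v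
      proof -
        have D: "((\<lambda>z. p n (g z)) has_derivative ?D (t, y)) (at (t, y))"
          by (rule Ck_on_has_derivative[OF Ckpg]) (use that in \<open>auto simp: Ut_def\<close>)
        have "((\<lambda>y. p n (g (t, y))) has_derivative (\<lambda>v. ?D (t, y) (0, v))) (at y)"
          by (rule has_derivative_compose[of "\<lambda>y. (t, y)" "\<lambda>v. (0, v)" y UNIV "\<lambda>z. p n (g z)", OF _ D])
            (auto intro!: derivative_eq_intros)
        from frechet_derivative_at[OF this] show ?thesis by metis
      qed
      have "integral ?B (\<lambda>y. \<eta> y * ?D (t, y) (1, 0)) =
          integral ?B (\<lambda>y. \<eta> y * frechet_derivative (\<lambda>y. p n (g (t, y))) (at y) (a y))"
        by (rule integral_cong) (use BUt slice D_flow in \<open>auto simp: Ut_def\<close>)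
      also have "\<dots> = integral ?B (\<lambda>y. field_adjoint a \<eta> y * p n (g (t, y)))"
      proof (rule integral_field_adjoint[OF Ut BUt D])
        show "Ck_on 1 Ut (\<lambda>y. p n (g (t, y)))"
        proof (rule Ck_on_compose[OF Ut W(1) _ Ckpg])
          show "Ck_on 1 Ut (Pair t)" by (intro Ck_on_Pair Ut Ck_on_const Ck_on_id)
        qed (auto simp: Ut_def)
      qed (use UtU \<eta> a Ck_on_subset in blast)+
      finally show ?thesis by (simp add: k_def)
    qed
    ultimately show ?thesis by (simp add: has_field_derivative_def)
  qed
  have "\<exists>h. \<forall>t\<in>?J. (\<lambda>n. H (p n) t) \<longlonglongrightarrow> h t \<and> (h has_derivative (\<lambda>s. k F t * s)) (at t within ?J)"
  proof (rule has_derivative_sequence[where f'="\<lambda>n t s. k (p n) t * s" and ?x0.0=0 and l="H F 0"])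
    fix e :: real assume e: "e > 0"
    define C where "C = integral ?B (\<lambda>y. \<bar>field_adjoint a \<eta> y\<bar>)"
    have "(\<lambda>n. C * (1 / Suc n)) \<longlonglongrightarrow> C * 0"
      by (intro tendsto_intros LIMSEQ_Suc lim_1_over_n)
    then have "\<forall>\<^sub>F n in sequentially. C * (1 / Suc n) < e"
      by (rule order_tendstoD(2)) (use e in simp)
    then show "\<forall>\<^sub>F n in sequentially. \<forall>t\<in>?J. \<forall>s. norm (k (p n) t * s - k F t * s) \<le> e * norm s"
    proof eventually_elim
      case (elim n)
      show ?case
      proof (intro ballI allI)
        fix t s assume "t \<in> ?J"
        then have "\<bar>k (p n) t - k F t\<bar> \<le> C * (1 / Suc n)"
          unfolding k_def C_def by (rule conv[OF contad])
        then have "\<bar>k (p n) t - k F t\<bar> \<le> e" using elim by linarith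
        then show "norm (k (p n) t * s - k F t * s) \<le> e * norm s"
          unfolding left_diff_distrib[symmetric] real_norm_def abs_mult by (rule mult_right_mono) simp
      qed
    qed
  next
    show "(\<lambda>n. H (p n) 0) \<longlonglongrightarrow> H F 0"
    proof (rule LIM_zero_cancel, rule Lim_null_comparison)
      show "\<forall>\<^sub>F n in sequentially. norm (H (p n) 0 - H F 0) \<le> integral ?B (\<lambda>y. \<bar>\<eta> y\<bar>) * (1 / Suc n)"
        unfolding H_def real_norm_def using \<delta> by (intro always_eventually allI conv cont\<eta>) auto
      have "(\<lambda>n. integral ?B (\<lambda>y. \<bar>\<eta> y\<bar>) * (1 / Suc n)) \<longlonglongrightarrow> integral ?B (\<lambda>y. \<bar>\<eta> y\<bar>) * 0"
        by (intro tendsto_intros LIMSEQ_Suc lim_1_over_n)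
      then show "(\<lambda>n. integral ?B (\<lambda>y. \<bar>\<eta> y\<bar>) * (1 / Suc n)) \<longlonglongrightarrow> 0" by simp
    qed
  qed (use der \<delta> in auto)
  then obtain h' where h': "\<And>t. t \<in> ?J \<Longrightarrow> (\<lambda>n. H (p n) t) \<longlonglongrightarrow> h' t"
    "\<And>t. t \<in> ?J \<Longrightarrow> (h' has_derivative (\<lambda>s. k F t * s)) (at t within ?J)"
    by blast
  have HF: "h' t = H F t" if t: "t \<in> ?J" for t
  proof (rule LIMSEQ_unique[OF h'(1)[OF t]], rule LIM_zero_cancel, rule Lim_null_comparison)
    show "\<forall>\<^sub>F n in sequentially. norm (H (p n) t - H F t) \<le> integral ?B (\<lambda>y. \<bar>\<eta> y\<bar>) * (1 / Suc n)"
      unfolding H_def real_norm_def by (intro always_eventually allI conv cont\<eta> t)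
    have "(\<lambda>n. integral ?B (\<lambda>y. \<bar>\<eta> y\<bar>) * (1 / Suc n)) \<longlonglongrightarrow> integral ?B (\<lambda>y. \<bar>\<eta> y\<bar>) * 0"
      by (intro tendsto_intros LIMSEQ_Suc lim_1_over_n)
    then show "(\<lambda>n. integral ?B (\<lambda>y. \<bar>\<eta> y\<bar>) * (1 / Suc n)) \<longlonglongrightarrow> 0" by simp
  qed
  have "(h' has_real_derivative k F 0) (at 0 within ?J)"
    using h'(2)[of 0] \<delta> by (simp add: has_field_derivative_def)
  then have "(H F has_real_derivative k F 0) (at 0 within ?J)"
    by (rule has_field_derivative_transform_within[OF _ zero_less_one]) (use \<delta> HF in auto)
  moreover have "at 0 within ?J = at (0::real)"
    by (rule at_within_interior) (use \<delta> in auto)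
  moreover have "k F 0 = integral ?B (\<lambda>y. field_adjoint a \<eta> y * F y)"
    unfolding k_def by (rule integral_cong) (simp add: g0)
  ultimately show ?thesis by (simp add: H_def[abs_def])
qed

section \<open>Mollification by left translations\<close>

lemma field_adjoint_sum:
  assumes U: "open U" "y \<in> U" and \<eta>: "Ck_on 1 U \<eta>" and a: "\<And>i. i \<in> I \<Longrightarrow> Ck_on 1 U (a i)"
    and eq: "\<And>y. y \<in> U \<Longrightarrow> a' y = (\<Sum>i\<in>I. c i *\<^sub>R a i y)"
  shows "field_adjoint a' \<eta> y = (\<Sum>i\<in>I. c i * field_adjoint (a i) \<eta> y)"
proof -
  have "frechet_derivative (\<lambda>y. \<eta> y * (a' y \<bullet> b)) (at y) b =
      (\<Sum>i\<in>I. c i * frechet_derivative (\<lambda>y. \<eta> y * (a i y \<bullet> b)) (at y) b)" for b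
  proof -
    have "((\<lambda>y. \<Sum>i\<in>I. c i * (\<eta> y * (a i y \<bullet> b))) has_derivative
        (\<lambda>v. \<Sum>i\<in>I. c i * frechet_derivative (\<lambda>y. \<eta> y * (a i y \<bullet> b)) (at y) v)) (at y)"
      by (intro has_derivative_sum has_derivative_mult_right
          Ck_on_has_derivative[OF Ck_on_mult_inner[OF U(1) \<eta> a] _ U(2)]) auto
    then have "((\<lambda>y. \<eta> y * (a' y \<bullet> b)) has_derivative
        (\<lambda>v. \<Sum>i\<in>I. c i * frechet_derivative (\<lambda>y. \<eta> y * (a i y \<bullet> b)) (at y) v)) (at y)"
      by (rule has_derivative_transform_within_open[OF _ U])
        (simp add: eq inner_sum_left sum_distrib_left mult.left_commute)
    from fun_cong[OF frechet_derivative_at[OF this], of b] show ?thesis by (rule sym)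
  qed
  then show ?thesis
    unfolding field_adjoint_def
    by (simp only: sum_negf sum_distrib_left mult_minus_right) (subst sum.swap, rule refl)
qed

context lie_group_exp
begin

definition Ad :: "'g \<Rightarrow> 'v \<Rightarrow> 'v" where
  "Ad p v = vector_derivative (\<lambda>t. snd \<kappa> (p \<otimes> E (t *\<^sub>R v) \<otimes> inv p)) (at 0)"

lemma one_param_conj: "one_param (Ad p v) (\<lambda>t. p \<otimes> E (t *\<^sub>R v) \<otimes> inv p)"
  unfolding one_param_def
proof (intro conjI allI)
  have Ck: "Ck_into 1 UNIV (\<lambda>t. p \<otimes> E (t *\<^sub>R v) \<otimes> inv p)"
    by (intro Ck_into_mult Ck_into_const Ck_into_exp open_UNIV)
  show "continuous_on UNIV (\<lambda>t. p \<otimes> E (t *\<^sub>R v) \<otimes> inv p)" by (rule Ck_intoD(1)[OF Ck])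
  show "p \<otimes> E ((s + t) *\<^sub>R v) \<otimes> inv p = p \<otimes> E (s *\<^sub>R v) \<otimes> inv p \<otimes> (p \<otimes> E (t *\<^sub>R v) \<otimes> inv p)" for s t
    by (simp add: m_assoc cancel_inv exp_add_assoc)
  have "(\<lambda>t. snd \<kappa> (p \<otimes> E (t *\<^sub>R v) \<otimes> inv p)) differentiable (at 0)"
    by (rule Ck_on_differentiable[OF Ck_intoD(2)[OF Ck chart_at_one(1)]]) (use chart_at_one(2) in auto)
  then show "((\<lambda>t. snd \<kappa> (p \<otimes> E (t *\<^sub>R v) \<otimes> inv p)) has_vector_derivative Ad p v) (at 0)"
    unfolding Ad_def by (simp add: vector_derivative_works)
qed

text \<open>In a chart, \<open>Ad p v\<close> is the partial derivative at \<open>t = 0\<close> of the smooth map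
  \<open>(p, t) \<mapsto> p E (t v) (inv p)\<close>.\<close>

lemma Ck_fun_Ad: "Ck_fun A k UNIV (\<lambda>p. Ad p v \<bullet> b)"
  unfolding Ck_fun_def
proof
  fix c assume c: "c \<in> A"
  let ?I = "snd c ` fst c"
  define \<Theta> where "\<Theta> z = chart_inv c (fst z) \<otimes> E (snd z *\<^sub>R v) \<otimes> inv (chart_inv c (fst z))" for z
  have op: "open (?I \<times> (UNIV :: real set))" by (intro open_Times chartD(2)[OF c] open_UNIV)
  have 1: "Ck_into (Suc k) (?I \<times> UNIV) (\<lambda>z::'v \<times> real. chart_inv c (fst z))"
    by (rule Ck_into_compose[OF op chartD(2)[OF c] Ck_into_chart_inv[OF c] Ck_on_bounded_linear[OF bounded_linear_fst]]) auto
  have 2: "Ck_into (Suc k) (?I \<times> UNIV) (\<lambda>z::'v \<times> real. E (snd z *\<^sub>R v))"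
    by (rule Ck_into_compose[OF op open_UNIV Ck_into_exp Ck_on_bounded_linear[OF bounded_linear_snd]]) auto
  have \<Theta>: "Ck_into (Suc k) (?I \<times> UNIV) \<Theta>"
    unfolding \<Theta>_def by (intro Ck_into_mult Ck_into_inv op 1 2)
  define W where "W = (?I \<times> UNIV) \<inter> \<Theta> -` fst \<kappa>"
  have W: "open W" unfolding W_def by (rule Ck_into_open_preimage[OF \<Theta> op chartD(1)[OF chart_at_one(1)]])
  have CkW: "Ck_on (Suc k) W (\<lambda>z. snd \<kappa> (\<Theta> z))"
    unfolding W_def by (rule Ck_intoD(2)[OF \<Theta> chart_at_one(1)])
  have inW: "(x, 0) \<in> W" if "x \<in> ?I" for x
    using that chart_at_one(2) by (simp add: W_def \<Theta>_def)
  have "Ck_on k ?I (\<lambda>x. frechet_derivative (\<lambda>z. snd \<kappa> (\<Theta> z)) (at (x, 0)) (0, 1) \<bullet> b)"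
    by (intro Ck_on_inner chartD(2)[OF c] Ck_on_const
        Ck_on_compose[where f="\<lambda>x. (x, 0)", OF chartD(2)[OF c] W _ Ck_on_SucD(2)[OF CkW]] Ck_on_Pair Ck_on_id)
      (use inW in auto)
  moreover have "frechet_derivative (\<lambda>z. snd \<kappa> (\<Theta> z)) (at (x, 0)) (0, 1) = Ad (chart_inv c x) v"
    if x: "x \<in> ?I" for x
  proof -
    let ?D = "frechet_derivative (\<lambda>z. snd \<kappa> (\<Theta> z)) (at (x, 0))"
    have D: "((\<lambda>z. snd \<kappa> (\<Theta> z)) has_derivative ?D) (at (x, 0))"
      by (rule Ck_on_has_derivative[OF CkW _ inW[OF x]]) simp
    have "((\<lambda>t. snd \<kappa> (\<Theta> (x, t))) has_derivative (\<lambda>h. ?D (0, h))) (at 0)"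
      by (rule has_derivative_compose[of "\<lambda>t. (x, t)" "\<lambda>h. (0, h)", OF _ D]) (auto intro!: derivative_eq_intros)
    moreover have "?D (0, h) = h *\<^sub>R ?D (0, 1)" for h
      using linear_scale[OF has_derivative_linear[OF D], of h "(0, 1)"]
      unfolding scaleR_Pair scaleR_zero_right real_scaleR_def mult_1_right .
    then have "(\<lambda>h. ?D (0, h)) = (\<lambda>h. h *\<^sub>R ?D (0, 1))" by (rule ext)
    ultimately have "((\<lambda>t. snd \<kappa> (\<Theta> (x, t))) has_vector_derivative ?D (0, 1)) (at 0)"
      unfolding has_vector_derivative_def by (rule has_derivative_eq_rhs)
    from vector_derivative_at[OF this] show ?thesis by (simp add: Ad_def \<Theta>_def)
  qed
  ultimately show "Ck_on k (snd c ` (fst c \<inter> UNIV)) ((\<lambda>p. Ad p v \<bullet> b) \<circ> chart_inv c)"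
    using chartD(2)[OF c] by (auto elim!: Ck_on_eq)
qed

abbreviation frame :: "'v \<Rightarrow> 'v \<Rightarrow> 'v" where
  "frame b y \<equiv> field_coords \<kappa> y b"

lemma Ck_on_frame: "Ck_on k coords (frame b)"
  by (rule Ck_on_field_coords[OF chart_at_one(1)])

text \<open>The average is taken with respect to Lebesgue measure in the chart \<open>\<kappa>\<close>; the density of a Haar measure
  would only change the kernel \<open>\<eta>\<close>.\<close>

definition mollify :: "'v \<Rightarrow> 'v \<Rightarrow> ('v \<Rightarrow> real) \<Rightarrow> ('g \<Rightarrow> real) \<Rightarrow> 'g \<Rightarrow> real" where
  "mollify l h \<eta> u p = integral (cbox l h) (\<lambda>y. \<eta> y * u (chart_inv \<kappa> y \<otimes> p))"

lemma continuous_on_translate: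
  assumes "continuous_on S u" "continuous_on T f" "continuous_on T g"
    and "\<And>x. x \<in> T \<Longrightarrow> f x \<in> coords" "\<And>x. x \<in> T \<Longrightarrow> chart_inv \<kappa> (f x) \<otimes> g x \<in> S"
  shows "continuous_on T (\<lambda>x. u (chart_inv \<kappa> (f x) \<otimes> g x))"
proof (rule continuous_on_compose2[OF assms(1)])
  have "continuous_on T (\<lambda>x. chart_inv \<kappa> (f x))"
    by (rule continuous_on_compose2[OF chartD(4)[OF chart_at_one(1)] assms(2)]) (use assms(4) in auto)
  then show "continuous_on T (\<lambda>x. chart_inv \<kappa> (f x) \<otimes> g x)"
    by (intro continuous_on_mult_group assms(3))
qed (use assms(5) in auto)

lemma continuous_on_mollify:
  assumes u: "continuous_on S u" and \<eta>: "continuous_on coords \<eta>" and B: "cbox l h \<subseteq> coords"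
    and P: "\<And>p y. p \<in> P \<Longrightarrow> y \<in> cbox l h \<Longrightarrow> chart_inv \<kappa> y \<otimes> p \<in> S"
  shows "continuous_on P (mollify l h \<eta> u)"
  unfolding mollify_def
proof (rule integral_continuous_on_param)
  have "continuous_on (P \<times> cbox l h) (\<lambda>z. \<eta> (snd z))"
    by (rule continuous_on_compose2[OF \<eta>]) (use B in \<open>auto intro!: continuous_intros\<close>)
  moreover have "continuous_on (P \<times> cbox l h) (\<lambda>z. u (chart_inv \<kappa> (snd z) \<otimes> fst z))"
    by (rule continuous_on_translate[OF u continuous_on_snd[OF continuous_on_id] continuous_on_fst[OF continuous_on_id]])
      (use B P in auto)
  ultimately show "continuous_on (P \<times> cbox l h) (\<lambda>(p, y). \<eta> y * u (chart_inv \<kappa> y \<otimes> p))"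
    by (simp add: case_prod_beta continuous_on_mult)
qed

text \<open>Right translation by \<open>E (t v)\<close> of the argument \<open>p\<close> is right translation by a conjugate
  one-parameter group of the integration variable, hence an average along the flow of a
  left-invariant field. So a horizontal derivative of a mollification is again a combination of
  mollifications, with kernels not depending on \<open>p\<close>.\<close>

lemma DERIV_mollify:
  assumes S: "open S" and u: "continuous_on S u" and B: "cbox l h \<subseteq> coords"
    and D: "compact D" "D \<subseteq> box l h" and \<eta>: "Ck_on 1 coords \<eta>" "\<And>y. y \<in> coords - D \<Longrightarrow> \<eta> y = 0"
    and p: "\<And>y. y \<in> cbox l h \<Longrightarrow> chart_inv \<kappa> y \<otimes> p \<in> S"
  shows "((\<lambda>t. mollify l h \<eta> u (p \<otimes> E (t *\<^sub>R v))) has_real_derivative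
    (\<Sum>b\<in>Basis. (Ad p v \<bullet> b) * mollify l h (field_adjoint (frame b) \<eta>) u p)) (at 0)"
proof -
  note ch = chartD[OF chart_at_one(1)]
  let ?B = "cbox l h"
  define \<sigma> where "\<sigma> t = p \<otimes> E (t *\<^sub>R v) \<otimes> inv p" for t
  define Z where "Z = Ad p v"
  have \<sigma>: "one_param Z \<sigma>"
    unfolding Z_def \<sigma>_def[abs_def] by (rule one_param_conj)
  define a where "a y = field_coords \<kappa> y Z" for y
  define Gm where "Gm z = chart_inv \<kappa> (snd z) \<otimes> \<sigma> (fst z)" for z
  define g where "g z = snd \<kappa> (Gm z)" for z
  define T where "T = coords \<inter> (\<lambda>y. chart_inv \<kappa> y \<otimes> p) -` S"
  define F where "F y = u (chart_inv \<kappa> y \<otimes> p)" for y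
  define W where "W = (UNIV \<times> coords) \<inter> Gm -` (fst \<kappa> \<inter> snd \<kappa> -` T)"
  have cont: "continuous_on coords (\<lambda>y. chart_inv \<kappa> y \<otimes> p)"
    by (intro continuous_intros ch(4))
  have T: "open T"
    unfolding T_def by (rule continuous_open_preimage[OF cont ch(2) S])
  have F: "continuous_on T F"
    unfolding F_def by (rule continuous_on_compose2[OF u continuous_on_subset[OF cont]]) (auto simp: T_def)
  have op: "open ((UNIV :: real set) \<times> coords)" by (intro open_Times open_UNIV ch(2))
  have Gm: "Ck_into 1 (UNIV \<times> coords) Gm"
    unfolding Gm_def
  proof (rule Ck_into_mult[OF op])
    show "Ck_into 1 (UNIV \<times> coords) (\<lambda>z::real \<times> 'v. chart_inv \<kappa> (snd z))"
      by (rule Ck_into_compose[OF op ch(2) Ck_into_chart_inv[OF chart_at_one(1)]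
            Ck_on_bounded_linear[OF bounded_linear_snd]]) auto
    show "Ck_into 1 (UNIV \<times> coords) (\<lambda>z::real \<times> 'v. \<sigma> (fst z))"
      using Ck_into_compose[OF op open_UNIV Ck_into_one_param[OF \<sigma>, of 1 \<one>]
          Ck_on_bounded_linear[OF bounded_linear_fst]] by simp
  qed
  have W: "open W"
    unfolding W_def
    by (intro Ck_into_open_preimage[OF Gm op] continuous_open_preimage[OF ch(3,1) T])
  have g: "Ck_on 1 W g"
    unfolding g_def by (rule Ck_on_subset[OF Ck_intoD(2)[OF Gm chart_at_one(1)]]) (auto simp: W_def)
  have g0: "Gm (0, y) = chart_inv \<kappa> y" for y
    by (simp add: Gm_def one_paramD(3)[OF \<sigma>])
  have BW: "{0} \<times> ?B \<subseteq> W"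
  proof clarify
    fix y assume y: "y \<in> ?B"
    then have "y \<in> coords" using B by blast
    then show "(0, y) \<in> W"
      using y p ch(5,6) by (auto simp: W_def g0 T_def)
  qed
  have flow: "frechet_derivative g (at (t, y)) (1, 0) = frechet_derivative g (at (t, y)) (0, a y)"
    if ty: "(t, y) \<in> W" for t y
  proof -
    let ?D = "frechet_derivative g (at (t, y))"
    have D: "(g has_derivative ?D) (at (t, y))"
      by (rule Ck_on_has_derivative[OF g _ ty]) simp
    have y: "y \<in> coords" using ty by (simp add: W_def)
    have "((\<lambda>s. g (t + s, y)) has_derivative (\<lambda>h. ?D (h, 0))) (at 0)"
      by (rule has_derivative_compose[of "\<lambda>s. (t + s, y)" "\<lambda>h. (h, 0)"])
        (use D in \<open>auto intro!: derivative_eq_intros\<close>)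
    have "((\<lambda>s. snd \<kappa> (chart_inv \<kappa> y \<otimes> \<sigma> s)) has_vector_derivative a y) (at 0)"
      using one_param_coords_derivative[OF chart_at_one(1) \<sigma>, of "chart_inv \<kappa> y" 0] ch(5,6)[OF y]
      by (simp add: one_paramD(3)[OF \<sigma>] a_def)
    then have "((\<lambda>s. (t, snd \<kappa> (chart_inv \<kappa> y \<otimes> \<sigma> s))) has_derivative (\<lambda>h. (0, h *\<^sub>R a y))) (at 0)"
      unfolding has_vector_derivative_def by (intro has_derivative_Pair has_derivative_const)
    then have d1: "((\<lambda>s. g (t, snd \<kappa> (chart_inv \<kappa> y \<otimes> \<sigma> s))) has_derivative (\<lambda>h. ?D (0, h *\<^sub>R a y))) (at 0)"
      by (rule has_derivative_compose) (use D ch(5,6)[OF y] in \<open>simp add: one_paramD(3)[OF \<sigma>]\<close>)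
    have d2: "open ((\<lambda>s. chart_inv \<kappa> y \<otimes> \<sigma> s) -` fst \<kappa>)"
      using continuous_open_preimage[OF _ open_UNIV ch(1), of "\<lambda>s. chart_inv \<kappa> y \<otimes> \<sigma> s"]
      by (simp add: continuous_intros one_paramD(1)[OF \<sigma>])
    have d3: "g (t, snd \<kappa> (chart_inv \<kappa> y \<otimes> \<sigma> s)) = g (t + s, y)"
      if "s \<in> (\<lambda>s. chart_inv \<kappa> y \<otimes> \<sigma> s) -` fst \<kappa>" for s
      using that ch(7) one_paramD(2)[OF \<sigma>, of s t] by (simp add: g_def Gm_def m_assoc add.commute)
    have "((\<lambda>s. g (t + s, y)) has_derivative (\<lambda>h. ?D (0, h *\<^sub>R a y))) (at 0)"
      by (rule has_derivative_transform_within_open[OF d1 d2 _ d3]) (use ch(5)[OF y] in \<open>simp_all add: one_paramD(3)[OF \<sigma>]\<close>)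
    from has_derivative_unique[OF \<open>((\<lambda>s. g (t + s, y)) has_derivative (\<lambda>h. ?D (h, 0))) (at 0)\<close> this]
    have "?D (1, 0) = ?D (0, 1 *\<^sub>R a y)" by metis
    then show ?thesis by simp
  qed
  have a: "Ck_on 1 coords a" unfolding a_def by (rule Ck_on_frame)
  have der: "((\<lambda>t. integral ?B (\<lambda>y. \<eta> y * F (g (t, y)))) has_real_derivative
      integral ?B (\<lambda>y. field_adjoint a \<eta> y * F y)) (at 0)"
  proof (rule has_derivative_average_along_flow[OF ch(2) B D \<eta> a W BW _ g flow _ F])
    show "g (0, y) = y" if "y \<in> ?B" for y
      using that B ch(6) by (auto simp: g_def g0)
  qed (auto simp: W_def g_def)
  obtain J where J: "0 \<in> J" "open J" "J \<times> ?B \<subseteq> W"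
    using Elementary_Topology.tube_lemma[OF compact_cbox W BW] by blast
  have "integral ?B (\<lambda>y. \<eta> y * F (g (t, y))) = mollify l h \<eta> u (p \<otimes> E (t *\<^sub>R v))" if t: "t \<in> J" for t
    unfolding mollify_def
  proof (rule integral_cong)
    fix y assume "y \<in> ?B"
    then have "(t, y) \<in> W" using J t by blast
    then have "chart_inv \<kappa> (g (t, y)) = chart_inv \<kappa> y \<otimes> \<sigma> t"
      using ch(7) by (simp add: W_def g_def Gm_def)
    then show "\<eta> y * F (g (t, y)) = \<eta> y * u (chart_inv \<kappa> y \<otimes> (p \<otimes> E (t *\<^sub>R v)))"
      by (simp add: F_def \<sigma>_def m_assoc)
  qed
  then have der': "((\<lambda>t. mollify l h \<eta> u (p \<otimes> E (t *\<^sub>R v))) has_real_derivative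
      integral ?B (\<lambda>y. field_adjoint a \<eta> y * F y)) (at 0)"
    by (intro has_field_derivative_transform_within_open[OF der J(2,1)])
  have frame: "a y = (\<Sum>b\<in>Basis. (Z \<bullet> b) *\<^sub>R frame b y)" if "y \<in> coords" for y
    using linear_field_coords[OF chart_at_one(1) that]
    unfolding a_def by (subst euclidean_representation[of Z, symmetric]) (simp add: linear_sum linear_scale)
  have contF: "continuous_on ?B F"
    by (rule continuous_on_subset[OF F]) (use B p in \<open>auto simp: T_def\<close>)
  have contA: "continuous_on ?B (field_adjoint (frame b) \<eta>)" for b
    using Ck_on_field_adjoint[OF ch(2), of 0 \<eta> "frame b"] \<eta>(1) Ck_on_frame[of 1 b] B
    by (auto intro: continuous_on_subset)
  have "integral ?B (\<lambda>y. field_adjoint a \<eta> y * F y) =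
      integral ?B (\<lambda>y. \<Sum>b\<in>Basis. (Z \<bullet> b) * (field_adjoint (frame b) \<eta> y * F y))"
  proof (rule integral_cong)
    fix y assume "y \<in> ?B"
    then have "y \<in> coords" using B by blast
    then show "field_adjoint a \<eta> y * F y = (\<Sum>b\<in>Basis. (Z \<bullet> b) * (field_adjoint (frame b) \<eta> y * F y))"
      by (subst field_adjoint_sum[OF ch(2) _ \<eta>(1) Ck_on_frame frame])
        (auto simp: sum_distrib_right mult.assoc)
  qed
  also have "\<dots> = (\<Sum>b\<in>Basis. integral ?B (\<lambda>y. (Z \<bullet> b) * (field_adjoint (frame b) \<eta> y * F y)))"
    by (rule integral_sum)
      (auto intro!: integrable_continuous continuous_on_mult continuous_on_const contA contF)
  also have "\<dots> = (\<Sum>b\<in>Basis. (Ad p v \<bullet> b) * mollify l h (field_adjoint (frame b) \<eta>) u p)"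
    by (simp add: mollify_def F_def Z_def)
  finally show ?thesis using der' by simp
qed

text \<open>The first derivatives of a mollification have as coefficients the smooth functions
  \<open>Ad p v \<bullet> b\<close> and as other factors mollifications with kernel one degree less regular. A kernel of class
  \<open>C\<^sup>2\<close> therefore admits two differentiations, however irregular the continuous function \<open>u\<close> is.\<close>

lemma Gamma2_mollify:
  assumes S: "open S" and u: "continuous_on S u" and B: "cbox l h \<subseteq> coords"
    and D: "compact D" "D \<subseteq> box l h" and \<eta>: "Ck_on 2 coords \<eta>" "\<And>y. y \<in> coords - D \<Longrightarrow> \<eta> y = 0"
    and P: "open P" "\<And>p y. p \<in> P \<Longrightarrow> y \<in> cbox l h \<Longrightarrow> chart_inv \<kappa> y \<otimes> p \<in> S"
  shows "Gamma2 G E X P (mollify l h \<eta> u)"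
proof -
  note ch = chartD[OF chart_at_one(1)]
  let ?T = "\<lambda>b. field_adjoint (frame b)"
  let ?w = "\<lambda>\<eta>. mollify l h \<eta> u"
  have \<eta>2: "Ck_on (Suc 1) coords \<eta>" using \<eta>(1) by (simp add: numeral_2_eq_2)
  have \<eta>1: "Ck_on 1 coords \<eta>" using Ck_on_SucD_le[OF \<eta>2] .
  have T1: "Ck_on 1 coords (?T b \<eta>)" for b
    by (rule Ck_on_field_adjoint[OF ch(2) \<eta>2 Ck_on_frame])
  have T1': "Ck_on (Suc 0) coords (?T b \<eta>)" for b using T1[of b] by simp
  have T1_0: "?T b \<eta> y = 0" if "y \<in> coords - D" for b y
    by (rule field_adjoint_eq_0[OF ch(2) compact_imp_closed[OF D(1)] \<eta>(2) that])
  have T2: "continuous_on coords (?T c (?T b \<eta>))" for b c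
    by (rule Ck_on_imp_continuous_on[OF Ck_on_field_adjoint[OF ch(2) T1' Ck_on_frame]])
  have cont_ad: "continuous_on P (\<lambda>p. Ad p v \<bullet> b)" for v b
    using continuous_on_subset[OF continuous_on_Ck_fun[OF Ck_fun_Ad open_UNIV]] by blast
  have cont_Xad: "continuous_on P (left_inv_field G E w (\<lambda>p. Ad p v \<bullet> b))" for v b w
    using continuous_on_subset[OF continuous_on_Ck_fun[OF Ck_fun_left_inv_field[OF Ck_fun_Ad[of "Suc 0"] open_UNIV] open_UNIV]]
    by blast
  note cont_w = continuous_on_mollify[OF u _ B P(2)]
  have cw1: "continuous_on P (?w (?T b \<eta>))" for b
    by (rule cont_w[OF Ck_on_imp_continuous_on[OF T1]])
  have cw2: "continuous_on P (?w (?T c (?T b \<eta>)))" for b c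
    by (rule cont_w[OF T2])
  define R where "R v p = (\<Sum>b\<in>Basis. (Ad p v \<bullet> b) * ?w (?T b \<eta>) p)" for v p
  have D1: "((\<lambda>t. ?w \<eta> (p \<otimes> E (t *\<^sub>R v))) has_real_derivative R v p) (at 0)" if "p \<in> P" for p v
    unfolding R_def by (rule DERIV_mollify[OF S u B D \<eta>1 \<eta>(2) P(2)[OF that]])
  have eq1: "left_inv_field G E v (?w \<eta>) p = R v p" if "p \<in> P" for p v
    unfolding left_inv_field_def by (rule DERIV_imp_deriv[OF D1[OF that]])
  define R2 where "R2 v' v p = (\<Sum>b\<in>Basis. left_inv_field G E v' (\<lambda>p. Ad p v \<bullet> b) p * ?w (?T b \<eta>) p
      + (\<Sum>c\<in>Basis. (Ad p v' \<bullet> c) * ?w (?T c (?T b \<eta>)) p) * (Ad p v \<bullet> b))" for v' v p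
  have D2: "((\<lambda>t. left_inv_field G E v (?w \<eta>) (p \<otimes> E (t *\<^sub>R v'))) has_real_derivative R2 v' v p) (at 0)"
    if p: "p \<in> P" for p v v'
  proof -
    have 1: "((\<lambda>t. Ad (p \<otimes> E (t *\<^sub>R v')) v \<bullet> b) has_real_derivative left_inv_field G E v' (\<lambda>p. Ad p v \<bullet> b) p) (at 0)" for b
      using DERIV_left_inv_field[OF Ck_fun_Ad[of 1 v b] _ one_param_exp, of p 0 v'] by simp
    have 2: "((\<lambda>t. ?w (?T b \<eta>) (p \<otimes> E (t *\<^sub>R v'))) has_real_derivative
        (\<Sum>c\<in>Basis. (Ad p v' \<bullet> c) * ?w (?T c (?T b \<eta>)) p)) (at 0)" for b
      by (rule DERIV_mollify[OF S u B D T1 T1_0 P(2)[OF p]])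
    have "((\<lambda>t. R v (p \<otimes> E (t *\<^sub>R v'))) has_real_derivative R2 v' v p) (at 0)"
      unfolding R_def R2_def using DERIV_mult[OF 1 2] by (intro DERIV_sum) simp
    moreover have "\<forall>\<^sub>F t in nhds 0. R v (p \<otimes> E (t *\<^sub>R v')) = left_inv_field G E v (?w \<eta>) (p \<otimes> E (t *\<^sub>R v'))"
      using one_param_preimage_nhds[OF one_param_exp[of v'] P(1) p] by eventually_elim (simp add: eq1)
    ultimately show ?thesis
      using DERIV_cong_ev[of 0 0 "\<lambda>t. R v (p \<otimes> E (t *\<^sub>R v'))"
          "\<lambda>t. left_inv_field G E v (?w \<eta>) (p \<otimes> E (t *\<^sub>R v'))" "R2 v' v p" "R2 v' v p"] by simp
  qed
  have eq2: "left_inv_field G E v' (left_inv_field G E v (?w \<eta>)) p = R2 v' v p" if "p \<in> P" for p v v'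
    unfolding left_inv_field_def[of _ _ v'] by (rule DERIV_imp_deriv[OF D2[OF that]])
  have diff: "f differentiable (at 0)" if "(f has_real_derivative d) (at 0)" for f d
    using that real_differentiable_def by blast
  show ?thesis
    unfolding Gamma2_def has_field_on_def
  proof (intro conjI allI ballI)
    show "continuous_on P (?w \<eta>)" by (rule cont_w[OF Ck_on_imp_continuous_on[OF \<eta>(1)]])
    show "continuous_on P (left_inv_field G E (X i) (?w \<eta>))" for i
    proof -
      have "continuous_on P (R (X i))" unfolding R_def by (intro continuous_intros cont_ad cw1)
      then show ?thesis by (rule continuous_on_eq) (simp add: eq1)
    qed
    show "continuous_on P (left_inv_field G E (X i) (left_inv_field G E (X j) (?w \<eta>)))" for i j
    proof -
      have "continuous_on P (R2 (X i) (X j))" unfolding R2_def by (intro continuous_intros cont_ad cw1 cw2 cont_Xad)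
      then show ?thesis by (rule continuous_on_eq) (simp add: eq2)
    qed
  qed (use diff D1 D2 in blast)+
qed

text \<open>Left translations map integral curves of left-invariant fields to integral curves, so an average
  of left translates of an h-convex function is h-convex.\<close>

lemma h_convex_mollify:
  assumes u: "continuous_on S u" and hc: "h_convex_on G E V S u" and B: "cbox l h \<subseteq> coords"
    and \<eta>: "continuous_on coords \<eta>" "\<And>y. \<eta> y \<ge> 0"
    and P: "\<And>p y. p \<in> P \<Longrightarrow> y \<in> cbox l h \<Longrightarrow> chart_inv \<kappa> y \<otimes> p \<in> S"
  shows "h_convex_on G E V P (mollify l h \<eta> u)"
  unfolding h_convex_on_def
proof (intro ballI impI)
  fix p v assume p: "p \<in> P" and v: "v \<in> V" and seg: "horizontal_segment G E p v \<subseteq> P"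
  let ?B = "cbox l h"
  have segP: "p \<otimes> E (t *\<^sub>R v) \<in> P" if "t \<in> {0..1}" for t
    using seg that unfolding horizontal_segment_def by blast
  have conv: "convex_on {0..1} (\<lambda>t::real. u (chart_inv \<kappa> y \<otimes> (p \<otimes> E (t *\<^sub>R v))))" if y: "y \<in> ?B" for y
  proof -
    have "horizontal_segment G E (chart_inv \<kappa> y \<otimes> p) v \<subseteq> S"
      using P[OF segP y] unfolding horizontal_segment_def by (auto simp: m_assoc)
    then have "convex_on {0..1} (\<lambda>t::real. u (chart_inv \<kappa> y \<otimes> p \<otimes> E (t *\<^sub>R v)))"
      using hc v P[OF p y] unfolding h_convex_on_def by blast
    then show ?thesis by (simp add: m_assoc)
  qed
  have cont: "continuous_on ?B (\<lambda>y. \<eta> y * u (chart_inv \<kappa> y \<otimes> q))" if "q \<in> P" for q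
  proof (intro continuous_on_mult continuous_on_subset[OF \<eta>(1) B])
    show "continuous_on ?B (\<lambda>y. u (chart_inv \<kappa> y \<otimes> q))"
      by (rule continuous_on_translate[OF u continuous_on_id continuous_on_const]) (use B P[OF that] in auto)
  qed
  show "convex_on {0..1} (\<lambda>t::real. mollify l h \<eta> u (p \<otimes> E (t *\<^sub>R v)))"
  proof (rule convex_onI)
    fix s x y :: real assume s: "0 < s" "s < 1" and xy: "x \<in> {0..1}" "y \<in> {0..1}"
    let ?z = "(1 - s) *\<^sub>R x + s *\<^sub>R y"
    let ?q = "\<lambda>t. p \<otimes> E (t *\<^sub>R v)"
    have z: "?z \<in> {0..1}"
      using convexD[OF convex_real_interval(5)[of 0 1] xy, of "1 - s" s] s by simp
    have "mollify l h \<eta> u (?q ?z) \<le> integral ?B (\<lambda>\<omega>. (1 - s) * (\<eta> \<omega> * u (chart_inv \<kappa> \<omega> \<otimes> ?q x))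
        + s * (\<eta> \<omega> * u (chart_inv \<kappa> \<omega> \<otimes> ?q y)))"
      unfolding mollify_def
    proof (rule integral_le)
      show "(\<lambda>\<omega>. \<eta> \<omega> * u (chart_inv \<kappa> \<omega> \<otimes> ?q ?z)) integrable_on ?B"
        by (intro integrable_continuous cont segP z)
      show "(\<lambda>\<omega>. (1 - s) * (\<eta> \<omega> * u (chart_inv \<kappa> \<omega> \<otimes> ?q x)) + s * (\<eta> \<omega> * u (chart_inv \<kappa> \<omega> \<otimes> ?q y))) integrable_on ?B"
        by (intro integrable_continuous continuous_on_add continuous_on_mult continuous_on_const cont segP xy)
      fix \<omega> assume "\<omega> \<in> ?B"
      from convex_onD[OF conv[OF this], of s x y] s xy
      have "u (chart_inv \<kappa> \<omega> \<otimes> ?q ?z) \<le> (1 - s) * u (chart_inv \<kappa> \<omega> \<otimes> ?q x) + s * u (chart_inv \<kappa> \<omega> \<otimes> ?q y)"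
        by simp
      from mult_left_mono[OF this \<eta>(2)]
      show "\<eta> \<omega> * u (chart_inv \<kappa> \<omega> \<otimes> ?q ?z) \<le>
        (1 - s) * (\<eta> \<omega> * u (chart_inv \<kappa> \<omega> \<otimes> ?q x)) + s * (\<eta> \<omega> * u (chart_inv \<kappa> \<omega> \<otimes> ?q y))"
        by (simp add: algebra_simps)
    qed
    also have "\<dots> = (1 - s) * mollify l h \<eta> u (?q x) + s * mollify l h \<eta> u (?q y)"
      unfolding mollify_def
      by (subst integral_add)
        (auto intro!: integrable_continuous continuous_on_mult continuous_on_const cont segP xy)
    finally show "mollify l h \<eta> u (?q ?z) \<le> (1 - s) * mollify l h \<eta> u (?q x) + s * mollify l h \<eta> u (?q y)" .
  qed simp
qed

text \<open>The only requirement on the support of the kernel is that all its left translations move the compact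
  set \<open>K\<close> so little that \<open>K\<close> stays in \<open>S\<close> and \<open>u\<close> changes by less than \<open>\<epsilon>\<close>; both follow from the tube
  lemma applied to \<open>{\<one>} \<times> K\<close>.\<close>

lemma h_convex_approximation:
  assumes S: "open S" and u: "continuous_on S u" and hc: "h_convex_on G E V S u"
    and K: "compact K" "K \<subseteq> S" and P: "open P" "P \<subseteq> K" and \<epsilon>: "\<epsilon> > 0"
  obtains w where "Gamma2 G E X P w" "h_convex_on G E V P w" "\<And>p. p \<in> P \<Longrightarrow> \<bar>w p - u p\<bar> \<le> \<epsilon>"
proof -
  note ch = chartD[OF chart_at_one(1)]
  have e0: "e0 \<in> coords" "chart_inv \<kappa> e0 = \<one>" using chart_at_one(2) ch(7) by auto
  define W1 where "W1 = (coords \<times> S) \<inter> (\<lambda>z. chart_inv \<kappa> (fst z) \<otimes> snd z) -` S"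
  have W1: "open W1"
    unfolding W1_def
    by (rule continuous_open_preimage[OF _ open_Times[OF ch(2) S] S])
      (auto intro!: continuous_intros continuous_on_compose2[OF ch(4)])
  define W2 where "W2 = W1 \<inter> (\<lambda>z. \<bar>u (chart_inv \<kappa> (fst z) \<otimes> snd z) - u (snd z)\<bar>) -` {..<\<epsilon>}"
  have "continuous_on W1 (\<lambda>z. u (chart_inv \<kappa> (fst z) \<otimes> snd z))"
    by (rule continuous_on_translate[OF u continuous_on_fst[OF continuous_on_id] continuous_on_snd[OF continuous_on_id]])
      (auto simp: W1_def)
  moreover have "continuous_on W1 (\<lambda>z. u (snd z))"
    by (rule continuous_on_compose2[OF u]) (auto simp: W1_def intro!: continuous_intros)
  ultimately have "continuous_on W1 (\<lambda>z. \<bar>u (chart_inv \<kappa> (fst z) \<otimes> snd z) - u (snd z)\<bar>)"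
    by (intro continuous_intros)
  then have W2: "open W2"
    unfolding W2_def by (rule continuous_open_preimage[OF _ W1 open_lessThan])
  have "{e0} \<times> K \<subseteq> W2"
    using K(2) e0 \<epsilon> by (auto simp: W2_def W1_def)
  from Elementary_Topology.tube_lemma[OF K(1) W2 this]
  obtain X0 where X0: "e0 \<in> X0" "open X0" "X0 \<times> K \<subseteq> W2" by blast
  obtain l h where lh: "cbox l h \<subseteq> X0 \<inter> coords" "e0 \<in> box l h" "\<forall>i\<in>Basis. l \<bullet> i < h \<bullet> i"
    using open_contains_cbox[OF open_Int[OF X0(2) ch(2)] IntI[OF X0(1) e0(1)]] .
  let ?B = "cbox l h"
  obtain \<rho> where \<rho>: "\<rho> > 0" "cball e0 \<rho> \<subseteq> box l h"
    using lh(2) open_box[of l h] unfolding open_contains_cball by blast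
  define \<psi> where "\<psi> y = cubic_part (\<rho>\<^sup>2 - (y - e0) \<bullet> (y - e0))" for y
  have \<psi>: "Ck_on 2 UNIV \<psi>"
    unfolding \<psi>_def
    by (rule Ck_on_compose[OF open_UNIV open_UNIV _ Ck_on_cubic_part])
      (intro Ck_on_diff Ck_on_const Ck_on_inner Ck_on_id open_UNIV, simp)
  have cont\<psi>: "continuous_on T \<psi>" for T
    using Ck_on_imp_continuous_on[OF \<psi>] continuous_on_subset by blast
  have \<psi>0: "\<psi> y = 0" if "y \<notin> cball e0 \<rho>" for y
  proof -
    have "\<rho> \<le> norm (y - e0)" using that by (simp add: dist_norm norm_minus_commute)
    then have "\<rho>\<^sup>2 \<le> (norm (y - e0))\<^sup>2" using \<rho>(1) by (intro power_mono) auto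
    then show ?thesis unfolding \<psi>_def by (intro cubic_part_simps(1)) (simp add: power2_norm_eq_inner)
  qed
  have e0B: "e0 \<in> ?B" using lh(2) box_subset_cbox by blast
  define I where "I = integral ?B \<psi>"
  have "I \<noteq> 0"
  proof
    assume "I = 0"
    moreover have "box l h \<noteq> {}" using lh(2) by blast
    ultimately have "\<forall>y\<in>?B. \<psi> y = 0"
      using integral_cbox_eq_0_iff[OF cont\<psi>, of l h] cubic_part_simps(3) by (simp add: I_def \<psi>_def)
    then have "\<psi> e0 = 0" using e0B by blast
    then show False using cubic_part_simps(2)[of "\<rho>\<^sup>2"] \<rho>(1) by (simp add: \<psi>_def)
  qed
  moreover have "I \<ge> 0"
    unfolding I_def by (rule integral_nonneg)
      (auto intro: integrable_continuous cont\<psi> simp: \<psi>_def cubic_part_simps(3))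
  ultimately have I: "I > 0" by simp
  define \<eta> where "\<eta> y = \<psi> y * (1 / I)" for y
  have \<eta>: "Ck_on 2 coords \<eta>"
    unfolding \<eta>_def by (intro Ck_on_mult Ck_on_const ch(2) Ck_on_subset[OF \<psi>]) simp
  have \<eta>0: "\<eta> y \<ge> 0" for y using I cubic_part_simps(3) by (simp add: \<eta>_def \<psi>_def)
  have int\<eta>: "integral ?B \<eta> = 1" using I by (simp add: \<eta>_def[abs_def] I_def)
  have cont\<eta>: "continuous_on T \<eta>" for T unfolding \<eta>_def[abs_def] by (intro continuous_intros cont\<psi>)
  have W2D: "(y, p) \<in> W2" if "p \<in> P" "y \<in> ?B" for p y using X0(3) lh(1) P(2) that by blast
  have inS: "chart_inv \<kappa> y \<otimes> p \<in> S" if "p \<in> P" "y \<in> ?B" for p y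
    using W2D[OF that] by (simp add: W2_def W1_def)
  have B: "?B \<subseteq> coords" using lh(1) by blast
  show thesis
  proof
    show "Gamma2 G E X P (mollify l h \<eta> u)"
      by (rule Gamma2_mollify[OF S u B compact_cball \<rho>(2) \<eta> _ P(1) inS]) (use \<psi>0 in \<open>auto simp: \<eta>_def\<close>)
    show "h_convex_on G E V P (mollify l h \<eta> u)"
      by (rule h_convex_mollify[OF u hc B cont\<eta> \<eta>0 inS])
    fix p assume p: "p \<in> P"
    have cont: "continuous_on ?B (\<lambda>y. u (chart_inv \<kappa> y \<otimes> p))"
      by (rule continuous_on_translate[OF u continuous_on_id continuous_on_const]) (use B inS[OF p] in auto)
    have "mollify l h \<eta> u p - u p = mollify l h \<eta> u p - integral ?B (\<lambda>y. \<eta> y * u p)"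
      using int\<eta> by simp
    also have "\<dots> = integral ?B (\<lambda>y. \<eta> y * (u (chart_inv \<kappa> y \<otimes> p) - u p))"
      unfolding mollify_def right_diff_distrib
      by (rule integral_diff[symmetric]; intro integrable_continuous continuous_on_mult cont\<eta> cont continuous_on_const)
    also have "\<bar>\<dots>\<bar> \<le> integral ?B (\<lambda>y. \<bar>\<eta> y\<bar>) * \<epsilon>"
      by (rule integral_weighted_bound[OF cont\<eta>])
        (use W2D[OF p] in \<open>auto intro!: continuous_on_diff cont continuous_on_const simp: W2_def less_imp_le\<close>)
    also have "\<dots> = \<epsilon>" using int\<eta> \<eta>0 by simp
    finally show "\<bar>mollify l h \<eta> u p - u p\<bar> \<le> \<epsilon>" .
  qed
qed

end

section \<open>The equivalence\<close>

context lie_group_exp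
begin

lemma h_convex_limit:
  assumes w: "\<And>k. h_convex_on G E V S (w k)" and lim: "\<And>p. p \<in> S \<Longrightarrow> (\<lambda>k. w k p) \<longlonglongrightarrow> u p"
  shows "h_convex_on G E V S u"
  unfolding h_convex_on_def
proof (intro ballI impI)
  fix p v assume p: "p \<in> S" and v: "v \<in> V" and seg: "horizontal_segment G E p v \<subseteq> S"
  have inS: "p \<otimes> E (t *\<^sub>R v) \<in> S" if "t \<in> {0..1}" for t
    using seg that unfolding horizontal_segment_def by blast
  show "convex_on {0..1} (\<lambda>t::real. u (p \<otimes> E (t *\<^sub>R v)))"
  proof (rule convex_onI)
    fix s x y :: real assume s: "0 < s" "s < 1" and xy: "x \<in> {0..1}" "y \<in> {0..1}"
    let ?q = "\<lambda>t. p \<otimes> E (t *\<^sub>R v)"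
    have z: "(1 - s) *\<^sub>R x + s *\<^sub>R y \<in> {0..1}"
      using convexD[OF convex_real_interval(5)[of 0 1] xy, of "1 - s" s] s by simp
    show "u (?q ((1 - s) *\<^sub>R x + s *\<^sub>R y)) \<le> (1 - s) * u (?q x) + s * u (?q y)"
    proof (rule LIMSEQ_le)
      show "(\<lambda>k. w k (?q ((1 - s) *\<^sub>R x + s *\<^sub>R y))) \<longlonglongrightarrow> u (?q ((1 - s) *\<^sub>R x + s *\<^sub>R y))"
        by (intro lim inS z)
      show "(\<lambda>k. (1 - s) * w k (?q x) + s * w k (?q y)) \<longlonglongrightarrow> (1 - s) * u (?q x) + s * u (?q y)"
        by (intro tendsto_intros lim inS xy)
      have "convex_on {0..1} (\<lambda>t::real. w k (?q t))" for k
        using w p v seg unfolding h_convex_on_def by blast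
      from convex_onD[OF this _ _ xy, of s] s
      show "\<exists>N. \<forall>k\<ge>N. w k (?q ((1 - s) *\<^sub>R x + s *\<^sub>R y)) \<le> (1 - s) * w k (?q x) + s * w k (?q y)"
        by (intro exI[of _ 0] allI impI) simp
    qed
  qed simp
qed

lemma small_domain:
  fixes S :: "'g set"
  assumes "open S" "p \<in> S"
  obtains T where "open_domain T" "compactly_contained T S" "p \<in> T"
proof -
  obtain c where c: "c \<in> A" "p \<in> fst c" using chart_around .
  note ch = chartD[OF c(1)]
  have "open (snd c ` (fst c \<inter> S))" by (rule open_chart_image[OF chart[OF c(1)] assms(1)])
  moreover have "snd c p \<in> snd c ` (fst c \<inter> S)" using c(2) assms(2) by blast
  ultimately obtain r where r: "r > 0" "cball (snd c p) r \<subseteq> snd c ` (fst c \<inter> S)"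
    unfolding open_contains_cball by blast
  define T where "T = chart_inv c ` ball (snd c p) r"
  define K where "K = chart_inv c ` cball (snd c p) r"
  have r': "cball (snd c p) r \<subseteq> snd c ` fst c" using r(2) by blast
  have cont: "continuous_on (cball (snd c p) r) (chart_inv c)"
    by (rule continuous_on_subset[OF ch(4) r'])
  have K: "compact K" unfolding K_def by (rule compact_continuous_image[OF cont compact_cball])
  have KS: "K \<subseteq> S"
  proof
    fix q assume "q \<in> K"
    then obtain x where x: "x \<in> cball (snd c p) r" "q = chart_inv c x" unfolding K_def by blast
    then obtain q' where "q' \<in> fst c \<inter> S" "x = snd c q'" using r(2) by blast
    then show "q \<in> S" using x(2) ch(7) by simp
  qed
  have TK: "T \<subseteq> K" unfolding T_def K_def by (intro image_mono ball_subset_cball)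
  have T_eq: "T = fst c \<inter> snd c -` ball (snd c p) r"
  proof (intro equalityI subsetI)
    fix q assume "q \<in> T"
    then obtain x where x: "x \<in> ball (snd c p) r" "q = chart_inv c x" unfolding T_def by blast
    then have "x \<in> snd c ` fst c" using r' by auto
    then show "q \<in> fst c \<inter> snd c -` ball (snd c p) r" using x ch(5,6) by simp
  next
    fix q assume "q \<in> fst c \<inter> snd c -` ball (snd c p) r"
    then show "q \<in> T" unfolding T_def by (intro image_eqI[of _ _ "snd c q"]) (simp_all add: ch(7))
  qed
  have "open T" unfolding T_eq by (rule continuous_open_preimage[OF ch(3,1) open_ball])
  moreover have "connected T"
    unfolding T_def
    by (rule connected_continuous_image[OF continuous_on_subset[OF cont ball_subset_cball] connected_ball])
  moreover have pT: "p \<in> T" using c(2) r(1) by (simp add: T_eq)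
  ultimately have "open_domain T" by (auto simp: open_domain_def)
  moreover have "closure T \<subseteq> K" by (rule closure_minimal[OF TK compact_imp_closed[OF K]])
  then have "compactly_contained T S"
    using compact_Int_closed[OF K closed_closure[of T]] KS
    by (auto simp: compactly_contained_def Int_absorb1)
  ultimately show thesis using that pT by blast
qed

lemma v_convex_if_approximable:
  fixes X :: "'m::finite \<Rightarrow> 'v"
  assumes S: "open S" and u: "continuous_on S u"
    and approx: "\<forall>T. open_domain T \<and> compactly_contained T S \<longrightarrow>
      (\<exists>w :: nat \<Rightarrow> 'g \<Rightarrow> real. (\<forall>k. h_convex_on G E (span (range X)) T (w k)) \<and> uniform_limit T w u sequentially)"
  shows "v_convex_on G A E X S u"
proof (rule locally_h_convex_imp_v_convex[OF S u subspace_span span_superset])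
  fix p assume "p \<in> S"
  from small_domain[OF S this] obtain T where T: "open_domain T" "compactly_contained T S" "p \<in> T" .
  then obtain w :: "nat \<Rightarrow> 'g \<Rightarrow> real" where w: "\<And>k. h_convex_on G E (span (range X)) T (w k)"
    "uniform_limit T w u sequentially"
    using approx by blast
  have "h_convex_on G E (span (range X)) T u"
    by (rule h_convex_limit[OF w(1) tendsto_uniform_limitI[OF w(2)]])
  then show "\<exists>T. open T \<and> p \<in> T \<and> h_convex_on G E (span (range X)) T u"
    using T by (auto simp: open_domain_def)
qed

lemma v_convex_imp_approximable:
  fixes X :: "'m::finite \<Rightarrow> 'v"
  assumes S: "open S" and u: "continuous_on S u" and vc: "v_convex_on G A E X S u"
    and T: "open_domain T" "compactly_contained T S"
  obtains w :: "nat \<Rightarrow> 'g \<Rightarrow> real" where "\<forall>k. Gamma2 G E X T (w k)"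
    "\<forall>k. h_convex_on G E (span (range X)) T (w k)" "uniform_limit T w u sequentially"
proof -
  have T': "open T" "compact (closure T)" "closure T \<subseteq> S"
    using T by (auto simp: open_domain_def compactly_contained_def)
  have hc: "h_convex_on G E (span (range X)) S u"
    by (rule v_convex_imp_h_convex[OF S u vc])
  have "\<exists>w. Gamma2 G E X T w \<and> h_convex_on G E (span (range X)) T w \<and> (\<forall>p\<in>T. \<bar>w p - u p\<bar> \<le> 1 / Suc k)" for k
  proof -
    have "1 / real (Suc k) > 0" by simp
    from h_convex_approximation[OF S u hc T'(2,3,1) closure_subset this, of X]
    show ?thesis by metis
  qed
  then obtain w where w: "\<And>k. Gamma2 G E X T (w k)" "\<And>k. h_convex_on G E (span (range X)) T (w k)"
    "\<And>k p. p \<in> T \<Longrightarrow> \<bar>w k p - u p\<bar> \<le> 1 / Suc k"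
    by metis
  have "uniform_limit T w u sequentially"
  proof (rule uniform_limitI)
    fix e :: real assume "e > 0"
    then obtain N where N: "1 / real (Suc N) < e" using nat_approx_posE by blast
    show "\<forall>\<^sub>F k in sequentially. \<forall>p\<in>T. dist (w k p) (u p) < e"
    proof (rule eventually_sequentiallyI, intro ballI)
      fix k p assume k: "N \<le> k" and p: "p \<in> T"
      have "\<bar>w k p - u p\<bar> \<le> 1 / Suc k" by (rule w(3)[OF p])
      also have "\<dots> \<le> 1 / Suc N" using k by (intro divide_left_mono) auto
      finally show "dist (w k p) (u p) < e" using N by (simp add: dist_real_def)
    qed
  qed
  then show thesis using that[of w] w(1,2) by blast
qed

end

sublocale carnot_group \<subseteq> lie_group_exp
  by unfold_locales (rule chart_at_one exponential)+

theorem corollaryB: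
  fixes G :: "'g::{t2_space, second_countable_topology} monoid"
    and A :: "('g, 'v::euclidean_space) chart set"
    and \<kappa> :: "('g, 'v) chart" and E :: "'v \<Rightarrow> 'g"
    and r :: nat and V :: "nat \<Rightarrow> 'v set" and X :: "'m::finite \<Rightarrow> 'v"
    and \<Omega> :: "'g set" and u :: "'g \<Rightarrow> real"
  assumes "carnot_group G A \<kappa> E r V"
    and "orthonormal_basis (V 1) X"
    and "open_domain \<Omega>" and "bounded_in_group E \<Omega>"
    and "continuous_on \<Omega> u"
  shows "(v_convex_on G A E X \<Omega> u \<longleftrightarrow>
            (\<forall>\<Omega>'. open_domain \<Omega>' \<and> compactly_contained \<Omega>' \<Omega> \<longrightarrow>
               (\<exists>w :: nat \<Rightarrow> 'g \<Rightarrow> real.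
                  (\<forall>k. Gamma2 G E X \<Omega>' (w k) \<and> v_convex_on G A E X \<Omega>' (w k)) \<and>
                  uniform_limit \<Omega>' w u sequentially))) \<and>
         (v_convex_on G A E X \<Omega> u \<longleftrightarrow>
            (\<forall>\<Omega>'. open_domain \<Omega>' \<and> compactly_contained \<Omega>' \<Omega> \<longrightarrow>
               (\<exists>w :: nat \<Rightarrow> 'g \<Rightarrow> real.
                  (\<forall>k. Gamma2 G E X \<Omega>' (w k) \<and> h_convex_on G E (V 1) \<Omega>' (w k)) \<and>
                  uniform_limit \<Omega>' w u sequentially)))"
proof -
  interpret carnot_group G A \<kappa> E r V by (rule assms(1))
  have V1: "V 1 = span (range X)"
    using assms(2) unfolding orthonormal_basis_def by simp
  have \<Omega>: "open \<Omega>" using assms(3) by (simp add: open_domain_def)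
  \<comment> \<open>Every \<open>\<Gamma>\<^sup>2\<close> function is continuous, so (b) and (c) are about the same approximating sequences.\<close>
  have Gamma2_v_iff_h: "v_convex_on G A E X T w \<longleftrightarrow> h_convex_on G E (V 1) T w"
    if "open_domain T" "Gamma2 G E X T w" for T w
  proof -
    have T: "open T" "continuous_on T w"
      using that by (auto simp: open_domain_def Gamma2_def)
    show ?thesis
      unfolding V1
      using v_convex_imp_h_convex[OF T] locally_h_convex_imp_v_convex[OF T subspace_span span_superset] T(1)
      by blast
  qed
  let ?approx = "\<lambda>C. \<forall>\<Omega>'. open_domain \<Omega>' \<and> compactly_contained \<Omega>' \<Omega> \<longrightarrow>
    (\<exists>w :: nat \<Rightarrow> 'g \<Rightarrow> real. (\<forall>k. Gamma2 G E X \<Omega>' (w k) \<and> C \<Omega>' (w k)) \<and> uniform_limit \<Omega>' w u sequentially)"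
  have h: "v_convex_on G A E X \<Omega> u \<longleftrightarrow> ?approx (h_convex_on G E (V 1))"
  proof
    assume vc: "v_convex_on G A E X \<Omega> u"
    show "?approx (h_convex_on G E (V 1))"
    proof (intro allI impI)
      fix T assume T: "open_domain T \<and> compactly_contained T \<Omega>"
      obtain w :: "nat \<Rightarrow> 'g \<Rightarrow> real" where "\<forall>k. Gamma2 G E X T (w k)"
        "\<forall>k. h_convex_on G E (span (range X)) T (w k)" "uniform_limit T w u sequentially"
        using v_convex_imp_approximable[OF \<Omega> assms(5) vc conjunct1[OF T] conjunct2[OF T]] .
      then show "\<exists>w :: nat \<Rightarrow> 'g \<Rightarrow> real. (\<forall>k. Gamma2 G E X T (w k) \<and> h_convex_on G E (V 1) T (w k)) \<and>
          uniform_limit T w u sequentially"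
        unfolding V1 by blast
    qed
  next
    assume "?approx (h_convex_on G E (V 1))"
    then show "v_convex_on G A E X \<Omega> u"
      unfolding V1 by (intro v_convex_if_approximable[OF \<Omega> assms(5)]) blast
  qed
  moreover have "?approx (v_convex_on G A E X) \<longleftrightarrow> ?approx (h_convex_on G E (V 1))"
    using Gamma2_v_iff_h by blast
  ultimately show ?thesis by blast
qed

end
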